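(* Let $V$ be a real vector space of dimension $b$ with a quadratic form $q$ of signature $(3,b-3)$, let $\mathbb{P}\mathrm{er}$ be its period space, and let $g$ be a Riemannian metric on $\mathbb{P}\mathrm{er}$. Then the sub-twistor metric on $\mathbb{P}\mathrm{er}$ is Finsler. That is, there is a continuous function $\nu:T\mathbb{P}\mathrm{er}\to[0,\infty)$ which restricts to a norm on each tangent space, such that the sub-twistor distance between any $x,y\in\mathbb{P}\mathrm{er}$ equals $\inf_\gamma\int_0^t\nu(\dot\gamma(s))\,ds$, where the infimum is over all piecewise smooth paths $\gamma:[0,t]\to\mathbb{P}\mathrm{er}$ from $x$ to $y$.
   Context: Period space: $\mathbb{P}\mathrm{er}$ is the set of all oriented two-dimensional subspaces $E\subset V$ on which $q$ is positive definite; it is an open subset of the Grassmannian $Gr^+(2,V)$ of oriented $2$-planes, hence a manifold. Twistor sphere: for a three-dimensional subspace $T\subset V$ on which $q$ is positive definite, $\mathrm{Tw}_T=\{L\in Gr^+(2,V): L\subset T\}\subset\mathbb{P}\mathrm{er}$. Sub-twistor cone: for $p\in\mathbb{P}\mathrm{er}$, $D^{tw}_p=\bigcup_S T_pS\subset T_p\mathbb{P}\mathrm{er}$, the union being over all twistor spheres $S$ passing through $p$. Sub-twistor metric (with respect to $g$): $d(x,y)=\inf_\gamma\int_0^t\sqrt{g(\dot\gamma(s),\dot\gamma(s))}\,ds$, the infimum being over all piecewise smooth paths $\gamma:[0,t]\to\mathbb{P}\mathrm{er}$ with $\gamma(0)=x$, $\gamma(t)=y$ and $\dot\gamma(s)\in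 D^{tw}_{\gamma(s)}$ whenever $\dot\gamma(s)$ is defined. Finsler norms are only required to be continuous, not smooth. *)

theory Defs
  imports "HOL-Analysis.Analysis"
begin

section \<open>Smooth maps and submanifolds of Euclidean space\<close>

text \<open>For \<open>U\<close> open (and a finite-dimensional domain), \<open>Ck k U f\<close> says that \<open>f\<close> is \<open>k\<close> times
  continuously differentiable on \<open>U\<close>; derivatives are taken along fixed directions.\<close>

primrec Ck ::
  "nat \<Rightarrow> 'a::euclidean_space set \<Rightarrow> ('a \<Rightarrow> 'b::euclidean_space) \<Rightarrow> bool" where
  "Ck 0 U f \<longleftrightarrow> continuous_on U f"
| "Ck (Suc k) U f \<longleftrightarrow> (\<forall>x\<in>U. f differentiable (at x)) \<and>
     (\<forall>v. Ck k U (\<lambda>x. frechet_derivative f (at x) v))"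

text \<open>Smoothness on an arbitrary subset \<open>S\<close>: local extendability to smooth maps on open sets.
  For \<open>S\<close> a submanifold or a compact interval this is the usual notion.\<close>

definition smooth_map ::
  "'a::euclidean_space set \<Rightarrow> ('a \<Rightarrow> 'b::euclidean_space) \<Rightarrow> bool" where
  "smooth_map S f \<longleftrightarrow>
     (\<forall>x\<in>S. \<exists>U F. open U \<and> x \<in> U \<and> (\<forall>k. Ck k U F) \<and> (\<forall>y\<in>U \<inter> S. F y = f y))"

text \<open>In the following \<open>M\<close> is an embedded submanifold of a Euclidean space.\<close>

definition tangent_space :: "'e::euclidean_space set \<Rightarrow> 'e \<Rightarrow> 'e set" where
  "tangent_space M x = {v. \<exists>\<epsilon>>0. \<exists>c::real \<Rightarrow> 'e.
     smooth_map {-\<epsilon><..<\<epsilon>} c \<and> c ` {-\<epsilon><..<\<epsilon>} \<subseteq> M \<and> c 0 = x \<and>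
     (c has_vector_derivative v) (at 0)}"

definition tangent_bundle :: "'e::euclidean_space set \<Rightarrow> ('e \<times> 'e) set" where
  "tangent_bundle M = {(x, v). x \<in> M \<and> v \<in> tangent_space M x}"

text \<open>Smoothness of a metric \<open>g\<close> is smoothness of the function \<open>(x, v, w) \<mapsto> g x v w\<close> on the
  Whitney sum of two copies of the tangent bundle.\<close>

definition riemannian_metric ::
  "'e::euclidean_space set \<Rightarrow> ('e \<Rightarrow> 'e \<Rightarrow> 'e \<Rightarrow> real) \<Rightarrow> bool" where
  "riemannian_metric M g \<longleftrightarrow>
     (\<forall>x\<in>M.
        (\<forall>v\<in>tangent_space M x. \<forall>w\<in>tangent_space M x. g x v w = g x w v) \<and>
        (\<forall>u\<in>tangent_space M x. \<forall>v\<in>tangent_space M x. \<forall>w\<in>tangent_space M x. \<forall>a.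
           g x (a *\<^sub>R u + v) w = a * g x u w + g x v w) \<and>
        (\<forall>v\<in>tangent_space M x. v \<noteq> 0 \<longrightarrow> g x v v > 0)) \<and>
     smooth_map {(x, v, w). x \<in> M \<and> v \<in> tangent_space M x \<and> w \<in> tangent_space M x}
       (\<lambda>(x, v, w). g x v w)"

definition finsler_norm ::
  "'e::euclidean_space set \<Rightarrow> ('e \<Rightarrow> 'e \<Rightarrow> real) \<Rightarrow> bool" where
  "finsler_norm M \<nu> \<longleftrightarrow>
     continuous_on (tangent_bundle M) (\<lambda>(x, v). \<nu> x v) \<and>
     (\<forall>x\<in>M.
        (\<forall>v\<in>tangent_space M x. \<nu> x v \<ge> 0) \<and>
        (\<forall>v\<in>tangent_space M x. \<nu> x v = 0 \<longleftrightarrow> v = 0) \<and>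
        (\<forall>v\<in>tangent_space M x. \<forall>a. \<nu> x (a *\<^sub>R v) = \<bar>a\<bar> * \<nu> x v) \<and>
        (\<forall>v\<in>tangent_space M x. \<forall>w\<in>tangent_space M x. \<nu> x (v + w) \<le> \<nu> x v + \<nu> x w))"

text \<open>Each piece is smooth up to both of its end points, and consecutive pieces share an end
  point, so these paths are continuous.\<close>

definition piecewise_smooth :: "real \<Rightarrow> (real \<Rightarrow> 'e::euclidean_space) \<Rightarrow> bool" where
  "piecewise_smooth t c \<longleftrightarrow>
     (\<exists>(n::nat) \<tau>::nat \<Rightarrow> real. \<tau> 0 = 0 \<and> \<tau> n = t \<and>
        (\<forall>i<n. \<tau> i < \<tau> (Suc i) \<and> smooth_map {\<tau> i..\<tau> (Suc i)} c))"

definition paths :: "'e::euclidean_space set \<Rightarrow> 'e \<Rightarrow> 'e \<Rightarrow> (real \<times> (real \<Rightarrow> 'e)) set" where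
  "paths M x y = {(t, c). 0 < t \<and> piecewise_smooth t c \<and> c ` {0..t} \<subseteq> M \<and> c 0 = x \<and> c t = y}"

text \<open>The velocity is undefined, hence arbitrary here, only at finitely many break points, which
  do not affect the integral.\<close>

definition path_len ::
  "('e::euclidean_space \<Rightarrow> 'e \<Rightarrow> real) \<Rightarrow> real \<times> (real \<Rightarrow> 'e) \<Rightarrow> real" where
  "path_len \<nu> = (\<lambda>(t, c).
     integral {0..t} (\<lambda>s. \<nu> (c s) (vector_derivative c (at s within {0..t}))))"

text \<open>Infima are taken in the extended reals, where the infimum of the empty set is infinite.\<close>

definition finsler_dist ::
  "'e::euclidean_space set \<Rightarrow> ('e \<Rightarrow> 'e \<Rightarrow> real) \<Rightarrow> 'e \<Rightarrow> 'e \<Rightarrow> ereal" where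
  "finsler_dist M \<nu> x y = (INF c\<in>paths M x y. ereal (path_len \<nu> c))"


section \<open>Quadratic forms\<close>

definition quadratic_form :: "('v::real_vector \<Rightarrow> real) \<Rightarrow> bool" where
  "quadratic_form q \<longleftrightarrow> (\<exists>B. bilinear B \<and> (\<forall>x y. B x y = B y x) \<and> (\<forall>x. q x = B x x))"

definition has_signature :: "('v::euclidean_space \<Rightarrow> real) \<Rightarrow> nat \<Rightarrow> nat \<Rightarrow> bool" where
  "has_signature q r s \<longleftrightarrow> r + s = DIM('v) \<and>
     (\<exists>e::nat \<Rightarrow> 'v. inj_on e {..<r + s} \<and> independent (e ` {..<r + s}) \<and>
        (\<forall>a::nat \<Rightarrow> real. q (\<Sum>i<r + s. a i *\<^sub>R e i) =
           (\<Sum>i<r. (a i)\<^sup>2) - (\<Sum>i=r..<r + s. (a i)\<^sup>2)))"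

definition pos_def_on :: "('v::real_vector \<Rightarrow> real) \<Rightarrow> 'v set \<Rightarrow> bool" where
  "pos_def_on q E \<longleftrightarrow> (\<forall>x\<in>E. x \<noteq> 0 \<longrightarrow> q x > 0)"


section \<open>Oriented planes\<close>

text \<open>An oriented plane is the set of its positively oriented ordered bases.\<close>

definition oriented_span :: "'v::real_vector \<Rightarrow> 'v \<Rightarrow> ('v \<times> 'v) set" where
  "oriented_span u v =
     {(a *\<^sub>R u + b *\<^sub>R v, c *\<^sub>R u + d *\<^sub>R v) | a b c d. a * d - b * c > 0}"

definition oriented_planes :: "('v::real_vector \<times> 'v) set set" where
  "oriented_planes = {oriented_span u v | u v. u \<noteq> v \<and> independent {u, v}}"

definition underlying :: "('v::real_vector \<times> 'v) set \<Rightarrow> 'v set" where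
  "underlying L = span (fst ` L)"

text \<open>The manifold structure on the set of oriented planes is that of a submanifold of the space
  of skew-symmetric matrices: an oriented plane is sent to the unit vector in the direction of its
  Pluecker coordinates. This is injective (\<open>inj_on_pluecker\<close> below) and is the standard
  embedding of the oriented Grassmannian into the unit sphere of bivectors; from now on oriented
  planes are identified with their images. The standard inner product on \<open>real ^ 'n\<close> enters
  only through the normalisation, and the smooth structure does not depend on it.\<close>

definition wedge :: "real ^ 'n \<Rightarrow> real ^ 'n \<Rightarrow> real ^ 'n ^ 'n" where
  "wedge u v = (\<chi> i j. u $ i * v $ j - u $ j * v $ i)"

definition pluecker :: "((real ^ 'n) \<times> (real ^ 'n)) set \<Rightarrow> real ^ 'n ^ 'n" where
  "pluecker L = the_elem ((\<lambda>(u, v). sgn (wedge u v)) ` L)"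

definition Per :: "(real ^ 'n \<Rightarrow> real) \<Rightarrow> (real ^ 'n ^ 'n) set" where
  "Per q = pluecker ` {L \<in> oriented_planes. pos_def_on q (underlying L)}"

definition Tw :: "(real ^ 'n) set \<Rightarrow> (real ^ 'n ^ 'n) set" where
  "Tw T = pluecker ` {L \<in> oriented_planes. underlying L \<subseteq> T}"

definition twistor_spheres :: "(real ^ 'n \<Rightarrow> real) \<Rightarrow> (real ^ 'n ^ 'n) set set" where
  "twistor_spheres q = {Tw T | T. subspace T \<and> dim T = 3 \<and> pos_def_on q T}"

definition twistor_cone :: "(real ^ 'n \<Rightarrow> real) \<Rightarrow> real ^ 'n ^ 'n \<Rightarrow> (real ^ 'n ^ 'n) set" where
  "twistor_cone q p = (\<Union>S\<in>{S \<in> twistor_spheres q. p \<in> S}. tangent_space S p)"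

definition twistor_paths ::
  "(real ^ 'n \<Rightarrow> real) \<Rightarrow> real ^ 'n ^ 'n \<Rightarrow> real ^ 'n ^ 'n \<Rightarrow>
     (real \<times> (real \<Rightarrow> real ^ 'n ^ 'n)) set" where
  "twistor_paths q x y = {(t, c) \<in> paths (Per q) x y.
     \<forall>s\<in>{0..t}. \<forall>v. (c has_vector_derivative v) (at s within {0..t}) \<longrightarrow>
       v \<in> twistor_cone q (c s)}"

definition subtwistor_dist ::
  "(real ^ 'n \<Rightarrow> real) \<Rightarrow> (real ^ 'n ^ 'n \<Rightarrow> real ^ 'n ^ 'n \<Rightarrow> real ^ 'n ^ 'n \<Rightarrow> real) \<Rightarrow>
     real ^ 'n ^ 'n \<Rightarrow> real ^ 'n ^ 'n \<Rightarrow> ereal" where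
  "subtwistor_dist q g x y =
     (INF c\<in>twistor_paths q x y. ereal (path_len (\<lambda>p v. sqrt (g p v v)) c))"


subsection \<open>The embedding is well defined and injective\<close>

lemma wedge_comb:
  "wedge (a *\<^sub>R u + b *\<^sub>R v) (c *\<^sub>R u + d *\<^sub>R v) = (a * d - b * c) *\<^sub>R wedge u v"
  by (simp add: wedge_def vec_eq_iff algebra_simps)

lemma wedge_mult: "wedge u v *v x = (v \<bullet> x) *\<^sub>R u - (u \<bullet> x) *\<^sub>R v"
  by (simp add: wedge_def vec_eq_iff matrix_vector_mult_def inner_vec_def algebra_simps
      sum_subtractf sum_distrib_left)

lemma mem_oriented_span: "(u, v) \<in> oriented_span u v"
proof -
  have "(u, v) = (1 *\<^sub>R u + 0 *\<^sub>R v, 0 *\<^sub>R u + 1 *\<^sub>R v) \<and> (1::real) * 1 - 0 * 0 > 0" by simp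
  then show ?thesis unfolding oriented_span_def by blast
qed

lemma underlying_oriented_span: "underlying (oriented_span u v) = span {u, v}"
proof -
  have "(v, -u) = (0 *\<^sub>R u + 1 *\<^sub>R v, (-1) *\<^sub>R u + 0 *\<^sub>R v) \<and> (0::real) * 0 - 1 * (-1) > 0"
    by simp
  then have "(v, -u) \<in> oriented_span u v" unfolding oriented_span_def by blast
  from imageI[OF this, of fst] imageI[OF mem_oriented_span[of u v], of fst]
  have 1: "{u, v} \<subseteq> fst ` oriented_span u v" by simp
  have 2: "fst ` oriented_span u v \<subseteq> span {u, v}"
    by (auto simp: oriented_span_def intro!: span_add span_scale intro: span_base)
  show ?thesis unfolding underlying_def
    using span_mono[OF 1] span_minimal[OF 2] by auto
qed

lemma pluecker_oriented_span: "pluecker (oriented_span u v) = sgn (wedge u v)"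
proof -
  have "(\<lambda>(u, v). sgn (wedge u v)) ` oriented_span u v = {sgn (wedge u v)}"
  proof
    show "(\<lambda>(u, v). sgn (wedge u v)) ` oriented_span u v \<subseteq> {sgn (wedge u v)}"
      by (auto simp: oriented_span_def wedge_comb sgn_scaleR)
    show "{sgn (wedge u v)} \<subseteq> (\<lambda>(u, v). sgn (wedge u v)) ` oriented_span u v"
      using mem_oriented_span[of u v] by force
  qed
  then show ?thesis by (simp add: pluecker_def)
qed

lemma independent_pair_coeffs:
  fixes u v :: "'v::real_vector"
  assumes "u \<noteq> v" "independent {u, v}" "a *\<^sub>R u + b *\<^sub>R v = 0"
  shows "a = 0 \<and> b = 0"
proof -
  have "(\<Sum>x\<in>{u, v}. (if x = u then a else b) *\<^sub>R x) = 0" using assms by auto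
  then have "\<forall>x\<in>{u, v}. (if x = u then a else b) = 0"
    using assms(2) independentD[of "{u, v}" "{u, v}" "\<lambda>x. if x = u then a else b"] by auto
  then show ?thesis using assms(1) by auto
qed

lemma wedge_neq_0:
  assumes "u \<noteq> v" "independent {u, v}"
  shows "wedge u v \<noteq> 0"
proof
  assume "wedge u v = 0"
  then have *: "(v \<bullet> v) *\<^sub>R u + (- (u \<bullet> v)) *\<^sub>R v = 0"
    using wedge_mult[of u v v] by simp
  have "v \<bullet> v = 0" using independent_pair_coeffs[OF assms *] by simp
  then show False using assms(2) dependent_zero[of "{u, v}"] by auto
qed

lemma span_subset_of_wedge:
  assumes "u \<noteq> v" "independent {u, v}" "wedge u v = k *\<^sub>R wedge u' v'"
  shows "u \<in> span {u', v'} \<and> v \<in> span {u', v'}"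
proof -
  have mem: "(v \<bullet> x) *\<^sub>R u - (u \<bullet> x) *\<^sub>R v \<in> span {u', v'}" for x
  proof -
    have "(v \<bullet> x) *\<^sub>R u - (u \<bullet> x) *\<^sub>R v = k *\<^sub>R ((v' \<bullet> x) *\<^sub>R u' - (u' \<bullet> x) *\<^sub>R v')"
      using assms(3) wedge_mult[of u v x] wedge_mult[of u' v' x]
      by (metis scaleR_matrix_vector_assoc)
    also have "\<dots> \<in> span {u', v'}"
      by (intro span_scale span_diff span_base) auto
    finally show ?thesis .
  qed
  define D where "D = (u \<bullet> u) * (v \<bullet> v) - (u \<bullet> v) * (u \<bullet> v)"
  have D: "D \<noteq> 0"
  proof
    assume "D = 0"
    then have "((v \<bullet> v) *\<^sub>R u + (- (u \<bullet> v)) *\<^sub>R v) \<bullet> ((v \<bullet> v) *\<^sub>R u + (- (u \<bullet> v)) *\<^sub>R v) = 0"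
      unfolding D_def
      by (simp add: inner_diff_left inner_diff_right inner_commute algebra_simps)
    then have "v \<bullet> v = 0" using independent_pair_coeffs[OF assms(1,2)] by (metis inner_eq_zero_iff)
    then show False using assms(2) dependent_zero[of "{u, v}"] by auto
  qed
  have "D *\<^sub>R u = (u \<bullet> u) *\<^sub>R ((v \<bullet> v) *\<^sub>R u - (u \<bullet> v) *\<^sub>R v)
      - (u \<bullet> v) *\<^sub>R ((v \<bullet> u) *\<^sub>R u - (u \<bullet> u) *\<^sub>R v)"
    by (simp add: D_def algebra_simps inner_commute)
  then have "D *\<^sub>R u \<in> span {u', v'}" using mem by (metis span_diff span_scale)
  moreover have "D *\<^sub>R v = (u \<bullet> v) *\<^sub>R ((v \<bullet> v) *\<^sub>R u - (u \<bullet> v) *\<^sub>R v)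
      - (v \<bullet> v) *\<^sub>R ((v \<bullet> u) *\<^sub>R u - (u \<bullet> u) *\<^sub>R v)"
    by (simp add: D_def algebra_simps inner_commute)
  then have "D *\<^sub>R v \<in> span {u', v'}" using mem by (metis span_diff span_scale)
  ultimately have "inverse D *\<^sub>R (D *\<^sub>R u) \<in> span {u', v'}" "inverse D *\<^sub>R (D *\<^sub>R v) \<in> span {u', v'}"
    by (blast intro: span_scale)+
  then show ?thesis using D by simp
qed

lemma oriented_span_subset:
  assumes "(u', v') \<in> oriented_span u v"
  shows "oriented_span u' v' \<subseteq> oriented_span u v"
proof
  fix z assume "z \<in> oriented_span u' v'"
  then obtain a b c d where z: "z = (a *\<^sub>R u' + b *\<^sub>R v', c *\<^sub>R u' + d *\<^sub>R v')"
    and 1: "a * d - b * c > 0" unfolding oriented_span_def by blast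
  obtain a' b' c' d' where w: "u' = a' *\<^sub>R u + b' *\<^sub>R v" "v' = c' *\<^sub>R u + d' *\<^sub>R v"
    and 2: "a' * d' - b' * c' > 0" using assms unfolding oriented_span_def by blast
  have "z = ((a * a' + b * c') *\<^sub>R u + (a * b' + b * d') *\<^sub>R v,
             (c * a' + d * c') *\<^sub>R u + (c * b' + d * d') *\<^sub>R v)"
    unfolding z w by (simp add: algebra_simps)
  moreover have "(a * a' + b * c') * (c * b' + d * d') - (a * b' + b * d') * (c * a' + d * c') > 0"
  proof -
    have "(a * a' + b * c') * (c * b' + d * d') - (a * b' + b * d') * (c * a' + d * c')
        = (a * d - b * c) * (a' * d' - b' * c')" by algebra
    then show ?thesis using mult_pos_pos[OF 1 2] by simp
  qed
  ultimately show "z \<in> oriented_span u v" unfolding oriented_span_def by blast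
qed

lemma mem_oriented_span_of_wedge:
  assumes "u \<noteq> v" "independent {u, v}" "wedge u v = k *\<^sub>R wedge u' v'" "k > 0"
  shows "(u, v) \<in> oriented_span u' v'"
proof -
  obtain a b c d where ab: "u = a *\<^sub>R u' + b *\<^sub>R v'" and cd: "v = c *\<^sub>R u' + d *\<^sub>R v'"
    using span_subset_of_wedge[OF assms(1,2,3)] unfolding span_insert
    by (auto simp: span_breakdown_eq algebra_simps)
  have "(a * d - b * c) *\<^sub>R wedge u' v' = k *\<^sub>R wedge u' v'"
    using assms(3) ab cd wedge_comb by metis
  moreover have "wedge u' v' \<noteq> 0" using wedge_neq_0[OF assms(1,2)] assms(3) by auto
  ultimately have "a * d - b * c = k" by simp
  then show ?thesis using ab cd assms(4) unfolding oriented_span_def by blast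
qed

lemma inj_on_pluecker: "inj_on pluecker oriented_planes"
proof (rule inj_onI)
  fix L L' :: "((real ^ 'n) \<times> (real ^ 'n)) set"
  assume "L \<in> oriented_planes" "L' \<in> oriented_planes" and eq: "pluecker L = pluecker L'"
  then obtain u v u' v' where L: "L = oriented_span u v" "u \<noteq> v" "independent {u, v}"
    and L': "L' = oriented_span u' v'" "u' \<noteq> v'" "independent {u', v'}"
    unfolding oriented_planes_def by blast
  have n: "wedge u v \<noteq> 0" "wedge u' v' \<noteq> 0" using L L' wedge_neq_0 by auto
  have s: "sgn (wedge u v) = sgn (wedge u' v')" using eq L L' by (simp add: pluecker_oriented_span)
  define k where "k = norm (wedge u v) / norm (wedge u' v')"
  have k: "k > 0" using n by (simp add: k_def)
  have "wedge u v = norm (wedge u v) *\<^sub>R sgn (wedge u v)" using n by (simp add: sgn_div_norm)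
  also have "\<dots> = k *\<^sub>R wedge u' v'" unfolding s using n by (simp add: sgn_div_norm k_def divide_inverse)
  finally have w: "wedge u v = k *\<^sub>R wedge u' v'" .
  then have w': "wedge u' v' = inverse k *\<^sub>R wedge u v" using k by simp
  show "L = L'"
    unfolding L(1) L'(1)
    using oriented_span_subset[OF mem_oriented_span_of_wedge[OF L(2,3) w k]]
      oriented_span_subset[OF mem_oriented_span_of_wedge[OF L'(2,3) w']] k by auto
qed

end

theory Submission
  imports Defs
begin

text \<open>The norm \<open>\<nu>\<close> is the one whose unit ball is the convex hull of the \<open>g\<close>-unit ball of the
  sub-twistor cone: \<open>\<nu>(\<xi>)\<close> is the infimum of \<open>\<Sum>|\<eta>\<^sub>i|\<close> over all decompositions
  \<open>\<xi> = \<Sum>\<eta>\<^sub>i\<close> into vectors of the cone (\<open>cone_norm\<close> below). On the cone itself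
  \<open>\<nu> \<le> |\<cdot>|\<close>, so a twistor path is at most as long for \<open>\<nu>\<close> as for \<open>g\<close>, and the Finsler
  distance is at most the sub-twistor distance (\<open>finsler_le_subtwistor\<close>).

  For the converse, an arbitrary path is replaced by twistor paths that zigzag along it. A plane is
  described by a frame \<open>z = (u, v)\<close>, and a vector of the cone at \<open>z\<close> is the velocity of the line
  \<open>t \<mapsto> (u + taw, v + tbw)\<close> for some \<open>w\<close> for which \<open>u, v, w\<close> span a positive
  three-space; the planes on this line all lie in one twistor sphere
  (\<open>dplane_in_twistor_cone\<close>, \<open>twistor_coneE\<close>). Since the admissible \<open>w\<close> form an open set that
  varies continuously with \<open>z\<close>, a fixed finite set of them spans everything near a given frame.
  Moving along them one after the other joins nearby planes by twistor paths of length at most a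
  constant times their distance (\<open>twistor_chain_lipschitz\<close>). If now \<open>\<gamma>'(x) = \<Sum>\<eta>\<^sub>i\<close>,
  following \<open>\<eta>\<^sub>1, \<eta>\<^sub>2, \<dots>\<close> for a time \<open>h\<close> each costs about \<open>h\<Sum>|\<eta>\<^sub>i|\<close> and ends at
  distance \<open>o(h)\<close> from \<open>\<gamma>(x + h)\<close>, and the gap is closed at cost \<open>o(h)\<close>
  (\<open>twistor_chain_local\<close>). A bisection argument adds these local estimates up to
  \<open>\<integral>\<nu>(\<gamma>')\<close> (\<open>twistor_chain_piece\<close>). Working with a point and a short interval around it
  at a time avoids all uniformity in the choice of decompositions.

  The cone spans each tangent space, so \<open>\<nu>\<close> is finite; it is a norm because it dominates a
  multiple of the Euclidean norm. The delicate point is its continuity, because the cone is not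
  closed: in a limit the positive direction \<open>w\<close> may become null. But null directions are limits of
  positive ones, so for nearby base points every vector of one cone is close, relative to its
  length, to a vector of the other (\<open>cone_close_near\<close>). Replacing each summand of a decomposition in
  this way compares \<open>\<nu>\<close> at the two points, however many summands there are
  (\<open>cone_norm_compare\<close>).\<close>

section \<open>Smooth curves obtained by normalising polynomials\<close>

lemma Ck_cong:
  assumes "open U" "\<And>x. x \<in> U \<Longrightarrow> f x = h x" "Ck k U f"
  shows "Ck k U h"
  using assms(2,3)
proof (induction k arbitrary: f h)
  case 0
  then show ?case by (simp cong: continuous_on_cong)
next
  case (Suc k)
  have d: "(h has_derivative frechet_derivative f (at x)) (at x)" if "x \<in> U" for x
  proof -
    have "(f has_derivative frechet_derivative f (at x)) (at x)"
      using Suc.prems(2) that frechet_derivative_works by auto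
    then show ?thesis
      using has_derivative_transform_within_open[OF _ \<open>open U\<close> that] Suc.prems(1) by blast
  qed
  have "frechet_derivative f (at x) v = frechet_derivative h (at x) v" if "x \<in> U" for x v
    using frechet_derivative_at[OF d[OF that]] by simp
  then have "Ck k U (\<lambda>x. frechet_derivative h (at x) v)" for v
    using Suc.IH[of "\<lambda>x. frechet_derivative f (at x) v" "\<lambda>x. frechet_derivative h (at x) v"]
      Suc.prems(2) by simp
  then show ?case using d by (auto simp: differentiable_def)
qed

lemma polynomial_function_inner:
  fixes p r :: "real \<Rightarrow> 'b::euclidean_space"
  assumes "polynomial_function p" "polynomial_function r"
  shows "polynomial_function (\<lambda>t. p t \<bullet> r t)"
proof -
  have "polynomial_function (\<lambda>t. \<Sum>b\<in>Basis. (p t \<bullet> b) * (r t \<bullet> b))"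
    using assms unfolding polynomial_function_iff_Basis_inner[of p] polynomial_function_iff_Basis_inner[of r]
    by (intro polynomial_function_sum polynomial_function_mult[where 'b = real, simplified])
       (auto simp: real_polynomial_function_eq)
  then show ?thesis by (simp add: euclidean_inner[of "p _" "r _"])
qed

lemma has_vector_derivative_inverse_norm_power:
  fixes p Q :: "real \<Rightarrow> 'b::euclidean_space"
  assumes "(p has_vector_derivative p') (at t)" "(Q has_vector_derivative Q') (at t)" "Q t \<noteq> 0"
  shows "((\<lambda>t. inverse (norm (Q t)) ^ m *\<^sub>R p t) has_vector_derivative
     inverse (norm (Q t)) ^ (m + 2) *\<^sub>R ((Q t \<bullet> Q t) *\<^sub>R p' - (real m * (Q t \<bullet> Q')) *\<^sub>R p t)) (at t)"
proof -
  let ?r = "norm (Q t)"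
  have r: "?r \<noteq> 0" using assms by simp
  have "((\<lambda>t. norm (Q t)) has_derivative (\<lambda>h. (h *\<^sub>R Q') \<bullet> sgn (Q t))) (at t)"
    using has_derivative_compose[of Q "\<lambda>h. h *\<^sub>R Q'" t UNIV norm "\<lambda>h. h \<bullet> sgn (Q t)"]
      has_derivative_norm[OF assms(3)] assms(2) unfolding has_vector_derivative_def by simp
  then have n: "((\<lambda>t. norm (Q t)) has_real_derivative (Q t \<bullet> Q') / ?r) (at t)"
    unfolding has_field_derivative_def
    by (rule has_derivative_eq_rhs) (auto simp: sgn_div_norm fun_eq_iff inner_commute divide_inverse)
  have i: "((\<lambda>t. inverse (norm (Q t)) ^ m) has_real_derivative
      - (real m * inverse ?r ^ (m + 2) * (Q t \<bullet> Q'))) (at t)"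
  proof (cases m)
    case (Suc k)
    show ?thesis unfolding Suc
      by (rule DERIV_cong[OF DERIV_power[OF DERIV_inverse'[OF n r]]])
         (use r in \<open>simp add: field_simps power2_eq_square\<close>)
  qed simp
  have nn: "?r * ?r = Q t \<bullet> Q t" using power2_norm_eq_inner[of "Q t"] by (simp add: power2_eq_square)
  have "((\<lambda>t. inverse (norm (Q t)) ^ m *\<^sub>R p t) has_vector_derivative
     inverse ?r ^ m *\<^sub>R p' + (- (real m * inverse ?r ^ (m + 2) * (Q t \<bullet> Q'))) *\<^sub>R p t) (at t)"
    by (rule has_vector_derivative_scaleR[OF i assms(1)])
  moreover have "inverse ?r ^ m = inverse ?r ^ (m + 2) * (Q t \<bullet> Q t)"
    using r by (simp add: nn[symmetric] field_simps power_add power2_eq_square)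
  moreover have "(x * b) *\<^sub>R p' + (- (k * x * c)) *\<^sub>R w = x *\<^sub>R (b *\<^sub>R p' - (k * c) *\<^sub>R w)"
    for x b c k and w :: 'b
    by (simp add: algebra_simps)
  ultimately show ?thesis by (simp only:)
qed

text \<open>The functions \<open>|Q|^(-m) p\<close> with \<open>p\<close>, \<open>Q\<close> polynomial are closed under differentiation, which
  gives smoothness of all orders at once; \<open>sgn Q\<close> is the case \<open>m = 1\<close>, \<open>p = Q\<close>.\<close>

lemma Ck_inverse_norm_power:
  fixes p Q :: "real \<Rightarrow> 'b::euclidean_space"
  assumes "open U" "\<And>t. t \<in> U \<Longrightarrow> Q t \<noteq> 0" "polynomial_function Q" "polynomial_function p"
  shows "Ck k U (\<lambda>t. inverse (norm (Q t)) ^ m *\<^sub>R p t)"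
  using assms(4)
proof (induction k arbitrary: p m)
  case 0
  have "continuous_on U p" "continuous_on U Q"
    using 0 assms continuous_on_polymonial_function by auto
  then show ?case using assms(2) by (auto intro!: continuous_intros)
next
  case (Suc k)
  obtain p' where p': "polynomial_function p'" "\<And>x. (p has_vector_derivative p' x) (at x)"
    using has_vector_derivative_polynomial_function[OF Suc.prems] by blast
  obtain Q' where Q': "polynomial_function Q'" "\<And>x. (Q has_vector_derivative Q' x) (at x)"
    using has_vector_derivative_polynomial_function[OF assms(3)] by blast
  let ?f = "\<lambda>t. inverse (norm (Q t)) ^ m *\<^sub>R p t"
  let ?d = "\<lambda>t. inverse (norm (Q t)) ^ (m + 2) *\<^sub>R
     ((Q t \<bullet> Q t) *\<^sub>R p' t - (real m * (Q t \<bullet> Q' t)) *\<^sub>R p t)"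
  have d: "(?f has_derivative (\<lambda>v. v *\<^sub>R ?d t)) (at t)" if "t \<in> U" for t
    using has_vector_derivative_inverse_norm_power[OF p'(2) Q'(2) assms(2)[OF that], of m]
    unfolding has_vector_derivative_def .
  have "Ck k U (\<lambda>x. frechet_derivative ?f (at x) v)" for v
  proof (rule Ck_cong[OF assms(1)])
    show "v *\<^sub>R ?d x = frechet_derivative ?f (at x) v" if "x \<in> U" for x
      unfolding frechet_derivative_at[OF d[OF that], symmetric] by (rule refl)
    have "polynomial_function (\<lambda>t. v *\<^sub>R ((Q t \<bullet> Q t) *\<^sub>R p' t - (real m * (Q t \<bullet> Q' t)) *\<^sub>R p t))"
      by (intro polynomial_function_cmul polynomial_function_diff polynomial_function_mult
          polynomial_function_cmul[where 'b=real, simplified]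
          polynomial_function_inner p' Q' assms Suc.prems)
    from Suc.IH[OF this, of "m + 2"] show "Ck k U (\<lambda>x. v *\<^sub>R ?d x)" by (simp add: mult_ac)
  qed
  moreover have "?f differentiable (at x)" if "x \<in> U" for x
    using d[OF that] unfolding differentiable_def by blast
  ultimately show ?case by simp
qed

lemma Ck_sgn_polynomial:
  fixes Q :: "real \<Rightarrow> 'b::euclidean_space"
  assumes "open U" "\<And>t. t \<in> U \<Longrightarrow> Q t \<noteq> 0" "polynomial_function Q"
  shows "Ck k U (\<lambda>t. sgn (Q t))"
  using Ck_inverse_norm_power[OF assms assms(3), of k 1] by (simp add: sgn_div_norm)

lemma smooth_map_sgn_polynomial:
  fixes Q :: "real \<Rightarrow> 'b::euclidean_space"
  assumes "\<And>t. t \<in> S \<Longrightarrow> Q t \<noteq> 0" "polynomial_function Q"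
  shows "smooth_map S (\<lambda>t. sgn (Q t))"
proof -
  have o: "open (Q -` (- {0}))"
    using continuous_on_polymonial_function[OF assms(2), of UNIV]
    by (intro open_vimage) auto
  have "Ck k (Q -` (- {0})) (\<lambda>t. sgn (Q t))" for k
    by (rule Ck_sgn_polynomial[OF o _ assms(2)]) auto
  then show ?thesis unfolding smooth_map_def using o assms(1) by fast
qed

section \<open>Frames and the planes that they span\<close>

lemma bounded_bilinear_wedge: "bounded_bilinear (wedge :: real ^ 'n \<Rightarrow> real ^ 'n \<Rightarrow> real ^ 'n ^ 'n)"
proof -
  have "bilinear (wedge :: real ^ 'n \<Rightarrow> real ^ 'n \<Rightarrow> real ^ 'n ^ 'n)"
    unfolding bilinear_def
    by (auto intro!: linearI simp: wedge_def vec_eq_iff algebra_simps)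
  then show ?thesis by (simp add: bilinear_conv_bounded_bilinear)
qed

interpretation wedge: bounded_bilinear wedge
  by (rule bounded_bilinear_wedge)

lemma wedge_self [simp]: "wedge u u = 0"
  by (simp add: wedge_def vec_eq_iff)

definition plane :: "(real ^ 'n) \<times> (real ^ 'n) \<Rightarrow> real ^ 'n ^ 'n" where
  "plane z = sgn (wedge (fst z) (snd z))"

text \<open>The derivative of \<open>plane\<close> at the frame \<open>z\<close> in the direction \<open>f\<close>.\<close>

definition dplane :: "(real ^ 'n) \<times> (real ^ 'n) \<Rightarrow> (real ^ 'n) \<times> (real ^ 'n) \<Rightarrow> real ^ 'n ^ 'n" where
  "dplane z f = inverse (norm (wedge (fst z) (snd z))) *\<^sub>R
     ((wedge (fst f) (snd z) + wedge (fst z) (snd f))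
       - (plane z \<bullet> (wedge (fst f) (snd z) + wedge (fst z) (snd f))) *\<^sub>R plane z)"

lemma has_derivative_sgn:
  fixes A :: "'a::real_inner"
  assumes "A \<noteq> 0"
  shows "(sgn has_derivative (\<lambda>X. inverse (norm A) *\<^sub>R (X - (sgn A \<bullet> X) *\<^sub>R sgn A))) (at A)"
proof -
  have "((\<lambda>A. inverse (norm A) *\<^sub>R A) has_derivative
      (\<lambda>X. inverse (norm A) *\<^sub>R X + (- (inverse (norm A) * (X \<bullet> sgn A) * inverse (norm A))) *\<^sub>R A)) (at A)"
    by (rule has_derivative_scaleR[OF Deriv.has_derivative_inverse[OF _ has_derivative_norm[OF assms]] has_derivative_ident])
       (use assms in auto)
  then show ?thesis unfolding sgn_div_norm[abs_def]
    by (rule has_derivative_eq_rhs)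
       (auto simp: fun_eq_iff algebra_simps inner_commute)
qed

lemma has_derivative_plane:
  assumes "wedge (fst z) (snd z) \<noteq> 0"
  shows "(plane has_derivative dplane z) (at z)"
proof -
  have "((\<lambda>z. wedge (fst z) (snd z)) has_derivative
     (\<lambda>f. wedge (fst z) (snd f) + wedge (fst f) (snd z))) (at z)"
    by (rule wedge.FDERIV) (auto intro!: derivative_eq_intros)
  from has_derivative_compose[OF this has_derivative_sgn[OF assms]]
  show ?thesis unfolding plane_def[abs_def] dplane_def
    by (simp add: add.commute)
qed

lemma linear_dplane: "linear (dplane z)"
  by (rule linearI) (auto simp: dplane_def wedge.add_left wedge.add_right wedge.scaleR_left
      wedge.scaleR_right inner_add_right inner_diff_right algebra_simps)

lemma continuous_on_wedge [continuous_intros]: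
  "continuous_on S f \<Longrightarrow> continuous_on S h \<Longrightarrow> continuous_on S (\<lambda>x. wedge (f x) (h x))"
  by (rule wedge.continuous_on)

lemma continuous_on_plane:
  "continuous_on {z. wedge (fst z) (snd z) \<noteq> 0} plane"
  unfolding plane_def[abs_def] sgn_div_norm
  by (intro continuous_intros) auto

lemma continuous_on_dplane:
  "continuous_on {(z, f). wedge (fst z) (snd z) \<noteq> 0} (\<lambda>(z, f). dplane z f)"
  unfolding dplane_def plane_def sgn_div_norm case_prod_unfold
  by (intro continuous_intros) auto

lemma open_wedge_neq_0: "open {z. wedge (fst z) (snd z) \<noteq> 0}"
  by (intro open_Collect_neq continuous_intros)

lemma plane_comb:
  assumes "a * d - b * c > 0"
  shows "plane (a *\<^sub>R u + b *\<^sub>R v, c *\<^sub>R u + d *\<^sub>R v) = plane (u, v)"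
  using assms by (simp add: plane_def wedge_comb sgn_scaleR)

text \<open>A decomposable bivector is recovered from its columns: this makes \<open>p \<mapsto> (p\<alpha>, p\<beta>)\<close> a local
  section of \<open>plane\<close> that is the restriction of a linear map.\<close>

lemma wedge_matrix_vector:
  assumes "p = k *\<^sub>R wedge u v"
  shows "wedge (p *v \<alpha>) (p *v \<beta>) = (\<alpha> \<bullet> (p *v \<beta>)) *\<^sub>R p"
proof -
  have *: "p *v x = (k * (v \<bullet> x)) *\<^sub>R u + (- k * (u \<bullet> x)) *\<^sub>R v" for x
    unfolding assms scaleR_matrix_vector_assoc[symmetric] wedge_mult
    by (simp add: algebra_simps)
  have "wedge (p *v \<alpha>) (p *v \<beta>) =
     (k * (v \<bullet> \<alpha>) * (- k * (u \<bullet> \<beta>)) - (- k * (u \<bullet> \<alpha>)) * (k * (v \<bullet> \<beta>))) *\<^sub>R wedge u v"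
    unfolding * wedge_comb ..
  also have "\<dots> = (\<alpha> \<bullet> (p *v \<beta>)) *\<^sub>R p"
    unfolding *[of \<beta>] unfolding assms
    by (simp add: inner_add_right inner_diff_right inner_commute algebra_simps)
  finally show ?thesis .
qed

lemma matrix_vector_in_span:
  assumes "p = k *\<^sub>R wedge u v"
  shows "p *v x \<in> span {u, v}"
  unfolding assms scaleR_matrix_vector_assoc[symmetric] wedge_mult
  by (intro span_scale span_diff span_base) auto

lemma exists_positive_entry:
  fixes p :: "real ^ 'n ^ 'n"
  assumes "p \<noteq> 0"
  obtains \<alpha> \<beta> where "\<alpha> \<bullet> (p *v \<beta>) > 0"
proof -
  obtain i where i: "p $ i \<noteq> 0" using assms by (auto simp: vec_eq_iff)
  have "axis i 1 \<bullet> (p *v (p $ i)) = p $ i \<bullet> p $ i"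
    by (simp add: inner_axis' matrix_vector_mul_component)
  then show ?thesis using that[of "axis i 1" "p $ i"] i by simp
qed

text \<open>Moving a frame within its own plane changes only the length of its wedge, which \<open>plane\<close>
  normalises away.\<close>

lemma dplane_span:
  assumes "x \<in> span {fst z, snd z}" "y \<in> span {fst z, snd z}"
  shows "dplane z (x, y) = 0"
proof (cases "wedge (fst z) (snd z) = 0")
  case True
  then show ?thesis by (simp add: dplane_def)
next
  case False
  obtain u v where z: "z = (u, v)" by (cases z)
  obtain a b c d where xy: "x = a *\<^sub>R u + b *\<^sub>R v" "y = c *\<^sub>R u + d *\<^sub>R v"
    using assms unfolding z span_insert by (auto simp: span_breakdown_eq algebra_simps)
  have w: "wedge x v + wedge u y = (a + d) *\<^sub>R wedge u v"
    by (simp add: xy wedge.add_left wedge.add_right wedge.scaleR_left wedge.scaleR_right algebra_simps)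
  have "wedge u v = norm (wedge u v) *\<^sub>R sgn (wedge u v)"
    using False by (simp add: z sgn_div_norm)
  moreover have "norm (sgn (wedge u v)) = 1" using False by (simp add: z norm_sgn)
  ultimately have "(sgn (wedge u v) \<bullet> wedge u v) *\<^sub>R sgn (wedge u v) = wedge u v"
    by (metis inner_scaleR_right mult.right_neutral norm_eq_1)
  then show ?thesis unfolding dplane_def z
    by (simp add: w plane_def flip: scaleR_scaleR)
qed

text \<open>Applied to the component \<open>z\<close> of \<open>w\<close> that is perpendicular to the plane, the bivector
  \<open>aw \<and> v + u \<and> bw\<close> gives a multiple of \<open>bu - av\<close>, while \<open>u \<and> v\<close> gives zero.\<close>

lemma dplane_eq_0D:
  assumes "wedge u v \<noteq> 0" "w \<notin> span {u, v}" "dplane (u, v) (a *\<^sub>R w, b *\<^sub>R w) = 0"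
  shows "a = 0 \<and> b = 0"
proof -
  define k where "k = plane (u, v) \<bullet> (wedge (a *\<^sub>R w) v + wedge u (b *\<^sub>R w))"
  have "wedge (a *\<^sub>R w) v + wedge u (b *\<^sub>R w) = k *\<^sub>R plane (u, v)"
    using assms(1,3) by (simp add: dplane_def k_def)
  then have e: "wedge (a *\<^sub>R w) v + wedge u (b *\<^sub>R w) = (k / norm (wedge u v)) *\<^sub>R wedge u v"
    by (simp add: plane_def sgn_div_norm divide_inverse)
  obtain y z where w: "y \<in> span {u, v}" "\<And>x. x \<in> span {u, v} \<Longrightarrow> orthogonal z x" "w = y + z"
    using orthogonal_subspace_decomp_exists[of "{u, v}" w] by metis
  have uv: "u \<bullet> z = 0" "v \<bullet> z = 0" "y \<bullet> z = 0"
    using w(2)[of u] w(2)[of v] w(2)[OF w(1)]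
    by (auto simp: orthogonal_def inner_commute intro: span_base)
  have "z \<noteq> 0" using w(1,3) assms(2) by auto
  then have wz: "w \<bullet> z \<noteq> 0" using w(3) uv by (simp add: inner_add_left)
  have "(wedge (a *\<^sub>R w) v + wedge u (b *\<^sub>R w)) *v z = (k / norm (wedge u v)) *\<^sub>R (wedge u v *v z)"
    unfolding e by (simp add: scaleR_matrix_vector_assoc)
  then have "(w \<bullet> z) *\<^sub>R (b *\<^sub>R u - a *\<^sub>R v) = 0"
    by (simp add: matrix_vector_mult_add_rdistrib wedge_mult uv algebra_simps)
  then have eq: "b *\<^sub>R u = a *\<^sub>R v" using wz by simp
  then have "b *\<^sub>R wedge u v = 0" "a *\<^sub>R wedge u v = 0"
    using wedge.scaleR_left[of b u v] wedge.scaleR_right[of u a v] by (auto simp: wedge.scaleR_left)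
       (metis eq wedge.scaleR_left wedge.scaleR_right wedge_self scaleR_zero_right)+
  then show ?thesis using assms(1) by simp
qed

section \<open>The period space, its tangent spaces and the sub-twistor cone\<close>

text \<open>Positivity on the span of \<open>u, v\<close> (and \<open>w\<close>) is expressed through coefficients, so that it
  includes linear independence and is visibly an open condition on the vectors.\<close>

definition pos2 :: "('v::real_vector \<Rightarrow> real) \<Rightarrow> 'v \<times> 'v \<Rightarrow> bool" where
  "pos2 q z \<longleftrightarrow> (\<forall>a b. (a, b) \<noteq> (0, 0) \<longrightarrow> q (a *\<^sub>R fst z + b *\<^sub>R snd z) > 0)"

definition pos3 :: "('v::real_vector \<Rightarrow> real) \<Rightarrow> 'v \<times> 'v \<Rightarrow> 'v \<Rightarrow> bool" where
  "pos3 q z w \<longleftrightarrow>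
     (\<forall>a b c. (a, b, c) \<noteq> (0, 0, 0) \<longrightarrow> q (a *\<^sub>R fst z + b *\<^sub>R snd z + c *\<^sub>R w) > 0)"

lemma pos3_imp_pos2: "pos3 q z w \<Longrightarrow> pos2 q z"
  unfolding pos2_def pos3_def by (metis add.right_neutral prod.inject scaleR_zero_left)

lemma wedge_neq_0_imp_independent:
  assumes "wedge u v \<noteq> 0"
  shows "u \<noteq> v" "independent {u, v}"
proof -
  have "v \<noteq> 0" using assms by (auto simp: wedge.zero_right)
  moreover have "u \<notin> span {v}"
    using assms by (auto simp: span_singleton wedge.scaleR_left)
  ultimately show "independent {u, v}" by (auto simp: independent_insert)
  show "u \<noteq> v" using assms by auto
qed

text \<open>Difference quotients stay in the closed set \<open>T\<close>.\<close>

lemma has_vector_derivative_in_subspace: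
  fixes f :: "real \<Rightarrow> 'a::euclidean_space"
  assumes "(f has_vector_derivative d) (at s within S)" "at s within S \<noteq> bot" "subspace T"
    and "\<And>r. r \<in> S \<Longrightarrow> f r \<in> T" "f s \<in> T"
  shows "d \<in> T"
proof -
  have h: "((\<lambda>y. (1 / norm (y - s)) *\<^sub>R (f y - (f s + (y - s) *\<^sub>R d))) \<longlongrightarrow> 0) (at s within S)"
    using assms(1) unfolding has_vector_derivative_def has_derivative_within by blast
  have g: "k *\<^sub>R (x /\<^sub>R k - d) = x - k *\<^sub>R d" if "k \<noteq> 0" for k and x d :: 'a
    using that by (simp add: scaleR_right_diff_distrib)
  from tendsto_norm_zero[OF h]
  have "((\<lambda>y. norm ((f y - f s) /\<^sub>R (y - s) - d)) \<longlongrightarrow> 0) (at s within S)"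
  proof (rule Lim_transform_eventually)
    have "norm ((1 / norm (y - s)) *\<^sub>R (f y - (f s + (y - s) *\<^sub>R d))) = norm ((f y - f s) /\<^sub>R (y - s) - d)"
      if "y \<noteq> s" for y
    proof -
      have "f y - (f s + (y - s) *\<^sub>R d) = (y - s) *\<^sub>R ((f y - f s) /\<^sub>R (y - s) - d)"
        using that g[of "y - s" "f y - f s" d] by simp
      then show ?thesis using that by simp
    qed
    then show "\<forall>\<^sub>F y in at s within S. norm ((1 / norm (y - s)) *\<^sub>R (f y - (f s + (y - s) *\<^sub>R d))) =
        norm ((f y - f s) /\<^sub>R (y - s) - d)"
      by (auto simp: eventually_at_filter)
  qed
  then have "((\<lambda>y. (f y - f s) /\<^sub>R (y - s) - d) \<longlongrightarrow> 0) (at s within S)"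
    by (rule tendsto_norm_zero_cancel)
  then have "((\<lambda>y. (f y - f s) /\<^sub>R (y - s)) \<longlongrightarrow> d) (at s within S)"
    by (rule LIM_zero_cancel)
  moreover have "closed T" using closed_subspace[OF assms(3)] .
  moreover have "\<forall>\<^sub>F y in at s within S. (f y - f s) /\<^sub>R (y - s) \<in> T"
    unfolding eventually_at_filter using assms(3-5)
    by (intro always_eventually allI impI subspace_mul subspace_diff) auto
  ultimately show ?thesis using Lim_in_closed_set[OF _ _ assms(2)] by metis
qed

lemma wedge_affine:
  "wedge (u + t *\<^sub>R x) (v + t *\<^sub>R y) =
     wedge u v + t *\<^sub>R (wedge x v + wedge u y) + (t * t) *\<^sub>R wedge x y"
  by (simp add: wedge.add_left wedge.add_right wedge.scaleR_left wedge.scaleR_right algebra_simps)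

lemma smooth_map_plane_line:
  assumes "\<And>t. t \<in> S \<Longrightarrow> wedge (fst (z + t *\<^sub>R f)) (snd (z + t *\<^sub>R f)) \<noteq> 0"
  shows "smooth_map S (\<lambda>t. plane (z + t *\<^sub>R f))"
proof -
  let ?Q = "\<lambda>t::real. wedge (fst (z + t *\<^sub>R f)) (snd (z + t *\<^sub>R f))"
  have "polynomial_function (\<lambda>t::real. t * t)"
    using polynomial_function_mult[OF polynomial_function_id polynomial_function_id] by simp
  then have "polynomial_function ?Q" unfolding fst_add snd_add fst_scaleR snd_scaleR wedge_affine
    by (intro polynomial_function_add polynomial_function_mult polynomial_function_const
        polynomial_function_id)
  then show ?thesis using smooth_map_sgn_polynomial[of S ?Q] assms by (simp add: plane_def)
qed

lemma has_vector_derivative_plane_line: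
  assumes "wedge (fst (z + t *\<^sub>R f)) (snd (z + t *\<^sub>R f)) \<noteq> 0"
  shows "((\<lambda>t. plane (z + t *\<^sub>R f)) has_vector_derivative dplane (z + t *\<^sub>R f) f) (at t within S)"
proof -
  have "((\<lambda>t. z + t *\<^sub>R f) has_derivative (\<lambda>h. h *\<^sub>R f)) (at t within S)"
    by (auto intro!: derivative_eq_intros)
  from has_derivative_compose[OF this has_derivative_plane[OF assms]]
  show ?thesis
    by (simp add: has_vector_derivative_def linear_cmul[OF linear_dplane])
qed

locale period_domain =
  fixes q :: "real ^ 'n \<Rightarrow> real" and B :: "real ^ 'n \<Rightarrow> real ^ 'n \<Rightarrow> real"
  assumes bilinear_B: "bilinear B" and B_sym: "B x y = B y x" and q_B: "q x = B x x"
    and positive_space: "\<exists>T. subspace T \<and> dim T = 3 \<and> pos_def_on q T"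
begin

lemma bounded_bilinear_B: "bounded_bilinear B"
  using bilinear_B by (simp add: bilinear_conv_bounded_bilinear)

sublocale B: bounded_bilinear B
  by (rule bounded_bilinear_B)

lemma q_scale [simp]: "q (a *\<^sub>R x) = a\<^sup>2 * q x"
  by (simp add: q_B B.scaleR_left B.scaleR_right power2_eq_square)

lemma q_0 [simp]: "q 0 = 0"
  by (simp add: q_B B.zero_left)

lemma q_add: "q (x + y) = q x + 2 * B x y + q y"
  by (simp add: q_B B.add_left B.add_right B_sym[of y x])

lemma continuous_on_q [continuous_intros]:
  "continuous_on S f \<Longrightarrow> continuous_on S (\<lambda>x. q (f x))"
  unfolding q_B by (intro B.continuous_on)

text \<open>By homogeneity it suffices to test the coefficients on a compact sphere; then the tube lemma applies.\<close>

lemma open_pos3: "open {(z, w). pos3 q z w}"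
proof -
  define K where "K = sphere (0 :: real \<times> real \<times> real) 1"
  define F where "F = (\<lambda>(z, w) (a, b, c). q (a *\<^sub>R fst z + b *\<^sub>R snd z + c *\<^sub>R w))"
  have eq: "pos3 q z w \<longleftrightarrow> (\<forall>s\<in>K. F (z, w) s > 0)" for z w
  proof
    assume p: "pos3 q z w"
    show "\<forall>s\<in>K. F (z, w) s > 0"
    proof
      fix s assume "s \<in> K"
      then have "s \<noteq> 0" by (auto simp: K_def)
      moreover obtain a b c where "s = (a, b, c)" by (cases s)
      ultimately show "F (z, w) s > 0" using p unfolding pos3_def F_def by (auto simp: zero_prod_def)
    qed
  next
    assume r: "\<forall>s\<in>K. F (z, w) s > 0"
    show "pos3 q z w" unfolding pos3_def
    proof (intro allI impI)
      fix a b c :: real assume nz: "(a, b, c) \<noteq> (0, 0, 0)"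
      let ?n = "norm (a, b, c)"
      have n: "?n > 0" using nz by (simp add: zero_prod_def)
      have "sgn (a, b, c) \<in> K" unfolding K_def mem_sphere_0 norm_sgn using nz by (simp add: zero_prod_def)
      then have "0 < F (z, w) (sgn (a, b, c))" using r by blast
      also have "F (z, w) (sgn (a, b, c)) = q (inverse ?n *\<^sub>R (a *\<^sub>R fst z + b *\<^sub>R snd z + c *\<^sub>R w))"
        by (simp add: F_def sgn_div_norm scaleR_right_distrib)
      finally show "q (a *\<^sub>R fst z + b *\<^sub>R snd z + c *\<^sub>R w) > 0"
        using n by (simp add: zero_less_mult_iff)
    qed
  qed
  have "open {p. F (fst p) (snd p) > 0}"
    unfolding F_def case_prod_unfold
    by (intro open_Collect_less continuous_intros)
  note tl = Elementary_Topology.tube_lemma[OF _ this, of K]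
  have K: "compact K" by (simp add: K_def)
  show ?thesis
  proof (subst open_subopen, clarify)
    fix z w assume "pos3 q z w"
    then have "{(z, w)} \<times> K \<subseteq> {p. F (fst p) (snd p) > 0}" by (auto simp: eq)
    from tl[OF K this] obtain X where "(z, w) \<in> X" "open X" "X \<times> K \<subseteq> {p. F (fst p) (snd p) > 0}"
      by blast
    then show "\<exists>T. open T \<and> (z, w) \<in> T \<and> T \<subseteq> {(z, w). pos3 q z w}"
      by (intro exI[of _ X]) (auto simp: eq)
  qed
qed

text \<open>The two conditions are the kernel of a linear map to the plane, which is not injective on a space
  of dimension three.\<close>

lemma exists_orthogonal:
  assumes "subspace T" "dim T \<ge> 3"
  obtains w where "w \<in> T" "w \<noteq> 0" "B w u = 0" "B w v = 0"
proof -
  define L where "L = (\<lambda>w. (B w u, B w v))"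
  have L: "linear L" unfolding L_def
    by (rule linearI) (auto simp: B.add_left B.scaleR_left)
  have "\<not> inj_on L T"
  proof
    assume "inj_on L T"
    then have "dim (L ` T) = dim T"
      using dim_image_eq[OF L, of T] span_eq_iff[THEN iffD2, OF assms(1)] by simp
    moreover have "dim (L ` T) \<le> DIM(real \<times> real)" by (rule dim_subset_UNIV)
    ultimately show False using assms(2) by simp
  qed
  then obtain x y where "x \<in> T" "y \<in> T" "x \<noteq> y" "L x = L y" by (auto simp: inj_on_def)
  then show ?thesis
    by (intro that[of "x - y"]) (auto simp: L_def B.diff_left subspace_diff[OF assms(1)])
qed

lemma pos3I:
  assumes "pos2 q z" "B w (fst z) = 0" "B w (snd z) = 0" "q w > 0"
  shows "pos3 q z w"
  unfolding pos3_def
proof (intro allI impI)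
  fix a b c :: real assume nz: "(a, b, c) \<noteq> (0, 0, 0)"
  let ?e = "a *\<^sub>R fst z + b *\<^sub>R snd z"
  have "B ?e (c *\<^sub>R w) = 0"
    using assms(2,3) 
      by (simp add: B.add_left B.scaleR_left B.scaleR_right B_sym[of "fst z" w] B_sym[of "snd z" w])
  then have e: "q (?e + c *\<^sub>R w) = q ?e + c\<^sup>2 * q w" by (simp add: q_add)
  show "q (?e + c *\<^sub>R w) > 0"
  proof (cases "(a, b) = (0, 0)")
    case True
    then show ?thesis using nz assms(4) e by auto
  next
    case False
    then have "q ?e > 0" using assms(1) unfolding pos2_def by blast
    then show ?thesis using e assms(4) by (simp add: add_pos_nonneg)
  qed
qed

text \<open>A positive three-space contains a vector orthogonal to the given plane: every positive plane lies
  on a twistor sphere.\<close>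

lemma pos2_extend:
  obtains w where "B w (fst z) = 0" "B w (snd z) = 0" "q w > 0"
proof -
  obtain T where T: "subspace T" "dim T = 3" "pos_def_on q T" using positive_space by blast
  obtain w where "w \<in> T" "w \<noteq> 0" "B w (fst z) = 0" "B w (snd z) = 0"
    using exists_orthogonal[OF T(1)] T(2) by (metis order_refl)
  then show ?thesis using T(3) that unfolding pos_def_on_def by blast
qed

lemma open_pos2: "open {z. pos2 q z}"
proof (subst open_subopen, clarify)
  fix z assume z: "pos2 q z"
  obtain w where "pos3 q z w" using pos3I[OF z] pos2_extend[of z] by metis
  moreover have "open ((\<lambda>z. (z, w)) -` {(z, w). pos3 q z w})"
    by (intro open_vimage open_pos3 continuous_intros)
  ultimately show "\<exists>T. open T \<and> z \<in> T \<and> T \<subseteq> {z. pos2 q z}"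
    by (intro exI[of _ "(\<lambda>z. (z, w)) -` {(z, w). pos3 q z w}"]) (auto intro: pos3_imp_pos2)
qed

lemma pos2_wedge_neq_0:
  assumes "pos2 q z"
  shows "wedge (fst z) (snd z) \<noteq> 0"
proof
  assume "wedge (fst z) (snd z) = 0"
  then have *: "(snd z \<bullet> snd z) *\<^sub>R fst z + (- (fst z \<bullet> snd z)) *\<^sub>R snd z = 0"
    using wedge_mult[of "fst z" "snd z" "snd z"] by simp
  have "snd z \<bullet> snd z = 0"
  proof (rule ccontr)
    assume "snd z \<bullet> snd z \<noteq> 0"
    then have "q ((snd z \<bullet> snd z) *\<^sub>R fst z + (- (fst z \<bullet> snd z)) *\<^sub>R snd z) > 0"
      using assms unfolding pos2_def by blast
    then show False unfolding * by simp
  qed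
  moreover have "q (0 *\<^sub>R fst z + 1 *\<^sub>R snd z) > 0"
    using assms unfolding pos2_def by (metis prod.inject zero_neq_one)
  ultimately show False by simp
qed

text \<open>A turn towards \<open>w\<close> does not leave the three-space spanned by \<open>u, v, w\<close>.\<close>

lemma pos3_move:
  assumes "pos3 q z w"
  shows "pos3 q (z + (a *\<^sub>R w, b *\<^sub>R w)) w"
  unfolding pos3_def
proof (intro allI impI)
  fix i j k :: real assume "(i, j, k) \<noteq> (0, 0, 0)"
  then have "(i, j, k + i * a + j * b) \<noteq> (0, 0, 0)" by auto
  then have "q (i *\<^sub>R fst z + j *\<^sub>R snd z + (k + i * a + j * b) *\<^sub>R w) > 0"
    using assms unfolding pos3_def by blast
  then show "q (i *\<^sub>R fst (z + (a *\<^sub>R w, b *\<^sub>R w)) + j *\<^sub>R snd (z + (a *\<^sub>R w, b *\<^sub>R w)) + k *\<^sub>R w) > 0"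
    by (simp add: algebra_simps)
qed

lemma span_pair_iff: "x \<in> span {u, v} \<longleftrightarrow> (\<exists>a b. x = a *\<^sub>R u + b *\<^sub>R (v::real ^ 'n))"
  by (auto simp: span_insert span_breakdown_eq algebra_simps)

lemma pos_def_on_span_pair:
  assumes "wedge u v \<noteq> 0"
  shows "pos_def_on q (span {u, v}) \<longleftrightarrow> pos2 q (u, v)"
proof -
  have "a *\<^sub>R u + b *\<^sub>R v = 0 \<longleftrightarrow> (a, b) = (0, 0)" for a b
    using independent_pair_coeffs[OF wedge_neq_0_imp_independent[OF assms], of a b] by auto
  moreover have "pos_def_on q (span {u, v}) \<longleftrightarrow>
      (\<forall>a b. a *\<^sub>R u + b *\<^sub>R v \<noteq> 0 \<longrightarrow> q (a *\<^sub>R u + b *\<^sub>R v) > 0)"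
    unfolding pos_def_on_def Ball_def span_pair_iff by metis
  ultimately show ?thesis unfolding pos2_def by simp
qed

lemma Per_eq: "Per q = plane ` {z. pos2 q z}"
proof
  show "Per q \<subseteq> plane ` {z. pos2 q z}"
  proof
    fix p assume "p \<in> Per q"
    then obtain u v where *: "p = pluecker (oriented_span u v)" "u \<noteq> v" "independent {u, v}"
      "pos_def_on q (underlying (oriented_span u v))"
      unfolding Per_def oriented_planes_def by blast
    then have "pos2 q (u, v)"
      using pos_def_on_span_pair[OF wedge_neq_0[OF *(2,3)]] by (simp add: underlying_oriented_span)
    then show "p \<in> plane ` {z. pos2 q z}"
      using *(1) by (auto simp: pluecker_oriented_span plane_def intro!: image_eqI[of _ _ "(u, v)"])
  qed
  show "plane ` {z. pos2 q z} \<subseteq> Per q"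
  proof clarify
    fix u v assume p: "pos2 q (u, v)"
    then have w: "wedge u v \<noteq> 0" using pos2_wedge_neq_0 by fastforce
    have "oriented_span u v \<in> oriented_planes"
      using wedge_neq_0_imp_independent[OF w] unfolding oriented_planes_def by blast
    moreover have "pos_def_on q (underlying (oriented_span u v))"
      using pos_def_on_span_pair[OF w] p by (simp add: underlying_oriented_span)
    moreover have "plane (u, v) = pluecker (oriented_span u v)"
      by (simp add: pluecker_oriented_span plane_def)
    ultimately show "plane (u, v) \<in> Per q" unfolding Per_def by blast
  qed
qed

lemma Tw_eq:
  fixes T :: "(real ^ 'n) set"
  shows "Tw T = plane ` {z. wedge (fst z) (snd z) \<noteq> 0 \<and> span {fst z, snd z} \<subseteq> T}"
proof
  show "Tw T \<subseteq> plane ` {z. wedge (fst z) (snd z) \<noteq> 0 \<and> span {fst z, snd z} \<subseteq> T}"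
  proof
    fix p assume "p \<in> Tw T"
    then obtain u v where *: "p = pluecker (oriented_span u v)" "u \<noteq> v" "independent {u, v}"
      "underlying (oriented_span u v) \<subseteq> T"
      unfolding Tw_def oriented_planes_def by blast
    then show "p \<in> plane ` {z. wedge (fst z) (snd z) \<noteq> 0 \<and> span {fst z, snd z} \<subseteq> T}"
      using wedge_neq_0[OF *(2,3)]
      by (auto simp: pluecker_oriented_span plane_def underlying_oriented_span intro!: image_eqI[of _ _ "(u, v)"])
  qed
  show "plane ` {z. wedge (fst z) (snd z) \<noteq> 0 \<and> span {fst z, snd z} \<subseteq> T} \<subseteq> Tw T"
  proof clarify
    fix u v :: "real ^ 'n" assume w: "wedge (fst (u, v)) (snd (u, v)) \<noteq> 0" "span {fst (u, v), snd (u, v)} \<subseteq> T"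
    have "oriented_span u v \<in> oriented_planes"
      using wedge_neq_0_imp_independent[of u v] w unfolding oriented_planes_def by auto
    moreover have "plane (u, v) = pluecker (oriented_span u v)"
      by (simp add: pluecker_oriented_span plane_def)
    ultimately show "plane (u, v) \<in> Tw T" using w unfolding Tw_def
      by (auto simp: underlying_oriented_span)
  qed
qed

lemma Tw_subset_Per:
  fixes T :: "(real ^ 'n) set"
  assumes "pos_def_on q T"
  shows "Tw T \<subseteq> Per q"
  unfolding Tw_eq Per_eq
proof clarify
  fix u v :: "real ^ 'n" assume "wedge (fst (u, v)) (snd (u, v)) \<noteq> 0" "span {fst (u, v), snd (u, v)} \<subseteq> T"
  then have "pos2 q (u, v)"
    using pos_def_on_span_pair[of u v] assms unfolding pos_def_on_def by auto
  then show "plane (u, v) \<in> plane ` {z. pos2 q z}" by blast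
qed

lemma Per_wedge:
  assumes "p \<in> Per q"
  obtains u v k where "p = k *\<^sub>R wedge u v" "pos2 q (u, v)" "p = plane (u, v)" "k > 0" "norm p = 1"
proof -
  obtain u v where *: "p = plane (u, v)" "pos2 q (u, v)" using assms unfolding Per_eq by auto
  then have "wedge u v \<noteq> 0" using pos2_wedge_neq_0 by fastforce
  then show ?thesis
    using * by (intro that[of "inverse (norm (wedge u v))" u v])
       (auto simp: plane_def sgn_div_norm norm_sgn)
qed

text \<open>Applying the matrix \<open>p\<close> to fixed vectors gives a frame of the plane \<open>p\<close> that depends linearly
  on \<open>p\<close>.\<close>

definition frame :: "real ^ 'n \<Rightarrow> real ^ 'n \<Rightarrow> real ^ 'n ^ 'n \<Rightarrow> (real ^ 'n) \<times> (real ^ 'n)" where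
  "frame \<alpha> \<beta> p = (p *v \<alpha>, p *v \<beta>)"

lemma bounded_linear_frame: "bounded_linear (frame \<alpha> \<beta>)"
proof -
  have "bounded_linear (\<lambda>p. p *v x)" for x :: "real ^ 'n"
    by (rule linear_conv_bounded_linear[THEN iffD1])
       (auto intro!: linearI simp: matrix_vector_mult_add_rdistrib scaleR_matrix_vector_assoc)
  then show ?thesis unfolding frame_def[abs_def] by (intro bounded_linear_Pair)
qed

lemma frame_section:
  assumes "p \<in> Per q" "\<alpha> \<bullet> (p *v \<beta>) > 0"
  shows "plane (frame \<alpha> \<beta> p) = p" "pos2 q (frame \<alpha> \<beta> p)"
proof -
  obtain u v k where k: "p = k *\<^sub>R wedge u v" "pos2 q (u, v)" "norm p = 1"
    using Per_wedge[OF assms(1)] by metis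
  have w: "wedge (p *v \<alpha>) (p *v \<beta>) = (\<alpha> \<bullet> (p *v \<beta>)) *\<^sub>R p" by (rule wedge_matrix_vector[OF k(1)])
  show "plane (frame \<alpha> \<beta> p) = p"
    using assms(2) k(3) by (simp add: plane_def frame_def w sgn_scaleR) (simp add: sgn_div_norm)
  have nz: "wedge (p *v \<alpha>) (p *v \<beta>) \<noteq> 0" using w assms(2) k(3) by auto
  have "wedge u v \<noteq> 0" using k(1,3) by auto
  then have "pos_def_on q (span {u, v})" using pos_def_on_span_pair k(2) by simp
  moreover have "span {p *v \<alpha>, p *v \<beta>} \<subseteq> span {u, v}"
    using matrix_vector_in_span[OF k(1)] by (intro span_minimal) auto
  ultimately have "pos_def_on q (span {p *v \<alpha>, p *v \<beta>})" unfolding pos_def_on_def by blast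
  then show "pos2 q (frame \<alpha> \<beta> p)" using pos_def_on_span_pair[OF nz] by (simp add: frame_def)
qed

lemma exists_frame:
  assumes "p \<in> Per q"
  obtains \<alpha> \<beta> where "\<alpha> \<bullet> (p *v \<beta>) > 0"
proof -
  have "p \<noteq> 0" using Per_wedge[OF assms] by fastforce
  then show ?thesis using exists_positive_entry that by blast
qed

lemma open_frame_domain:
  fixes \<alpha> \<beta> :: "real ^ 'n"
  shows "open {p. \<alpha> \<bullet> (p *v \<beta>) > (0::real)}"
proof -
  have "continuous_on UNIV (\<lambda>p. snd (frame \<alpha> \<beta> p))"
    by (intro continuous_intros bounded_linear.continuous_on[OF bounded_linear_frame])
  then show ?thesis unfolding frame_def
    by (intro open_Collect_less continuous_intros) simp
qed

text \<open>Near \<open>s\<close> the curve equals \<open>plane\<close> of its frame, so the chain rule applies. The derivative may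
  be one-sided, as at the end points of the pieces of a path.\<close>

lemma velocity_dplane:
  fixes c :: "real \<Rightarrow> real ^ 'n ^ 'n"
  assumes "(c has_vector_derivative \<xi>) (at s within S)" "at s within S \<noteq> bot" "s \<in> S"
    and "c ` S \<subseteq> Per q" "\<alpha> \<bullet> (c s *v \<beta>) > 0"
  shows "\<xi> = dplane (frame \<alpha> \<beta> (c s)) (frame \<alpha> \<beta> \<xi>)"
proof -
  let ?z = "\<lambda>r. frame \<alpha> \<beta> (c r)"
  have cs: "c s \<in> Per q" using assms by auto
  have nz: "wedge (fst (?z s)) (snd (?z s)) \<noteq> 0"
    using pos2_wedge_neq_0 frame_section(2)[OF cs assms(5)] by blast
  have "(?z has_derivative (\<lambda>h. frame \<alpha> \<beta> (h *\<^sub>R \<xi>))) (at s within S)"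
    using bounded_linear.has_derivative[OF bounded_linear_frame] assms(1)
    unfolding has_vector_derivative_def by blast
  from has_derivative_compose[OF this has_derivative_plane[OF nz]]
  have *: "((\<lambda>r. plane (?z r)) has_vector_derivative dplane (?z s) (frame \<alpha> \<beta> \<xi>)) (at s within S)"
    unfolding has_vector_derivative_def
    by (simp add: linear_cmul[OF linear_dplane] linear_cmul[OF bounded_linear.linear[OF bounded_linear_frame]])
  have "continuous (at s within S) c" using assms(1) has_vector_derivative_continuous by blast
  then have "\<forall>\<^sub>F r in at s within S. c r \<in> {p. \<alpha> \<bullet> (p *v \<beta>) > 0}"
    unfolding continuous_within using topological_tendstoD[OF _ open_frame_domain] assms(5) by blast
  then have "\<forall>\<^sub>F r in at s within S. plane (?z r) = c r"
    using frame_section(1) assms(4) by (auto simp: eventually_at_filter elim!: eventually_mono)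
  then have "(c has_vector_derivative dplane (?z s) (frame \<alpha> \<beta> \<xi>)) (at s within S)"
    using * frame_section(1)[OF cs assms(5)] unfolding has_vector_derivative_def
    by (simp add: has_derivative_transform_eventually[OF _ _ _ assms(3)])
  then show ?thesis using vector_derivative_unique_within assms(1,2) by blast
qed

lemma dplane_in_tangent_space:
  assumes "pos2 q z"
  shows "dplane z f \<in> tangent_space (Per q) (plane z)"
proof -
  have "open ((\<lambda>t::real. z + t *\<^sub>R f) -` {z. pos2 q z})"
    by (intro open_vimage open_pos2 continuous_intros)
  moreover have "0 \<in> (\<lambda>t::real. z + t *\<^sub>R f) -` {z. pos2 q z}" using assms by simp
  ultimately obtain \<epsilon> where \<epsilon>: "\<epsilon> > 0" "ball 0 \<epsilon> \<subseteq> (\<lambda>t::real. z + t *\<^sub>R f) -` {z. pos2 q z}"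
    using open_contains_ball by blast
  let ?c = "\<lambda>t. plane (z + t *\<^sub>R f)"
  have p: "pos2 q (z + t *\<^sub>R f)" if "t \<in> {-\<epsilon><..<\<epsilon>}" for t
  proof -
    have "t \<in> ball 0 \<epsilon>" using that by (auto simp: dist_real_def)
    then show ?thesis using \<epsilon> by blast
  qed
  have "smooth_map {-\<epsilon><..<\<epsilon>} ?c"
    using p pos2_wedge_neq_0 by (intro smooth_map_plane_line) blast
  moreover have "?c ` {-\<epsilon><..<\<epsilon>} \<subseteq> Per q" using p Per_eq by blast
  moreover have "(?c has_vector_derivative dplane z f) (at 0)"
    using has_vector_derivative_plane_line[of z 0 f UNIV] pos2_wedge_neq_0[OF assms] by simp
  ultimately show ?thesis unfolding tangent_space_def using \<epsilon>(1) by fastforce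
qed

text \<open>This description as a fixed-point set of a linear map shows that the tangent space is a subspace,
  and it lifts tangent vectors linearly to the space of frames.\<close>

lemma tangent_space_frame:
  assumes "p \<in> Per q" "\<alpha> \<bullet> (p *v \<beta>) > 0"
  shows "\<xi> \<in> tangent_space (Per q) p \<longleftrightarrow> \<xi> = dplane (frame \<alpha> \<beta> p) (frame \<alpha> \<beta> \<xi>)"
proof
  assume "\<xi> \<in> tangent_space (Per q) p"
  then obtain \<epsilon> c where c: "\<epsilon> > (0::real)" "c ` {-\<epsilon><..<\<epsilon>} \<subseteq> Per q" "c 0 = p"
    "(c has_vector_derivative \<xi>) (at 0)" unfolding tangent_space_def by blast
  have a: "at (0::real) within {-\<epsilon><..<\<epsilon>} = at 0" using c(1) by (intro at_within_open) auto
  show "\<xi> = dplane (frame \<alpha> \<beta> p) (frame \<alpha> \<beta> \<xi>)"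
    using velocity_dplane[of c \<xi> 0 "{-\<epsilon><..<\<epsilon>}" \<alpha> \<beta>] c assms unfolding a by simp
next
  assume "\<xi> = dplane (frame \<alpha> \<beta> p) (frame \<alpha> \<beta> \<xi>)"
  then show "\<xi> \<in> tangent_space (Per q) p"
    using dplane_in_tangent_space[OF frame_section(2)[OF assms], of "frame \<alpha> \<beta> \<xi>"]
      frame_section(1)[OF assms] by simp
qed

lemma subspace_tangent_space:
  assumes "p \<in> Per q"
  shows "subspace (tangent_space (Per q) p)"
proof -
  obtain \<alpha> \<beta> where ab: "\<alpha> \<bullet> (p *v \<beta>) > 0" using exists_frame[OF assms] .
  have F: "linear (frame \<alpha> \<beta>)" using bounded_linear_frame bounded_linear.linear by blast
  define L where "L = (\<lambda>\<xi>. dplane (frame \<alpha> \<beta> p) (frame \<alpha> \<beta> \<xi>))"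
  have L: "linear L"
    using linear_compose[OF F linear_dplane[of "frame \<alpha> \<beta> p"]] by (simp add: L_def o_def)
  have "\<xi> \<in> tangent_space (Per q) p \<longleftrightarrow> L \<xi> = \<xi>" for \<xi>
    unfolding tangent_space_frame[OF assms ab] L_def by auto
  then show ?thesis
    unfolding subspace_def by (simp add: linear_0[OF L] linear_add[OF L] linear_cmul[OF L])
qed

lemma pos3_span:
  assumes "pos3 q (u, v) w"
  shows "dim (span {u, v, w}) = 3" "pos_def_on q (span {u, v, w})"
proof -
  have i: "a = 0 \<and> b = 0 \<and> c = 0" if "a *\<^sub>R u + b *\<^sub>R v + c *\<^sub>R w = 0" for a b c
  proof (rule ccontr)
    assume "\<not> ?thesis"
    then have "(a, b, c) \<noteq> (0, 0, 0)" by auto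
    then have "q (a *\<^sub>R u + b *\<^sub>R v + c *\<^sub>R w) > 0" using assms unfolding pos3_def by fastforce
    then show False unfolding that by simp
  qed
  have m: "\<exists>a b c. x = a *\<^sub>R u + b *\<^sub>R v + c *\<^sub>R w" if x: "x \<in> span {u, v, w}" for x
  proof -
    obtain a where "x - a *\<^sub>R u \<in> span {v, w}" using x unfolding span_breakdown_eq[of x u] by blast
    then obtain b c where "x - a *\<^sub>R u = b *\<^sub>R v + c *\<^sub>R w" unfolding span_pair_iff by blast
    then have "x = a *\<^sub>R u + b *\<^sub>R v + c *\<^sub>R w" by (simp add: algebra_simps)
    then show ?thesis by blast
  qed
  show "pos_def_on q (span {u, v, w})"
    unfolding pos_def_on_def
  proof (intro ballI impI)
    fix x assume x: "x \<in> span {u, v, w}" "x \<noteq> 0"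
    then obtain a b c where e: "x = a *\<^sub>R u + b *\<^sub>R v + c *\<^sub>R w" using m by blast
    then have "(a, b, c) \<noteq> (0, 0, 0)" using x(2) by auto
    then show "q x > 0" using assms unfolding pos3_def e by simp
  qed
  have "w \<noteq> 0" using i[of 0 0 1] by auto
  moreover have "v \<notin> span {w}"
  proof
    assume "v \<in> span {w}"
    then obtain k where "v = k *\<^sub>R w" by (auto simp: span_singleton)
    then show False using i[of 0 1 "- k"] by simp
  qed
  moreover have "u \<notin> span {v, w}"
  proof
    assume "u \<in> span {v, w}"
    then obtain k l where "u = k *\<^sub>R v + l *\<^sub>R w" unfolding span_pair_iff by blast
    then show False using i[of 1 "- k" "- l"] by simp
  qed
  ultimately show "dim (span {u, v, w}) = 3"
    by (simp add: dim_insert)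
qed

lemma pos3_wedge_neq_0: "pos3 q z w \<Longrightarrow> wedge (fst z) (snd z) \<noteq> 0"
  using pos3_imp_pos2 pos2_wedge_neq_0 by blast

text \<open>The line of frames that starts in the direction \<open>(aw, bw)\<close> consists of frames of planes inside
  the three-space spanned by \<open>u, v, w\<close>, hence runs in a single twistor sphere.\<close>

lemma dplane_in_twistor_cone:
  assumes "pos3 q z w"
  shows "dplane z (a *\<^sub>R w, b *\<^sub>R w) \<in> twistor_cone q (plane z)"
proof -
  obtain u v where z: "z = (u, v)" by (cases z)
  let ?T = "span {u, v, w}" and ?f = "(a *\<^sub>R w, b *\<^sub>R w)"
  let ?c = "\<lambda>t. plane (z + t *\<^sub>R ?f)"
  have p: "pos3 q (z + t *\<^sub>R ?f) w" for t
    using pos3_move[OF assms, of "t * a" "t * b"] by simp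
  have Tw: "?c t \<in> Tw ?T" for t
  proof -
    have "u \<in> ?T" "v \<in> ?T" "w \<in> ?T" by (auto intro: span_base)
    then have "span {fst (z + t *\<^sub>R ?f), snd (z + t *\<^sub>R ?f)} \<subseteq> ?T"
      by (intro span_minimal) (auto simp: z intro!: span_add span_scale)
    then show ?thesis unfolding Tw_eq using pos3_wedge_neq_0[OF p[of t]] by blast
  qed
  have "smooth_map {-1<..<1} ?c"
    using p pos3_wedge_neq_0 by (intro smooth_map_plane_line) blast
  moreover have "(?c has_vector_derivative dplane z ?f) (at 0)"
    using has_vector_derivative_plane_line[of z 0 ?f UNIV] pos3_wedge_neq_0[OF assms]
    by (simp add: zero_prod_def[symmetric])
  moreover have "?c ` {-1<..<1} \<subseteq> Tw ?T" using Tw by auto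
  moreover have "?c 0 = plane z" by (simp add: zero_prod_def[symmetric])
  ultimately have "dplane z ?f \<in> tangent_space (Tw ?T) (plane z)"
    unfolding tangent_space_def mem_Collect_eq
    by (intro exI[of _ "1::real"] conjI exI[of _ ?c]) auto
  moreover have "Tw ?T \<in> twistor_spheres q"
    unfolding twistor_spheres_def using pos3_span assms z by auto
  moreover have "plane z \<in> Tw ?T" using Tw[of 0] by (simp add: zero_prod_def[symmetric])
  ultimately show ?thesis unfolding twistor_cone_def by blast
qed

text \<open>Conversely the frame of a curve in the twistor sphere of \<open>T\<close> stays in \<open>T\<close>, and \<open>T\<close> is the plane
  plus one orthogonal positive line. The velocity of the frame agrees with \<open>(aw, bw)\<close> only up to
  vectors of the plane, which \<open>dplane\<close> does not see; the path comparison needs this remainder.\<close>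

lemma twistor_coneE:
  assumes "\<eta> \<in> twistor_cone q p" "p \<in> Per q" "\<alpha> \<bullet> (p *v \<beta>) > 0"
  obtains a b w where "B w (p *v \<alpha>) = 0" "B w (p *v \<beta>) = 0" "q w > 0"
    "\<eta> *v \<alpha> - a *\<^sub>R w \<in> span {p *v \<alpha>, p *v \<beta>}" "\<eta> *v \<beta> - b *\<^sub>R w \<in> span {p *v \<alpha>, p *v \<beta>}"
    "\<eta> = dplane (frame \<alpha> \<beta> p) (a *\<^sub>R w, b *\<^sub>R w)"
proof -
  obtain T where T: "subspace T" "dim T = 3" "pos_def_on q T" "p \<in> Tw T"
    "\<eta> \<in> tangent_space (Tw T) p"
    using assms(1) unfolding twistor_cone_def twistor_spheres_def by blast
  then obtain \<epsilon> c where c: "\<epsilon> > (0::real)" "c ` {-\<epsilon><..<\<epsilon>} \<subseteq> Tw T" "c 0 = p"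
    "(c has_vector_derivative \<eta>) (at 0)" unfolding tangent_space_def by blast
  have at: "at (0::real) within {-\<epsilon><..<\<epsilon>} = at 0" using c(1) by (intro at_within_open) auto
  have TwT: "x *v y \<in> T" if x: "x \<in> Tw T" for x y
  proof -
    obtain z where z: "x = plane z" "span {fst z, snd z} \<subseteq> T" using x unfolding Tw_eq by blast
    have "x = inverse (norm (wedge (fst z) (snd z))) *\<^sub>R wedge (fst z) (snd z)"
      unfolding z(1) plane_def sgn_div_norm ..
    from matrix_vector_in_span[OF this] show ?thesis using z(2) by blast
  qed
  have d: "\<eta> *v y \<in> T" for y
  proof (rule has_vector_derivative_in_subspace[OF _ _ T(1), of "\<lambda>t. c t *v y" "\<eta> *v y" 0 "{-\<epsilon><..<\<epsilon>}"])
    have "bounded_linear (\<lambda>p :: real ^ 'n ^ 'n. p *v y)"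
      using bounded_linear_compose[OF bounded_linear_fst bounded_linear_frame[of y y]]
      by (simp add: frame_def)
    from bounded_linear.has_vector_derivative[OF this c(4)]
    show "((\<lambda>t. c t *v y) has_vector_derivative \<eta> *v y) (at 0 within {-\<epsilon><..<\<epsilon>})" unfolding at .
    show "at 0 within {-\<epsilon><..<\<epsilon>} \<noteq> bot" unfolding at by simp
    show "c r *v y \<in> T" if "r \<in> {-\<epsilon><..<\<epsilon>}" for r using TwT c(2) that by blast
    show "c 0 *v y \<in> T" using TwT T(4) c(3) by simp
  qed
  let ?u = "p *v \<alpha>" and ?v = "p *v \<beta>"
  have p2: "pos2 q (?u, ?v)" using frame_section(2)[OF assms(2,3)] by (simp add: frame_def)
  obtain w where w: "w \<in> T" "w \<noteq> 0" "B w ?u = 0" "B w ?v = 0"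
    using exists_orthogonal[OF T(1)] T(2) by (metis order_refl)
  have qw: "q w > 0" using T(3) w unfolding pos_def_on_def by blast
  have p3: "pos3 q (?u, ?v) w" using pos3I[OF p2] w qw by simp
  have sub: "span {?u, ?v, w} \<subseteq> T" using TwT[OF T(4)] w(1) by (intro span_minimal T(1)) auto
  have Teq: "span {w, ?u, ?v} = T"
    using subspace_dim_equal[OF subspace_span T(1) sub] pos3_span(1)[OF p3] T(2)
    by (simp add: insert_commute)
  obtain a b where a: "\<eta> *v \<alpha> - a *\<^sub>R w \<in> span {?u, ?v}" and b: "\<eta> *v \<beta> - b *\<^sub>R w \<in> span {?u, ?v}"
    using d[of \<alpha>] d[of \<beta>] unfolding Teq[symmetric] span_breakdown_eq[of _ w] by blast
  have "c ` {-\<epsilon><..<\<epsilon>} \<subseteq> Per q" using c(2) Tw_subset_Per[OF T(3)] by blast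
  then have "\<eta> = dplane (frame \<alpha> \<beta> p) (frame \<alpha> \<beta> \<eta>)"
    using velocity_dplane[of c \<eta> 0 "{-\<epsilon><..<\<epsilon>}" \<alpha> \<beta>] c assms(3) unfolding at by simp
  also have "frame \<alpha> \<beta> \<eta> = (\<eta> *v \<alpha> - a *\<^sub>R w, \<eta> *v \<beta> - b *\<^sub>R w) + (a *\<^sub>R w, b *\<^sub>R w)"
    by (simp add: frame_def)
  also have "dplane (frame \<alpha> \<beta> p) \<dots> = dplane (frame \<alpha> \<beta> p) (a *\<^sub>R w, b *\<^sub>R w)"
    unfolding linear_add[OF linear_dplane] using a b by (simp add: dplane_span frame_def)
  finally show ?thesis using that[OF w(3,4) qw a b] by blast
qed

lemma twistor_cone_subset_tangent_space:
  assumes "p \<in> Per q"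
  shows "twistor_cone q p \<subseteq> tangent_space (Per q) p"
proof
  fix \<eta> assume \<eta>: "\<eta> \<in> twistor_cone q p"
  obtain \<alpha> \<beta> where ab: "\<alpha> \<bullet> (p *v \<beta>) > 0" using exists_frame[OF assms] .
  obtain f where "\<eta> = dplane (frame \<alpha> \<beta> p) f" using twistor_coneE[OF \<eta> assms ab] by metis
  then show "\<eta> \<in> tangent_space (Per q) p"
    using dplane_in_tangent_space[OF frame_section(2)[OF assms ab]] frame_section(1)[OF assms ab]
    by metis
qed

lemma scale_in_twistor_cone:
  assumes "p \<in> Per q" "\<eta> \<in> twistor_cone q p"
  shows "r *\<^sub>R \<eta> \<in> twistor_cone q p"
proof -
  obtain \<alpha> \<beta> where ab: "\<alpha> \<bullet> (p *v \<beta>) > 0" using exists_frame[OF assms(1)] .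
  let ?z = "frame \<alpha> \<beta> p"
  obtain a b w where w: "B w (p *v \<alpha>) = 0" "B w (p *v \<beta>) = 0" "q w > 0"
    "\<eta> = dplane ?z (a *\<^sub>R w, b *\<^sub>R w)" using twistor_coneE[OF assms(2,1) ab] by metis
  have "pos3 q ?z w"
    using w pos3I[OF frame_section(2)[OF assms(1) ab]] by (simp add: frame_def)
  moreover have "r *\<^sub>R \<eta> = dplane ?z ((r * a) *\<^sub>R w, (r * b) *\<^sub>R w)"
    unfolding w(4) linear_cmul[OF linear_dplane, symmetric] by simp
  ultimately show ?thesis using dplane_in_twistor_cone frame_section(1)[OF assms(1) ab] by metis
qed

lemma zero_in_twistor_cone:
  assumes "p \<in> Per q"
  shows "0 \<in> twistor_cone q p"
proof -
  obtain z where z: "p = plane z" "pos2 q z" using assms Per_eq by blast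
  obtain w where "pos3 q z w" using pos3I[OF z(2)] pos2_extend[of z] by metis
  from dplane_in_twistor_cone[OF this, of 0 0] show ?thesis
    using z(1) linear_0[OF linear_dplane, of z] by (simp add: zero_prod_def)
qed

end

section \<open>Piecewise smooth paths and chains of twistor arcs\<close>

lemma smooth_map_imp_continuous_on:
  assumes "smooth_map S f"
  shows "continuous_on S f"
  unfolding continuous_on_eq_continuous_within
proof
  fix x assume x: "x \<in> S"
  then obtain U F where U: "open U" "x \<in> U" "Ck 0 U F" "\<And>y. y \<in> U \<inter> S \<Longrightarrow> F y = f y"
    using assms unfolding smooth_map_def by metis
  have "continuous_on (U \<inter> S) F" using U(3) by (auto intro: continuous_on_subset)
  then have "continuous_on (S \<inter> U) f" using U(4) by (metis Int_commute continuous_on_cong)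
  then have "continuous (at x within S \<inter> U) f"
    using x U(2) by (simp add: continuous_on_eq_continuous_within)
  then show "continuous (at x within S) f"
    using at_within_nhd[of x U "S \<inter> U" S] U(1,2) by (simp add: Int_ac)
qed

lemma smooth_map_cong:
  assumes "smooth_map S f" "\<And>x. x \<in> S \<Longrightarrow> f x = h x"
  shows "smooth_map S h"
  unfolding smooth_map_def
proof
  fix x assume "x \<in> S"
  then obtain U F where "open U" "x \<in> U" "\<forall>k. Ck k U F" "\<forall>y\<in>U \<inter> S. F y = f y"
    using assms(1) unfolding smooth_map_def by blast
  then show "\<exists>U F. open U \<and> x \<in> U \<and> (\<forall>k. Ck k U F) \<and> (\<forall>y\<in>U \<inter> S. F y = h y)"
    using assms(2) by (intro exI[of _ U] exI[of _ F]) auto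
qed

lemma
  fixes c :: "real \<Rightarrow> 'e::euclidean_space"
  assumes ab: "a < b" and "smooth_map {a..b} c"
  shows smooth_map_has_vector_derivative: "s \<in> {a..b} \<Longrightarrow>
      (c has_vector_derivative vector_derivative c (at s within {a..b})) (at s within {a..b})"
    and smooth_map_continuous_derivative:
      "continuous_on {a..b} (\<lambda>s. vector_derivative c (at s within {a..b}))"
proof -
  let ?d = "\<lambda>s. vector_derivative c (at s within {a..b})"
  have loc: "\<exists>U D. open U \<and> s \<in> U \<and> continuous_on U D \<and>
      (\<forall>r\<in>U \<inter> {a..b}. (c has_vector_derivative D r) (at r within {a..b}))" if s: "s \<in> {a..b}" for s
  proof -
    obtain U F where U: "open U" "s \<in> U" "Ck 1 U F" "\<And>y. y \<in> U \<inter> {a..b} \<Longrightarrow> F y = c y"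
      using assms s unfolding smooth_map_def by metis
    have "(c has_vector_derivative frechet_derivative F (at r) 1) (at r within {a..b})"
      if r: "r \<in> U \<inter> {a..b}" for r
    proof -
      have F: "(F has_derivative frechet_derivative F (at r)) (at r)"
        using U(3) r by (simp add: frechet_derivative_works)
      define D where "D = frechet_derivative F (at r)"
      have "D h = h *\<^sub>R D 1" for h :: real
        using linear_cmul[OF has_derivative_linear[OF F], of h 1]
        unfolding D_def real_scaleR_def mult_1_right .
      then have "D = (\<lambda>h. h *\<^sub>R D 1)" by (rule ext)
      then have "(F has_vector_derivative D 1) (at r)"
        using F unfolding has_vector_derivative_def D_def[symmetric] by metis
      then have "(F has_vector_derivative frechet_derivative F (at r) 1) (at r)"
        unfolding D_def .
      then have "(F has_vector_derivative frechet_derivative F (at r) 1) (at r within {a..b})"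
        by (rule has_vector_derivative_at_within)
      moreover have "\<forall>\<^sub>F x in nhds r. x \<in> {a..b} \<longrightarrow> F x = c x"
        using U(1,4) r by (auto simp: eventually_nhds)
      ultimately show ?thesis
        using has_vector_derivative_cong_ev U(4)[OF r] by metis
    qed
    moreover have "continuous_on U (\<lambda>r. frechet_derivative F (at r) 1)" using U(3) by simp
    ultimately show ?thesis using U(1,2) by blast
  qed
  have eq: "?d r = D" if "r \<in> {a..b}" "(c has_vector_derivative D) (at r within {a..b})" for r D
    using vector_derivative_within_closed_interval[OF ab that] .
  show "(c has_vector_derivative ?d s) (at s within {a..b})" if "s \<in> {a..b}" for s
    using loc[OF that] eq that by (metis Int_iff)
  show "continuous_on {a..b} ?d"
    unfolding continuous_on_eq_continuous_within
  proof
    fix s assume s: "s \<in> {a..b}"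
    obtain U D where U: "open U" "s \<in> U" "continuous_on U D"
      "\<And>r. r \<in> U \<inter> {a..b} \<Longrightarrow> (c has_vector_derivative D r) (at r within {a..b})"
      using loc[OF s] by blast
    have "continuous_on ({a..b} \<inter> U) D" using U(3) by (auto intro: continuous_on_subset)
    moreover have "D r = ?d r" if "r \<in> {a..b} \<inter> U" for r
      using eq[of r "D r"] U(4)[of r] that by auto
    ultimately have "continuous_on ({a..b} \<inter> U) ?d" by (metis (no_types, lifting) continuous_on_cong)
    then have "continuous (at s within {a..b} \<inter> U) ?d"
      using s U(2) by (simp add: continuous_on_eq_continuous_within)
    then show "continuous (at s within {a..b}) ?d"
      using at_within_nhd[of s U "{a..b} \<inter> U" "{a..b}"] U(1,2) by (simp add: Int_ac)
  qed
qed

lemma partition_le: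
  fixes \<tau> :: "nat \<Rightarrow> real"
  assumes "\<And>i. i < n \<Longrightarrow> \<tau> i < \<tau> (Suc i)" "i \<le> j" "j \<le> n"
  shows "\<tau> i \<le> \<tau> j"
  using assms(2,3)
proof (induction j rule: dec_induct)
  case (step k)
  then show ?case using assms(1)[of k] by force
qed simp

lemma partition_interior:
  fixes \<tau> :: "nat \<Rightarrow> real"
  assumes "s \<in> {\<tau> 0..\<tau> n}" "s \<notin> \<tau> ` {..n}"
  obtains i where "i < n" "\<tau> i < s" "s < \<tau> (Suc i)"
proof -
  have "\<exists>i<n. \<tau> i < s \<and> s < \<tau> (Suc i)" using assms
  proof (induction n)
    case (Suc n)
    show ?case
    proof (cases "s < \<tau> n")
      case True
      have "\<exists>i<n. \<tau> i < s \<and> s < \<tau> (Suc i)"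
        by (rule Suc.IH) (use Suc.prems True in \<open>auto simp: atMost_Suc\<close>)
      then show ?thesis using less_SucI by blast
    next
      case False
      then have "\<tau> n < s" "s < \<tau> (Suc n)" using Suc.prems by (auto simp: less_le)
      then show ?thesis by blast
    qed
  qed auto
  then show ?thesis using that by blast
qed

context period_domain
begin

lemma velocity_in_tangent_space:
  fixes c :: "real \<Rightarrow> real ^ 'n ^ 'n"
  assumes "(c has_vector_derivative \<xi>) (at s within S)" "at s within S \<noteq> bot" "s \<in> S"
    and "c ` S \<subseteq> Per q"
  shows "\<xi> \<in> tangent_space (Per q) (c s)"
proof -
  have cs: "c s \<in> Per q" using assms by auto
  obtain \<alpha> \<beta> where ab: "\<alpha> \<bullet> (c s *v \<beta>) > 0" using exists_frame[OF cs] .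
  show ?thesis
    using velocity_dplane[OF assms ab] tangent_space_frame[OF cs ab] by blast
qed

lemma piece_velocity:
  fixes c :: "real \<Rightarrow> real ^ 'n ^ 'n"
  assumes "a < b" "smooth_map {a..b} c" "c ` {a..b} \<subseteq> Per q"
    and "s \<in> {a..b}"
  shows "vector_derivative c (at s within {a..b}) \<in> tangent_space (Per q) (c s)"
  using velocity_in_tangent_space[OF smooth_map_has_vector_derivative[OF assms(1,2,4)] _ assms(4,3)]
    assms(1,4) by (simp add: trivial_limit_within)

lemma piece_continuous:
  fixes c :: "real \<Rightarrow> real ^ 'n ^ 'n"
  assumes "a < b" "smooth_map {a..b} c" "c ` {a..b} \<subseteq> Per q"
    and \<mu>: "continuous_on (tangent_bundle (Per q)) (\<lambda>(p, v). \<mu> p v)"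
  shows "continuous_on {a..b} (\<lambda>s. \<mu> (c s) (vector_derivative c (at s within {a..b})))"
proof -
  have "continuous_on {a..b} (\<lambda>s. (c s, vector_derivative c (at s within {a..b})))"
    by (intro continuous_intros smooth_map_imp_continuous_on smooth_map_continuous_derivative assms)
  moreover have "(\<lambda>s. (c s, vector_derivative c (at s within {a..b}))) ` {a..b} \<subseteq> tangent_bundle (Per q)"
    using assms(3) piece_velocity[OF assms(1-3)] unfolding tangent_bundle_def by blast
  ultimately show ?thesis using continuous_on_compose2[OF \<mu>] by fastforce
qed

text \<open>The break points are a finite set, so path lengths may be computed from the one-sided velocities
  of the single pieces, which are continuous on closed intervals.\<close>

lemma path_pieces:
  fixes \<mu> :: "real ^ 'n ^ 'n \<Rightarrow> real ^ 'n ^ 'n \<Rightarrow> real" and c :: "real \<Rightarrow> real ^ 'n ^ 'n"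
  assumes \<tau>: "\<tau> 0 = 0" "\<And>i. i < n \<Longrightarrow> \<tau> i < \<tau> (Suc i)" "\<And>i. i < n \<Longrightarrow> smooth_map {\<tau> i..\<tau> (Suc i)} c"
    and c: "c ` {0..\<tau> n} \<subseteq> Per q"
    and \<mu>: "continuous_on (tangent_bundle (Per q)) (\<lambda>(p, v). \<mu> p v)"
  shows "((\<lambda>s. \<mu> (c s) (vector_derivative c (at s within {0..\<tau> n}))) has_integral
      (\<Sum>i<n. integral {\<tau> i..\<tau> (Suc i)} (\<lambda>s. \<mu> (c s) (vector_derivative c (at s within {\<tau> i..\<tau> (Suc i)})))))
      {0..\<tau> n}"
proof -
  let ?f = "\<lambda>s. \<mu> (c s) (vector_derivative c (at s within {0..\<tau> n}))"
  let ?h = "\<lambda>i s. \<mu> (c s) (vector_derivative c (at s within {\<tau> i..\<tau> (Suc i)}))"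
  have "(?f has_integral (\<Sum>i<k. integral {\<tau> i..\<tau> (Suc i)} (?h i))) {0..\<tau> k}" if "k \<le> n" for k
    using that
  proof (induction k)
    case (Suc k)
    have k: "k < n" using Suc by simp
    have sub: "0 \<le> \<tau> k" "\<tau> (Suc k) \<le> \<tau> n"
      using partition_le[of n \<tau> 0 k] partition_le[of n \<tau> "Suc k" n] \<tau> k by auto
    then have "c ` {\<tau> k..\<tau> (Suc k)} \<subseteq> Per q" using c by force
    then have "continuous_on {\<tau> k..\<tau> (Suc k)} (?h k)"
      by (rule piece_continuous[OF \<tau>(2)[OF k] \<tau>(3)[OF k] _ \<mu>])
    then have "(?h k has_integral integral {\<tau> k..\<tau> (Suc k)} (?h k)) {\<tau> k..\<tau> (Suc k)}"
      by (rule integrable_integral[OF integrable_continuous_real])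
    moreover have "?f s = ?h k s" if "s \<in> {\<tau> k..\<tau> (Suc k)} - {\<tau> k, \<tau> (Suc k)}" for s
    proof -
      have "at s within {0..\<tau> n} = at s" "at s within {\<tau> k..\<tau> (Suc k)} = at s"
        using that sub by (auto intro!: at_within_Icc_at)
      then show ?thesis by simp
    qed
    ultimately have "(?f has_integral integral {\<tau> k..\<tau> (Suc k)} (?h k)) {\<tau> k..\<tau> (Suc k)}"
      by (intro has_integral_spike_finite[of "{\<tau> k, \<tau> (Suc k)}" _ ?f "?h k"]) auto
    then show ?case
      using has_integral_combine[of 0 "\<tau> k" "\<tau> (Suc k)"] Suc sub \<tau>(2)[OF k] by (simp add: less_imp_le)
  qed (simp add: \<tau> has_integral_refl)
  then show ?thesis by blast
qed

lemma path_facts: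
  fixes c :: "real \<Rightarrow> real ^ 'n ^ 'n"
  assumes "(t, c) \<in> paths (Per q) x y"
  obtains F where "finite F"
    "\<And>s. s \<in> {0..t} - F \<Longrightarrow> 0 < s \<and> s < t \<and>
       (c has_vector_derivative vector_derivative c (at s within {0..t})) (at s within {0..t}) \<and>
       vector_derivative c (at s within {0..t}) \<in> tangent_space (Per q) (c s)"
proof -
  obtain n \<tau> where \<tau>: "\<tau> 0 = 0" "\<tau> n = t" "\<And>i. i < n \<Longrightarrow> \<tau> i < \<tau> (Suc i)"
      "\<And>i. i < n \<Longrightarrow> smooth_map {\<tau> i..\<tau> (Suc i)} c"
    using assms unfolding paths_def piecewise_smooth_def by blast
  have c: "c ` {0..t} \<subseteq> Per q" using assms unfolding paths_def by blast
  show ?thesis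
  proof (rule that[of "\<tau> ` {..n}"])
    fix s assume s: "s \<in> {0..t} - \<tau> ` {..n}"
    then obtain i where i: "i < n" "\<tau> i < s" "s < \<tau> (Suc i)"
      using partition_interior[of s \<tau> n] \<tau>(1,2) by auto
    have b: "0 \<le> \<tau> i" "\<tau> (Suc i) \<le> t"
      using partition_le[of n \<tau> 0 i] partition_le[of n \<tau> "Suc i" n] \<tau> i by auto
    have at: "at s within {0..t} = at s" "at s within {\<tau> i..\<tau> (Suc i)} = at s"
      using i b by (auto intro!: at_within_Icc_at)
    have *: "(c has_vector_derivative vector_derivative c (at s within {0..t})) (at s within {0..t})"
      using smooth_map_has_vector_derivative[OF \<tau>(3)[OF i(1)] \<tau>(4)[OF i(1)], of s] i
      unfolding at by simp
    then have "vector_derivative c (at s within {0..t}) \<in> tangent_space (Per q) (c s)"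
      using velocity_in_tangent_space[OF *] s c at by auto
    then show "0 < s \<and> s < t \<and>
       (c has_vector_derivative vector_derivative c (at s within {0..t})) (at s within {0..t}) \<and>
       vector_derivative c (at s within {0..t}) \<in> tangent_space (Per q) (c s)"
      using * i b by auto
  qed simp
qed

lemma path_integrable:
  fixes \<mu> :: "real ^ 'n ^ 'n \<Rightarrow> real ^ 'n ^ 'n \<Rightarrow> real" and c :: "real \<Rightarrow> real ^ 'n ^ 'n"
  assumes "(t, c) \<in> paths (Per q) x y"
    and "continuous_on (tangent_bundle (Per q)) (\<lambda>(p, v). \<mu> p v)"
  shows "(\<lambda>s. \<mu> (c s) (vector_derivative c (at s within {0..t}))) integrable_on {0..t}"
proof -
  obtain n \<tau> where \<tau>: "\<tau> 0 = 0" "\<tau> n = t" "\<And>i. i < n \<Longrightarrow> \<tau> i < \<tau> (Suc i)"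
      "\<And>i. i < n \<Longrightarrow> smooth_map {\<tau> i..\<tau> (Suc i)} c"
    using assms unfolding paths_def piecewise_smooth_def by blast
  have c: "c ` {0..\<tau> n} \<subseteq> Per q" using assms \<tau> unfolding paths_def by blast
  show ?thesis
    using has_integral_integrable[OF path_pieces[OF \<tau>(1,3,4) c assms(2)]] unfolding \<tau>(2) .
qed

end

locale period_metric = period_domain q B
  for q :: "real ^ 'n \<Rightarrow> real" and B +
  fixes g :: "real ^ 'n ^ 'n \<Rightarrow> real ^ 'n ^ 'n \<Rightarrow> real ^ 'n ^ 'n \<Rightarrow> real"
  assumes riemannian: "riemannian_metric (Per q) g"
begin

definition len :: "real ^ 'n ^ 'n \<Rightarrow> real ^ 'n ^ 'n \<Rightarrow> real" where
  "len p v = sqrt (g p v v)"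

lemma continuous_on_len: "continuous_on (tangent_bundle (Per q)) (\<lambda>(p, v). len p v)"
proof -
  have g: "continuous_on {(x, v, w). x \<in> Per q \<and> v \<in> tangent_space (Per q) x \<and> w \<in> tangent_space (Per q) x}
       (\<lambda>(x, v, w). g x v w)"
    using riemannian smooth_map_imp_continuous_on unfolding riemannian_metric_def by blast
  have "continuous_on (tangent_bundle (Per q)) (\<lambda>(x, v). (x, v, v))"
    unfolding case_prod_unfold by (intro continuous_intros)
  from continuous_on_compose2[OF g this]
  have "continuous_on (tangent_bundle (Per q)) (\<lambda>(x, v). g x v v)"
    by (force simp: tangent_bundle_def case_prod_unfold)
  then show ?thesis unfolding len_def case_prod_unfold by (rule continuous_on_real_sqrt)
qed

lemma
  assumes "p \<in> Per q" "v \<in> tangent_space (Per q) p"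
  shows len_nonneg: "len p v \<ge> 0"
    and len_pos: "v \<noteq> 0 \<Longrightarrow> len p v > 0"
    and len_scale: "len p (a *\<^sub>R v) = \<bar>a\<bar> * len p v"
proof -
  let ?T = "tangent_space (Per q) p"
  have lin: "g p (a *\<^sub>R u + v) w = a * g p u w + g p v w" if "u \<in> ?T" "v \<in> ?T" "w \<in> ?T" for a u v w
    using riemannian assms(1) that unfolding riemannian_metric_def by blast
  have sym: "g p v w = g p w v" if "v \<in> ?T" "w \<in> ?T" for v w
    using riemannian assms(1) that unfolding riemannian_metric_def by blast
  have z: "0 \<in> ?T" using subspace_tangent_space[OF assms(1)] subspace_0 by blast
  have z0: "g p 0 w = 0" if "w \<in> ?T" for w using lin[OF z z that, of 1] by simp
  have sc: "g p (a *\<^sub>R u) w = a * g p u w" if "u \<in> ?T" "w \<in> ?T" for a u w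
    using lin[OF that(1) z that(2), of a] z0[OF that(2)] by simp
  have av: "a *\<^sub>R v \<in> ?T" using subspace_tangent_space[OF assms(1)] assms(2) subspace_scale by blast
  have "g p (a *\<^sub>R v) (a *\<^sub>R v) = a\<^sup>2 * g p v v"
    using sc[OF assms(2) av] sym[OF assms(2) av] sc[OF assms(2,2)] by (simp add: power2_eq_square)
  then show "len p (a *\<^sub>R v) = \<bar>a\<bar> * len p v" by (simp add: len_def real_sqrt_mult)
  have pos: "g p v v > 0" if "v \<noteq> 0"
    using riemannian assms that unfolding riemannian_metric_def by blast
  then show "v \<noteq> 0 \<Longrightarrow> len p v > 0" by (simp add: len_def)
  show "len p v \<ge> 0" using pos z0[OF z] by (cases "v = 0") (auto simp: len_def less_imp_le)
qed

text \<open>A chain of twistor arcs with an upper bound for its length. Each arc is the image of a line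
  segment in the space of frames.\<close>

inductive twistor_chain :: "real ^ 'n ^ 'n \<Rightarrow> real \<Rightarrow> real ^ 'n ^ 'n \<Rightarrow> bool" where
  nil: "p \<in> Per q \<Longrightarrow> twistor_chain p 0 p"
| step: "twistor_chain p l (plane z) \<Longrightarrow> pos3 q z w \<Longrightarrow> f = (a *\<^sub>R w, b *\<^sub>R w) \<Longrightarrow>
    (\<And>s. s \<in> {0..1} \<Longrightarrow> len (plane (z + s *\<^sub>R f)) (dplane (z + s *\<^sub>R f) f) \<le> m) \<Longrightarrow>
    twistor_chain p (l + m) (plane (z + f))"

lemma twistor_chain_trans:
  "twistor_chain p l r \<Longrightarrow> twistor_chain r m s \<Longrightarrow> twistor_chain p (l + m) s"
proof (rotate_tac, induction r m s rule: twistor_chain.induct)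
  case (step p' l' z w f a b m)
  show ?case
    using twistor_chain.step[OF step.IH[OF step.prems] step.hyps(2-4)] by (simp add: add.assoc)
qed simp

text \<open>An arc is appended to a path that ends at time \<open>t\<close> by letting it run over \<open>{t..t+1}\<close>. If the
  resulting path is differentiable at \<open>t\<close>, its velocity there is that of the earlier piece, which
  lies in the cone.\<close>

lemma twistor_chain_path:
  "twistor_chain x l y \<Longrightarrow> \<exists>c\<in>twistor_paths q x y. path_len len c \<le> l"
proof (induction x l y rule: twistor_chain.induct)
  case (nil p)
  let ?c = "\<lambda>_::real. p"
  have "smooth_map {0..1::real} ?c" unfolding smooth_map_def
  proof (intro ballI exI conjI allI)
    fix k show "Ck k UNIV ?c"
    proof (cases k)
      case (Suc m)
      have "Ck m UNIV (\<lambda>_::real. 0 :: real ^ 'n ^ 'n)"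
        by (induction m) auto
      then show ?thesis by (simp add: Suc)
    qed simp
  qed auto
  then have "piecewise_smooth 1 ?c" unfolding piecewise_smooth_def
    by (intro exI[of _ 1] exI[of _ real]) auto
  then have pth: "(1, ?c) \<in> paths (Per q) p p" using nil by (simp add: paths_def image_subset_iff)
  have d: "v = 0" if "s \<in> {0..1}" "(?c has_vector_derivative v) (at s within {0..1})" for s v
    by (rule trans[OF vector_derivative_within_closed_interval[OF zero_less_one that, symmetric]
        vector_derivative_within_closed_interval[OF zero_less_one that(1) has_vector_derivative_const]])
  have "(1, ?c) \<in> twistor_paths q p p"
    unfolding twistor_paths_def using pth d zero_in_twistor_cone[OF nil] by blast
  moreover have "path_len len (1, ?c) = 0"
  proof -
    have "vector_derivative ?c (at s within {0..1}) = 0" if "s \<in> {0..1}" for s :: real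
      using vector_derivative_within_closed_interval[OF _ that has_vector_derivative_const] by simp
    then have "path_len len (1, ?c) = integral {0..1} (\<lambda>s::real. len p 0)"
      unfolding path_len_def prod.case by (intro integral_cong) simp
    also have "len p 0 = 0"
      using len_scale[OF nil, of 0 0] subspace_0[OF subspace_tangent_space[OF nil]] by simp
    finally show ?thesis by simp
  qed
  ultimately show ?case by force
next
  case (step x l z w f a b m)
  then obtain t c where tc: "(t, c) \<in> twistor_paths q x (plane z)" "path_len len (t, c) \<le> l" by auto
  then have pth: "(t, c) \<in> paths (Per q) x (plane z)"
    and cone: "\<And>s v. s \<in> {0..t} \<Longrightarrow> (c has_vector_derivative v) (at s within {0..t}) \<Longrightarrow> v \<in> twistor_cone q (c s)"
    unfolding twistor_paths_def by auto
  then have t: "t > 0" and cP: "c ` {0..t} \<subseteq> Per q" and c0: "c 0 = x" "c t = plane z"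
    unfolding paths_def by auto
  let ?z = "\<lambda>s. (z - t *\<^sub>R f) + s *\<^sub>R f"
  let ?e = "\<lambda>s. plane (?z s)"
  define c' where "c' s = (if s \<le> t then c s else ?e s)" for s
  have z: "?z s = z + (s - t) *\<^sub>R f" for s by (simp add: algebra_simps)
  have p3: "pos3 q (?z s) w" for s
    using pos3_move[OF step.hyps(2), of "(s - t) * a" "(s - t) * b"] 
    unfolding z by (simp add: step.hyps(3))
  have nz: "wedge (fst (?z s)) (snd (?z s)) \<noteq> 0" for s using pos3_wedge_neq_0[OF p3] .
  have e_smooth: "smooth_map {t..t + 1} ?e" by (rule smooth_map_plane_line[OF nz])
  have e_der: "(?e has_vector_derivative dplane (?z s) f) (at s within S)" for s S
    by (rule has_vector_derivative_plane_line[OF nz])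
  have e_cone: "dplane (?z s) f \<in> twistor_cone q (?e s)" for s
    using dplane_in_twistor_cone[OF p3[of s], of a b] step.hyps(3) by simp
  have et: "?e t = c t" using c0 by simp
  have c1: "c' s = c s" if "s \<in> {0..t}" for s using that by (simp add: c'_def)
  have c2: "c' s = ?e s" if "s \<in> {t..t+1}" for s using that et by (auto simp: c'_def)
  obtain n \<tau> where \<tau>: "\<tau> 0 = 0" "\<tau> n = t" "\<And>i. i < n \<Longrightarrow> \<tau> i < \<tau> (Suc i)"
      "\<And>i. i < n \<Longrightarrow> smooth_map {\<tau> i..\<tau> (Suc i)} c"
    using pth unfolding paths_def piecewise_smooth_def by blast
  let ?\<tau> = "\<tau>(Suc n := t + 1)"
  have "smooth_map {?\<tau> i..?\<tau> (Suc i)} c'" "?\<tau> i < ?\<tau> (Suc i)" if i: "i < Suc n" for i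
  proof -
    show "?\<tau> i < ?\<tau> (Suc i)" using i \<tau>(2) \<tau>(3)[of i] by (auto simp: less_Suc_eq)
    show "smooth_map {?\<tau> i..?\<tau> (Suc i)} c'"
    proof (cases "i = n")
      case True
      then show ?thesis using smooth_map_cong[OF e_smooth c2[symmetric]] \<tau>(2) by simp
    next
      case False
      then have i: "i < n" using i by simp
      have "{\<tau> i..\<tau> (Suc i)} \<subseteq> {0..t}"
        using partition_le[of n \<tau> 0 i] partition_le[of n \<tau> "Suc i" n] \<tau> i by auto
      then show ?thesis using smooth_map_cong[OF \<tau>(4)[OF i], of c'] c1 i by auto
    qed
  qed
  then have ps: "piecewise_smooth (t + 1) c'"
    unfolding piecewise_smooth_def using \<tau>(1) by (intro exI[of _ "Suc n"] exI[of _ ?\<tau>]) auto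
  have c'P: "c' ` {0..t + 1} \<subseteq> Per q"
    using cP pos3_imp_pos2[OF p3] unfolding c'_def Per_eq by auto
  have pth': "(t + 1, c') \<in> paths (Per q) x (plane (z + f))"
    unfolding paths_def using ps c'P t c0 c1[of 0] c2[of "t + 1"] by (simp add: algebra_simps)
  have cone': "v \<in> twistor_cone q (c' s)"
    if s: "s \<in> {0..t+1}" and v: "(c' has_vector_derivative v) (at s within {0..t+1})" for s v
  proof (cases "s \<le> t")
    case True
    have "(c' has_vector_derivative v) (at s within {0..t})"
      using v by (rule has_vector_derivative_within_subset) auto
    then have "(c has_vector_derivative v) (at s within {0..t})"
      by (rule has_vector_derivative_transform[rotated 2]) (use True s c1 in auto)
    then show ?thesis using cone[of s] True s c1 by auto
  next
    case False
    have "(c' has_vector_derivative v) (at s within {t..t+1})"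
      using v by (rule has_vector_derivative_within_subset) (use t in auto)
    then have "(?e has_vector_derivative v) (at s within {t..t+1})"
      by (rule has_vector_derivative_transform[rotated 2]) (use False s c2 in auto)
    then have "v = dplane (?z s) f"
      using vector_derivative_within_closed_interval[of t "t+1" s ?e v]
        vector_derivative_within_closed_interval[of t "t+1" s ?e, OF _ _ e_der] False s by auto
    then show ?thesis using e_cone[of s] c2[of s] False s by auto
  qed
  have tw: "(t + 1, c') \<in> twistor_paths q x (plane (z + f))"
    unfolding twistor_paths_def using pth' cone' by blast
  let ?I = "\<lambda>s. len (c' s) (vector_derivative c' (at s within {0..t+1}))"
  have int: "?I integrable_on {0..t+1}" by (rule path_integrable[OF pth' continuous_on_len])
  have split: "path_len len (t + 1, c') = integral {0..t} ?I + integral {t..t+1} ?I"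
    unfolding path_len_def using Henstock_Kurzweil_Integration.integral_combine[OF _ _ int, of t] t by simp
  have "integral {0..t} ?I = path_len len (t, c)"
    unfolding path_len_def prod.case
  proof (rule integral_spike[of "{0, t}"])
    fix s assume s: "s \<in> {0..t} - {0, t}"
    have "at s within {0..t+1} = at s" "at s within {0..t} = at s"
      using s by (auto intro!: at_within_Icc_at)
    moreover have "vector_derivative c' (at s) = vector_derivative c (at s)"
    proof (rule vector_derivative_cong_eq)
      show "\<forall>\<^sub>F x in nhds s. x \<in> UNIV \<longrightarrow> c' x = c x"
        using s c1 by (auto simp: eventually_nhds intro!: exI[of _ "{0<..<t}"])
    qed auto
    ultimately show "len (c s) (vector_derivative c (at s within {0..t})) = ?I s" using s c1 by simp
  qed simp
  moreover have "integral {t..t+1} ?I \<le> m"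
  proof -
    have le: "?I s \<le> m" if s: "s \<in> {t..t+1} - {t, t+1}" for s
    proof -
      have "at s within {0..t+1} = at s"
        using s t by (auto intro!: at_within_Icc_at)
      moreover have "vector_derivative c' (at s) = dplane (?z s) f"
      proof -
        have "vector_derivative c' (at s) = vector_derivative ?e (at s)"
        proof (rule vector_derivative_cong_eq)
          show "\<forall>\<^sub>F x in nhds s. x \<in> UNIV \<longrightarrow> c' x = ?e x"
            using s c2 by (auto simp: eventually_nhds intro!: exI[of _ "{t<..<t+1}"])
        qed auto
        then show ?thesis using vector_derivative_at[OF e_der] by simp
      qed
      moreover have "c' s = ?e s" using s c2 by auto
      ultimately have "?I s = len (plane (z + (s - t) *\<^sub>R f)) (dplane (z + (s - t) *\<^sub>R f) f)"
        by (simp add: z)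
      then show ?thesis using step.hyps(4)[of "s - t"] s by auto
    qed
    have i: "?I integrable_on {t..t+1}"
      using int by (rule integrable_on_subinterval) (use t in auto)
    let ?J = "\<lambda>s. if s \<in> {t, t+1} then m else ?I s"
    have "(?J has_integral integral {t..t+1} ?I) {t..t+1}"
      by (rule has_integral_spike_finite[OF _ _ integrable_integral[OF i], of "{t, t+1}"]) auto
    moreover have "((\<lambda>s. m) has_integral m) {t..t+1}"
      using has_integral_const_real[of m t "t+1"] by simp
    ultimately show ?thesis
      by (rule has_integral_le) (use le in auto)
  qed
  ultimately have "path_len len (t + 1, c') \<le> l + m" using split tc(2) by simp
  then show ?case using tw by blast
qed

end

section \<open>Local moves between frames\<close>

context period_domain
begin

text \<open>The direction \<open>f\<close> is a turn towards a vector \<open>w\<close> that is admissible for all frames of \<open>U\<close>, so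
  straight moves in the direction \<open>f\<close> inside \<open>U\<close> are twistor arcs.\<close>

definition turns_on :: "((real ^ 'n) \<times> (real ^ 'n)) set \<Rightarrow> (real ^ 'n) \<times> (real ^ 'n) \<Rightarrow> bool" where
  "turns_on U f \<longleftrightarrow> (\<exists>a b w. f = (a *\<^sub>R w, b *\<^sub>R w) \<and> (\<forall>z\<in>U. pos3 q z w))"

lemma turns_on_subset: "turns_on U f \<Longrightarrow> V \<subseteq> U \<Longrightarrow> turns_on V f"
  unfolding turns_on_def by blast

lemma turns_on_scale: "turns_on U f \<Longrightarrow> turns_on U (r *\<^sub>R f)"
proof -
  assume "turns_on U f"
  then obtain a b w where "f = (a *\<^sub>R w, b *\<^sub>R w)" "\<forall>z\<in>U. pos3 q z w"
    unfolding turns_on_def by blast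
  then show ?thesis unfolding turns_on_def
    by (intro exI[of _ "r * a"] exI[of _ "r * b"] exI[of _ w]) simp
qed

lemma turns_on_in_cone: "turns_on U f \<Longrightarrow> z \<in> U \<Longrightarrow> dplane z f \<in> twistor_cone q (plane z)"
  unfolding turns_on_def using dplane_in_twistor_cone by blast

lemma pos3_ball:
  assumes "pos3 q z w"
  obtains R where "R > 0" "\<And>z' w'. dist z' z < R \<Longrightarrow> dist w' w < R \<Longrightarrow> pos3 q z' w'"
proof -
  obtain e where e: "e > 0" "ball (z, w) e \<subseteq> {(z, w). pos3 q z w}"
    using open_pos3 assms open_contains_ball by blast
  show ?thesis
  proof (rule that[of "e / 2"])
    fix z' w' assume "dist z' z < e / 2" "dist w' w < e / 2"
    then have "dist (z, w) (z', w') < e"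
      using dist_triangle[of "(z, w)" "(z', w')" "(z', w)"]
      by (simp add: dist_Pair_Pair dist_commute)
    then show "pos3 q z' w'" using e(2) by auto
  qed (use e in simp)
qed

text \<open>The admissible \<open>w\<close> contain a ball around some \<open>w\<^sub>0\<close>, and a small multiple of a basis vector is the difference
  of two vectors of that ball. So near \<open>z\<^sub>0\<close> finitely many admissible turns generate all
  directions, with control of the total size.\<close>

lemma turn_decomposition:
  assumes "pos2 q z0"
  obtains R C where "R > 0" "C > 0"
    "\<And>f. \<exists>fs. sum_list fs = f \<and> (\<Sum>h\<leftarrow>fs. norm h) \<le> C * norm f \<and> (\<forall>h\<in>set fs. turns_on (ball z0 R) h)"
proof -
  obtain w0 where w0: "pos3 q z0 w0" using pos3I[OF assms] pos2_extend[of z0] by metis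
  obtain R where R: "R > 0" "\<And>z' w'. dist z' z0 < R \<Longrightarrow> dist w' w0 < R \<Longrightarrow> pos3 q z' w'"
    using pos3_ball[OF w0] by blast
  define s where "s = R / 2"
  have s: "s > 0" using R(1) by (simp add: s_def)
  define Dec where "Dec f c \<longleftrightarrow> (\<exists>fs. sum_list fs = f \<and> (\<Sum>h\<leftarrow>fs. norm h) \<le> c \<and>
      (\<forall>h\<in>set fs. turns_on (ball z0 R) h))" for f and c :: real
  have Dec_add: "Dec (f + f') (c + c')" if d: "Dec f c" "Dec f' c'" for f f' c c'
  proof -
    obtain fs where "sum_list fs = f" "(\<Sum>h\<leftarrow>fs. norm h) \<le> c" "\<forall>h\<in>set fs. turns_on (ball z0 R) h"
      using d(1) unfolding Dec_def by blast
    moreover obtain fs' where "sum_list fs' = f'" "(\<Sum>h\<leftarrow>fs'. norm h) \<le> c'" "\<forall>h\<in>set fs'. turns_on (ball z0 R) h"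
      using d(2) unfolding Dec_def by blast
    ultimately show ?thesis unfolding Dec_def by (intro exI[of _ "fs @ fs'"]) auto
  qed
  have Dec_sum: "Dec (sum f I) (sum c I)" if "finite I" "\<And>i. i \<in> I \<Longrightarrow> Dec (f i) (c i)"
    for f c and I :: "(real ^ 'n) set"
    using that
  proof (induction I rule: finite_induct)
    case empty
    show ?case unfolding Dec_def by (intro exI[of _ "[]"]) simp
  next
    case (insert i I)
    then show ?case using Dec_add by simp
  qed
  have Dec_turn: "Dec (a *\<^sub>R w, b *\<^sub>R w) (norm (a *\<^sub>R w, b *\<^sub>R w))" if "dist w w0 < R" for a b w
  proof -
    have "turns_on (ball z0 R) (a *\<^sub>R w, b *\<^sub>R w)"
      unfolding turns_on_def using R(2) that by (metis dist_commute mem_ball)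
    then show ?thesis unfolding Dec_def by (intro exI[of _ "[(a *\<^sub>R w, b *\<^sub>R w)]"]) simp
  qed
  define D where "D = (2 * norm w0 + s) / s"
  have D: "D > 0" using s by (simp add: D_def add_nonneg_pos)
  have Dec_mono: "Dec f c'" if "Dec f c" "c \<le> c'" for f c c'
    using that unfolding Dec_def by force
  \<comment> \<open>a basis vector is a multiple of the difference of two admissible directions\<close>
  have Dec_basis: "Dec (a *\<^sub>R i, b *\<^sub>R i) (norm (a, b) * D)" if i: "i \<in> Basis" for a b and i :: "real ^ 'n"
  proof -
    let ?w = "w0 + s *\<^sub>R i"
    have "dist ?w w0 < R" using i R(1) by (simp add: dist_norm s_def)
    from Dec_add[OF Dec_turn[OF this, of "a / s" "b / s"] Dec_turn[of w0 "- a / s" "- b / s"]]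
    have X: "Dec ((a / s) *\<^sub>R ?w + (- a / s) *\<^sub>R w0, (b / s) *\<^sub>R ?w + (- b / s) *\<^sub>R w0)
        (norm ((a / s) *\<^sub>R ?w, (b / s) *\<^sub>R ?w) + norm ((- a / s) *\<^sub>R w0, (- b / s) *\<^sub>R w0))"
      using R(1) by simp
    have e: "(k / s) *\<^sub>R ?w + (- k / s) *\<^sub>R w0 = k *\<^sub>R i" for k
      using s by (simp add: algebra_simps)
    have n: "norm ((c / s) *\<^sub>R w, (d / s) *\<^sub>R w) = norm (c, d) * norm w / s"
      for c d and w :: "real ^ 'n"
    proof -
      have "norm ((c / s) *\<^sub>R w, (d / s) *\<^sub>R w) = sqrt ((c\<^sup>2 + d\<^sup>2) * (norm w / s)\<^sup>2)"
        by (simp add: norm_Pair power_mult_distrib power_divide algebra_simps add_divide_distrib)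
      also have "\<dots> = norm (c, d) * (norm w / s)"
        using s by (simp add: real_sqrt_mult norm_Pair)
      finally show ?thesis by simp
    qed
    have "Dec (a *\<^sub>R i, b *\<^sub>R i) (norm (a, b) * norm ?w / s + norm (- a, - b) * norm w0 / s)"
      using X unfolding e n .
    moreover have "norm (- a, - b) = norm (a, b)" by (simp add: norm_Pair)
    moreover have "norm ?w \<le> norm w0 + s" using norm_triangle_ineq[of w0 "s *\<^sub>R i"] i s by simp
    then have "(norm ?w + norm w0) / s \<le> D"
      unfolding D_def using s by (intro divide_right_mono) auto
    then have "norm (a, b) * ((norm ?w + norm w0) / s) \<le> norm (a, b) * D"
      by (intro mult_left_mono) auto
    then have "norm (a, b) * norm ?w / s + norm (a, b) * norm w0 / s \<le> norm (a, b) * D"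
      by (simp add: add_divide_distrib distrib_left)
    ultimately show ?thesis using Dec_mono by simp
  qed
  let ?N = "real (card (Basis :: (real ^ 'n) set))"
  have "Dec f (?N * D * norm f)" for f
  proof -
    have "f = (\<Sum>i\<in>Basis. ((fst f \<bullet> i) *\<^sub>R i, (snd f \<bullet> i) *\<^sub>R i))"
      by (simp add: prod_eq_iff fst_sum snd_sum euclidean_representation)
    moreover have "Dec (\<Sum>i\<in>Basis. ((fst f \<bullet> i) *\<^sub>R i, (snd f \<bullet> i) *\<^sub>R i))
        (\<Sum>i\<in>(Basis :: (real ^ 'n) set). norm f * D)"
    proof (rule Dec_sum)
      fix i :: "real ^ 'n" assume i: "i \<in> Basis"
      have "norm (fst f \<bullet> i, snd f \<bullet> i) \<le> norm f"
        unfolding norm_Pair norm_prod_def[of f]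
        using Basis_le_norm[OF i, of "fst f"] Basis_le_norm[OF i, of "snd f"]
        by (intro real_sqrt_le_mono add_mono power_mono) (auto simp: prod.case_eq_if)
      then show "Dec ((fst f \<bullet> i) *\<^sub>R i, (snd f \<bullet> i) *\<^sub>R i) (norm f * D)"
        using Dec_mono[OF Dec_basis[OF i]] D by (simp add: mult_right_mono)
    qed simp
    ultimately show ?thesis by (simp add: mult_ac)
  qed
  moreover have "?N * D > 0" using D by (simp add: card_gt_0_iff)
  ultimately show ?thesis using that[OF R(1), of "?N * D"] unfolding Dec_def by blast
qed

end

context period_metric
begin

text \<open>The metric pulled back to the space of frames, an open subset of a vector space, where base
  points may be varied freely.\<close>

definition lift_len :: "(real ^ 'n) \<times> (real ^ 'n) \<Rightarrow> (real ^ 'n) \<times> (real ^ 'n) \<Rightarrow> real" where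
  "lift_len z f = len (plane z) (dplane z f)"

lemma plane_in_Per: "pos2 q z \<Longrightarrow> plane z \<in> Per q"
  using Per_eq by blast

lemma lift_len_scale: "pos2 q z \<Longrightarrow> lift_len z (a *\<^sub>R f) = \<bar>a\<bar> * lift_len z f"
  unfolding lift_len_def
  by (simp add: linear_cmul[OF linear_dplane] len_scale plane_in_Per dplane_in_tangent_space)

lemma continuous_on_lift_len: "continuous_on {(z, f). pos2 q z} (\<lambda>(z, f). lift_len z f)"
proof -
  let ?S = "{(z, f). pos2 q z} :: (((real ^ 'n) \<times> (real ^ 'n)) \<times> ((real ^ 'n) \<times> (real ^ 'n))) set"
  have "continuous_on ?S (\<lambda>p. plane (fst p))"
    by (rule continuous_on_compose2[OF continuous_on_plane])
      (use pos2_wedge_neq_0 in \<open>auto intro!: continuous_intros\<close>)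
  moreover have "continuous_on ?S (\<lambda>(z, f). dplane z f)"
    by (rule continuous_on_subset[OF continuous_on_dplane]) (use pos2_wedge_neq_0 in auto)
  ultimately have "continuous_on ?S (\<lambda>p. (plane (fst p), dplane (fst p) (snd p)))"
    by (intro continuous_on_Pair) (simp_all add: case_prod_unfold)
  moreover have "(\<lambda>p. (plane (fst p), dplane (fst p) (snd p))) ` ?S \<subseteq> tangent_bundle (Per q)"
    using plane_in_Per dplane_in_tangent_space unfolding tangent_bundle_def by auto
  ultimately have "continuous_on ?S (\<lambda>p. (\<lambda>(p, v). len p v) (plane (fst p), dplane (fst p) (snd p)))"
    by (rule continuous_on_compose2[OF continuous_on_len])
  then show ?thesis by (simp add: lift_len_def case_prod_unfold)
qed

lemma isCont_lift_len:
  assumes "pos2 q z"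
  shows "isCont (\<lambda>(z, f). lift_len z f) (z, f)"
proof -
  have "open {(z :: (real ^ 'n) \<times> (real ^ 'n), f :: (real ^ 'n) \<times> (real ^ 'n)). pos2 q z}"
  proof -
    have "{(z :: (real ^ 'n) \<times> (real ^ 'n), f :: (real ^ 'n) \<times> (real ^ 'n)). pos2 q z} = {z. pos2 q z} \<times> UNIV"
      by auto
    then show ?thesis using open_Times[OF open_pos2 open_UNIV] by simp
  qed
  then show ?thesis using continuous_on_lift_len assms continuous_on_eq_continuous_at by fastforce
qed

text \<open>Continuity at \<open>(z\<^sub>0, 0)\<close> bounds the length on a small ball, and homogeneity does the rest.\<close>

lemma lift_len_bound:
  assumes "pos2 q z0"
  obtains R K where "R > 0" "K > 0" "\<And>z. z \<in> ball z0 R \<Longrightarrow> pos2 q z"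
    "\<And>z f. z \<in> ball z0 R \<Longrightarrow> lift_len z f \<le> K * norm f"
proof -
  obtain R0 where R0: "R0 > 0" "ball z0 R0 \<subseteq> {z. pos2 q z}"
    using openE[OF open_pos2, of z0] assms by (metis mem_Collect_eq)
  have "lift_len z0 0 = 0" using lift_len_scale[OF assms, of 0 0] by simp
  moreover obtain d where d: "d > 0"
    "\<forall>p. dist p (z0, 0) < d \<longrightarrow> dist ((\<lambda>(z, f). lift_len z f) p) ((\<lambda>(z, f). lift_len z f) (z0, 0)) < 1"
    using isCont_lift_len[OF assms, of 0] zero_less_one unfolding continuous_at_eps_delta by blast
  ultimately have d2: "lift_len z f < 1" if "dist (z, f) (z0, 0) < d" for z f
    using spec[OF d(2), of "(z, f)"] that by (simp add: dist_real_def)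
  show ?thesis
  proof (rule that[of "min R0 (d / 2)" "4 / d"])
    fix z f assume z: "z \<in> ball z0 (min R0 (d / 2))"
    show p: "pos2 q z" using R0 z by auto
    show "lift_len z f \<le> 4 / d * norm f"
    proof (cases "f = 0")
      case True
      then show ?thesis using lift_len_scale[OF p, of 0 0] by simp
    next
      case False
      define k where "k = d / 4 / norm f"
      have k: "k > 0" using False d by (simp add: k_def)
      have "dist (z, k *\<^sub>R f) (z0, 0) \<le> dist z z0 + norm (k *\<^sub>R f)"
        using dist_triangle[of "(z, k *\<^sub>R f)" "(z0, 0)" "(z0, k *\<^sub>R f)"]
        by (simp add: dist_Pair_Pair)
      also have "norm (k *\<^sub>R f) = d / 4" using False d by (simp add: k_def)
      also have "dist z z0 + d / 4 < d" using z d by (simp add: dist_commute)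
      finally have "k * lift_len z f < 1"
        using d2[of z "k *\<^sub>R f"] lift_len_scale[OF p, of k f] k by simp
      then have "lift_len z f < 1 / k" using k by (simp add: field_simps)
      then show ?thesis by (simp add: k_def)
    qed
  qed (use R0 d in auto)
qed

text \<open>The moves are made one after the other along straight lines; the bound on the total size
  keeps all of them inside the ball on which the turns are admissible.\<close>

lemma twistor_chain_moves:
  assumes "\<And>z. z \<in> ball z0 R \<Longrightarrow> pos2 q z"
    and "\<And>f. f \<in> set fs \<Longrightarrow> turns_on (ball z0 R) f"
    and "\<And>f z. f \<in> set fs \<Longrightarrow> z \<in> ball z0 R \<Longrightarrow> lift_len z f \<le> M f"
    and "dist z z0 + (\<Sum>f\<leftarrow>fs. norm f) < R"
  shows "twistor_chain (plane z) (\<Sum>f\<leftarrow>fs. M f) (plane (z + sum_list fs))"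
  using assms(2-4)
proof (induction fs arbitrary: z)
  case Nil
  then show ?case using nil[OF plane_in_Per[OF assms(1)], of z] by (simp add: dist_commute)
next
  case (Cons f fs)
  have n: "0 \<le> (\<Sum>f\<leftarrow>fs. norm f)" by (intro sum_list_nonneg) auto
  have inball: "z + s *\<^sub>R f \<in> ball z0 R" if "s \<in> {0..1}" for s :: real
  proof -
    have "dist (z + s *\<^sub>R f) z0 \<le> dist z z0 + norm (s *\<^sub>R f)"
      using dist_triangle[of "z + s *\<^sub>R f" z0 z] by (simp add: dist_norm)
    also have "norm (s *\<^sub>R f) \<le> norm f" using that by (simp add: mult_left_le_one_le)
    finally show ?thesis using Cons.prems(3) n by (simp add: dist_commute)
  qed
  obtain a b w where f: "f = (a *\<^sub>R w, b *\<^sub>R w)" "\<forall>z\<in>ball z0 R. pos3 q z w"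
    using Cons.prems(1)[of f] unfolding turns_on_def by auto
  have z: "z \<in> ball z0 R" using inball[of 0] by simp
  have "twistor_chain (plane z) (0 + M f) (plane (z + f))"
  proof (rule step[OF nil[OF plane_in_Per[OF assms(1)[OF z]]] _ f(1)])
    show "pos3 q z w" using f z by blast
    show "len (plane (z + s *\<^sub>R f)) (dplane (z + s *\<^sub>R f) f) \<le> M f" if "s \<in> {0..1}" for s
      using Cons.prems(2)[OF _ inball[OF that], of f] by (simp add: lift_len_def)
  qed
  moreover have "twistor_chain (plane (z + f)) (\<Sum>f\<leftarrow>fs. M f) (plane (z + f + sum_list fs))"
  proof (rule Cons.IH)
    show "dist (z + f) z0 + (\<Sum>f\<leftarrow>fs. norm f) < R"
      using Cons.prems(3) dist_triangle[of "z + f" z0 z] by (simp add: dist_norm)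
  qed (use Cons.prems in auto)
  ultimately show ?case
    using twistor_chain_trans[of "plane z" "0 + M f" "plane (z + f)"] by (simp add: add.assoc)
qed

lemma twistor_chain_lipschitz:
  assumes "pos2 q z0"
  obtains r L where "r > 0" "L > 0"
    "\<And>z z'. z \<in> ball z0 r \<Longrightarrow> z' \<in> ball z0 r \<Longrightarrow>
       \<exists>l\<le>L * norm (z' - z). twistor_chain (plane z) l (plane z')"
proof -
  obtain R1 C where C: "R1 > 0" "C > 0"
    "\<And>f. \<exists>fs. sum_list fs = f \<and> (\<Sum>h\<leftarrow>fs. norm h) \<le> C * norm f \<and> (\<forall>h\<in>set fs. turns_on (ball z0 R1) h)"
    using turn_decomposition[OF assms] by blast
  obtain R2 K where K: "R2 > 0" "K > 0" "\<And>z. z \<in> ball z0 R2 \<Longrightarrow> pos2 q z"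
    "\<And>z f. z \<in> ball z0 R2 \<Longrightarrow> lift_len z f \<le> K * norm f"
    using lift_len_bound[OF assms] by blast
  define R where "R = min R1 R2"
  define r where "r = R / (1 + 2 * C)"
  have R: "R > 0" "R \<le> R1" "R \<le> R2" using C K by (auto simp: R_def)
  have r: "r > 0" "r + C * (2 * r) = R"
  proof -
    have "1 + 2 * C > 0" using C by simp
    then have "r > 0" "r * (1 + 2 * C) = R" using R by (simp_all add: r_def)
    then show "r > 0" "r + C * (2 * r) = R" by (simp_all add: algebra_simps)
  qed
  show ?thesis
  proof (rule that[of r "K * C"])
    fix z z' assume z: "z \<in> ball z0 r" "z' \<in> ball z0 r"
    obtain fs where fs: "sum_list fs = z' - z" "(\<Sum>h\<leftarrow>fs. norm h) \<le> C * norm (z' - z)"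
      "\<forall>h\<in>set fs. turns_on (ball z0 R1) h" using C(3) by blast
    have "norm (z' - z) \<le> dist z' z0 + dist z0 z"
      using dist_triangle[of z' z z0] by (simp add: dist_norm)
    also have "\<dots> \<le> 2 * r" using z by (simp add: dist_commute)
    finally have "C * norm (z' - z) \<le> C * (2 * r)" using C(2) by simp
    moreover have "dist z z0 < r" using z(1) by (simp add: dist_commute)
    ultimately have *: "dist z z0 + (\<Sum>f\<leftarrow>fs. norm f) < R"
      using fs(2) r(2) by linarith
    have "twistor_chain (plane z) (\<Sum>f\<leftarrow>fs. K * norm f) (plane (z + sum_list fs))"
    proof (rule twistor_chain_moves[where R = R])
      show "turns_on (ball z0 R) f" if "f \<in> set fs" for f
        using turns_on_subset[of "ball z0 R1" f] fs(3) that R by (simp add: subset_ball)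
    qed (use K(3,4) R * in auto)
    moreover have "(\<Sum>f\<leftarrow>fs. K * norm f) \<le> K * C * norm (z' - z)"
      using fs(2) K(2) by (simp add: sum_list_const_mult mult.assoc)
    ultimately show "\<exists>l\<le>K * C * norm (z' - z). twistor_chain (plane z) l (plane z')"
      using fs(1) by auto
  qed (use r C K in auto)
qed

end

section \<open>The norm generated by the sub-twistor cone\<close>

lemma sum_list_in_subspace: "subspace S \<Longrightarrow> set L \<subseteq> S \<Longrightarrow> sum_list L \<in> S"
  by (induction L) (auto simp: subspace_0 subspace_add)

lemma linear_sum_list: "linear f \<Longrightarrow> f (sum_list L) = sum_list (map f L)"
  by (induction L) (auto simp: linear_0 linear_add)

context period_metric
begin

definition cone_norm :: "real ^ 'n ^ 'n \<Rightarrow> real ^ 'n ^ 'n \<Rightarrow> real" where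
  "cone_norm p \<xi> = Inf {\<Sum>\<eta>\<leftarrow>L. len p \<eta> | L. set L \<subseteq> twistor_cone q p \<and> sum_list L = \<xi>}"

lemma len_nonneg_cone:
  assumes "p \<in> Per q" "set L \<subseteq> twistor_cone q p"
  shows "0 \<le> (\<Sum>\<eta>\<leftarrow>L. len p \<eta>)"
  using assms twistor_cone_subset_tangent_space[OF assms(1)]
  by (intro sum_list_nonneg) (auto intro: len_nonneg)

lemma cone_norm_le:
  assumes "p \<in> Per q" "set L \<subseteq> twistor_cone q p" "sum_list L = \<xi>"
  shows "cone_norm p \<xi> \<le> (\<Sum>\<eta>\<leftarrow>L. len p \<eta>)"
  unfolding cone_norm_def
proof (rule cInf_lower)
  show "bdd_below {\<Sum>\<eta>\<leftarrow>L. len p \<eta> | L. set L \<subseteq> twistor_cone q p \<and> sum_list L = \<xi>}"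
    by (rule bdd_belowI[of _ 0]) (use len_nonneg_cone[OF assms(1)] in auto)
qed (use assms in auto)

lemma tangent_lift:
  assumes "p \<in> Per q" "\<xi> \<in> tangent_space (Per q) p"
  obtains z f where "p = plane z" "pos2 q z" "\<xi> = dplane z f"
proof -
  obtain \<alpha> \<beta> where ab: "\<alpha> \<bullet> (p *v \<beta>) > 0" using exists_frame[OF assms(1)] .
  show ?thesis
    using that[OF frame_section(1)[OF assms(1) ab, symmetric] frame_section(2)[OF assms(1) ab]]
      tangent_space_frame[OF assms(1) ab] assms(2) by blast
qed

lemma cone_decomposition:
  assumes "p \<in> Per q" "\<xi> \<in> tangent_space (Per q) p"
  obtains L where "set L \<subseteq> twistor_cone q p" "sum_list L = \<xi>"
proof -
  obtain z f where z: "p = plane z" "pos2 q z" "\<xi> = dplane z f" using tangent_lift[OF assms] .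
  obtain R C where "R > 0" "C > 0" and
    *: "\<And>f. \<exists>fs. sum_list fs = f \<and> (\<Sum>h\<leftarrow>fs. norm h) \<le> C * norm f \<and> (\<forall>h\<in>set fs. turns_on (ball z R) h)"
    using turn_decomposition[OF z(2)] by blast
  obtain fs where fs: "sum_list fs = f" "\<forall>h\<in>set fs. turns_on (ball z R) h" using *[of f] by blast
  show ?thesis
  proof (rule that[of "map (dplane z) fs"])
    show "set (map (dplane z) fs) \<subseteq> twistor_cone q p"
      using turns_on_in_cone[of "ball z R" _ z] fs(2) z(1) \<open>R > 0\<close> by auto
    show "sum_list (map (dplane z) fs) = \<xi>"
      using linear_sum_list[OF linear_dplane] fs(1) z(3) by metis
  qed
qed

lemma cone_norm_approx:
  assumes "p \<in> Per q" "\<xi> \<in> tangent_space (Per q) p" "\<epsilon> > 0"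
  obtains L where "set L \<subseteq> twistor_cone q p" "sum_list L = \<xi>" "(\<Sum>\<eta>\<leftarrow>L. len p \<eta>) < cone_norm p \<xi> + \<epsilon>"
proof -
  let ?X = "{\<Sum>\<eta>\<leftarrow>L. len p \<eta> | L. set L \<subseteq> twistor_cone q p \<and> sum_list L = \<xi>}"
  obtain L0 where "set L0 \<subseteq> twistor_cone q p" "sum_list L0 = \<xi>"
    using cone_decomposition[OF assms(1,2)] .
  then have ne: "?X \<noteq> {}" by auto
  have "Inf ?X < cone_norm p \<xi> + \<epsilon>" using assms(3) by (simp add: cone_norm_def)
  from cInf_lessD[OF ne this] obtain x where "x \<in> ?X" "x < cone_norm p \<xi> + \<epsilon>" by blast
  then show ?thesis using that by blast
qed

lemma cone_norm_nonneg:
  assumes "p \<in> Per q" "\<xi> \<in> tangent_space (Per q) p"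
  shows "cone_norm p \<xi> \<ge> 0"
  unfolding cone_norm_def
proof (rule cInf_greatest)
  show "{\<Sum>\<eta>\<leftarrow>L. len p \<eta> | L. set L \<subseteq> twistor_cone q p \<and> sum_list L = \<xi>} \<noteq> {}"
  proof -
    obtain L0 where "set L0 \<subseteq> twistor_cone q p" "sum_list L0 = \<xi>"
      using cone_decomposition[OF assms] .
    then show ?thesis by auto
  qed
qed (use len_nonneg_cone[OF assms(1)] in auto)

lemma cone_norm_le_len:
  assumes "p \<in> Per q" "\<eta> \<in> twistor_cone q p"
  shows "cone_norm p \<eta> \<le> len p \<eta>"
  using cone_norm_le[OF assms(1), of "[\<eta>]"] assms(2) by simp

text \<open>Scaling the summands of a decomposition gives one inequality; the reverse one follows by scaling back.\<close>

lemma cone_norm_scale_le: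
  assumes "p \<in> Per q" "\<xi> \<in> tangent_space (Per q) p"
  shows "cone_norm p (a *\<^sub>R \<xi>) \<le> \<bar>a\<bar> * cone_norm p \<xi>"
proof (rule field_le_epsilon)
  fix e :: real assume e: "e > 0"
  then have "e / (\<bar>a\<bar> + 1) > 0" by simp
  from cone_norm_approx[OF assms this] obtain L where L: "set L \<subseteq> twistor_cone q p" "sum_list L = \<xi>"
    "(\<Sum>\<eta>\<leftarrow>L. len p \<eta>) < cone_norm p \<xi> + e / (\<bar>a\<bar> + 1)" .
  have "set (map ((*\<^sub>R) a) L) \<subseteq> twistor_cone q p"
    using L(1) scale_in_twistor_cone[OF assms(1)] by auto
  moreover have "sum_list (map ((*\<^sub>R) a) L) = a *\<^sub>R \<xi>"
    using linear_sum_list[OF linear_scaleR] L(2) by metis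
  ultimately have "cone_norm p (a *\<^sub>R \<xi>) \<le> (\<Sum>\<eta>\<leftarrow>map ((*\<^sub>R) a) L. len p \<eta>)"
    by (rule cone_norm_le[OF assms(1)])
  also have "\<dots> = (\<Sum>\<eta>\<leftarrow>L. \<bar>a\<bar> * len p \<eta>)"
  proof -
    have "len p (a *\<^sub>R \<eta>) = \<bar>a\<bar> * len p \<eta>" if "\<eta> \<in> set L" for \<eta>
      using len_scale[OF assms(1)] twistor_cone_subset_tangent_space[OF assms(1)] L(1) that by blast
    then have "map (\<lambda>\<eta>. len p (a *\<^sub>R \<eta>)) L = map (\<lambda>\<eta>. \<bar>a\<bar> * len p \<eta>) L" by simp
    then show ?thesis by (simp add: o_def del: map_eq_conv)
  qed
  also have "\<dots> = \<bar>a\<bar> * (\<Sum>\<eta>\<leftarrow>L. len p \<eta>)" by (rule sum_list_const_mult)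
  also have "\<dots> \<le> \<bar>a\<bar> * (cone_norm p \<xi> + e / (\<bar>a\<bar> + 1))" using L(3) by (intro mult_left_mono) auto
  also have "\<dots> = \<bar>a\<bar> * cone_norm p \<xi> + e * (\<bar>a\<bar> / (\<bar>a\<bar> + 1))" by (simp add: algebra_simps)
  also have "\<dots> \<le> \<bar>a\<bar> * cone_norm p \<xi> + e"
    using e by (intro add_left_mono mult_left_le) (auto simp: divide_simps)
  finally show "cone_norm p (a *\<^sub>R \<xi>) \<le> \<bar>a\<bar> * cone_norm p \<xi> + e" .
qed

lemma cone_norm_scale:
  assumes "p \<in> Per q" "\<xi> \<in> tangent_space (Per q) p"
  shows "cone_norm p (a *\<^sub>R \<xi>) = \<bar>a\<bar> * cone_norm p \<xi>"
proof (cases "a = 0")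
  case True
  have T: "a *\<^sub>R \<xi> \<in> tangent_space (Per q) p"
    using subspace_tangent_space[OF assms(1)] assms(2) subspace_scale by blast
  then show ?thesis using cone_norm_scale_le[OF assms, of a] cone_norm_nonneg[OF assms(1) T] True by simp
next
  case False
  have T: "a *\<^sub>R \<xi> \<in> tangent_space (Per q) p"
    using subspace_tangent_space[OF assms(1)] assms(2) subspace_scale by blast
  have "cone_norm p \<xi> \<le> \<bar>inverse a\<bar> * cone_norm p (a *\<^sub>R \<xi>)"
    using cone_norm_scale_le[OF assms(1) T, of "inverse a"] False by simp
  then have "\<bar>a\<bar> * cone_norm p \<xi> \<le> cone_norm p (a *\<^sub>R \<xi>)"
    using False by (simp add: abs_inverse field_simps)
  then show ?thesis using cone_norm_scale_le[OF assms, of a] by simp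
qed

lemma cone_norm_triangle:
  assumes "p \<in> Per q" "\<xi> \<in> tangent_space (Per q) p" "\<zeta> \<in> tangent_space (Per q) p"
  shows "cone_norm p (\<xi> + \<zeta>) \<le> cone_norm p \<xi> + cone_norm p \<zeta>"
proof (rule field_le_epsilon)
  fix e :: real assume "e > 0"
  then have e: "e / 2 > 0" by simp
  obtain L where L: "set L \<subseteq> twistor_cone q p" "sum_list L = \<xi>"
    "(\<Sum>\<eta>\<leftarrow>L. len p \<eta>) < cone_norm p \<xi> + e / 2" using cone_norm_approx[OF assms(1,2) e] .
  obtain L' where L': "set L' \<subseteq> twistor_cone q p" "sum_list L' = \<zeta>"
    "(\<Sum>\<eta>\<leftarrow>L'. len p \<eta>) < cone_norm p \<zeta> + e / 2" using cone_norm_approx[OF assms(1,3) e] .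
  show "cone_norm p (\<xi> + \<zeta>) \<le> cone_norm p \<xi> + cone_norm p \<zeta> + e"
    using cone_norm_le[OF assms(1), of "L @ L'" "\<xi> + \<zeta>"] L L' by simp
qed

text \<open>Compactness of the Euclidean unit sphere of the tangent space.\<close>

lemma len_lower_bound:
  assumes "p \<in> Per q"
  obtains c where "c > 0" "\<And>v. v \<in> tangent_space (Per q) p \<Longrightarrow> c * norm v \<le> len p v"
proof -
  let ?T = "tangent_space (Per q) p"
  have T: "subspace ?T" by (rule subspace_tangent_space[OF assms])
  define S where "S = ?T \<inter> sphere 0 1"
  have S: "compact S" unfolding S_def
    using closed_Int_compact[OF closed_subspace[OF T] compact_sphere] by blast
  have cont: "continuous_on S (len p)"
  proof -
    have "continuous_on S (\<lambda>v. (p, v))" by (intro continuous_intros)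
    from continuous_on_compose2[OF continuous_on_len this] show ?thesis
      using assms by (auto simp: S_def tangent_bundle_def)
  qed
  have sph: "sgn v \<in> S" if "v \<in> ?T" "v \<noteq> 0" for v
    using that T by (simp add: S_def norm_sgn sgn_div_norm subspace_scale)
  show ?thesis
  proof (cases "S = {}")
    case True
    then have z: "v = 0" if "v \<in> ?T" for v using sph that by blast
    show ?thesis
    proof (rule that[of 1])
      fix v assume v: "v \<in> tangent_space (Per q) p"
      then have "v = 0" by (rule z)
      then show "1 * norm v \<le> len p v" using len_nonneg[OF assms v] by simp
    qed simp
  next
    case False
    obtain v0 where v0: "v0 \<in> S" "\<And>v. v \<in> S \<Longrightarrow> len p v0 \<le> len p v"
      using continuous_attains_inf[OF S False cont] by blast
    have "v0 \<noteq> 0" using v0(1) by (auto simp: S_def)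
    then have pos: "len p v0 > 0" using len_pos[OF assms] v0(1) by (auto simp: S_def)
    show ?thesis
    proof (rule that[OF pos])
      fix v assume v: "v \<in> ?T"
      show "len p v0 * norm v \<le> len p v"
      proof (cases "v = 0")
        case True
        then show ?thesis using len_nonneg[OF assms v] by simp
      next
        case False
        have "len p v0 \<le> len p (sgn v)" using v0(2) sph[OF v False] by blast
        also have "\<dots> = len p v / norm v"
          using len_scale[OF assms v] by (simp add: sgn_div_norm divide_inverse)
        finally show ?thesis using False by (simp add: field_simps)
      qed
    qed
  qed
qed

lemma cone_norm_eq_0:
  assumes "p \<in> Per q" "\<xi> \<in> tangent_space (Per q) p"
  shows "cone_norm p \<xi> = 0 \<longleftrightarrow> \<xi> = 0"
proof
  assume "\<xi> = 0"
  then show "cone_norm p \<xi> = 0" using cone_norm_scale[OF assms, of 0] by simp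
next
  assume z: "cone_norm p \<xi> = 0"
  obtain c where c: "c > 0" "\<And>v. v \<in> tangent_space (Per q) p \<Longrightarrow> c * norm v \<le> len p v"
    using len_lower_bound[OF assms(1)] by blast
  have "c * norm \<xi> \<le> 0"
  proof (rule field_le_epsilon)
    fix e :: real assume "e > 0"
    from cone_norm_approx[OF assms this] obtain L where L: "set L \<subseteq> twistor_cone q p"
      "sum_list L = \<xi>" "(\<Sum>\<eta>\<leftarrow>L. len p \<eta>) < e" using z by (metis add_0)
    have "c * norm (sum_list L) \<le> (\<Sum>\<eta>\<leftarrow>L. len p \<eta>)" using L(1)
    proof (induction L)
      case (Cons \<eta> L)
      have "c * norm (\<eta> + sum_list L) \<le> c * norm \<eta> + c * norm (sum_list L)"
        using c(1) norm_triangle_ineq[of \<eta> "sum_list L"] by (simp flip: distrib_left)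
      also have "c * norm \<eta> \<le> len p \<eta>"
        using c(2) Cons.prems twistor_cone_subset_tangent_space[OF assms(1)] by auto
      finally show ?case using Cons by simp
    qed simp
    then show "c * norm \<xi> \<le> 0 + e" using L by simp
  qed
  then show "\<xi> = 0" using c(1) by (simp add: mult_le_0_iff)
qed

lemma cone_norm_lift_bound:
  assumes "pos2 q z0"
  obtains R K where "R > 0" "K > 0"
    "\<And>z f. z \<in> ball z0 R \<Longrightarrow> cone_norm (plane z) (dplane z f) \<le> K * norm f"
proof -
  obtain R1 C where C: "R1 > 0" "C > 0"
    "\<And>f. \<exists>fs. sum_list fs = f \<and> (\<Sum>h\<leftarrow>fs. norm h) \<le> C * norm f \<and> (\<forall>h\<in>set fs. turns_on (ball z0 R1) h)"
    using turn_decomposition[OF assms] by blast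
  obtain R2 K where K: "R2 > 0" "K > 0" "\<And>z. z \<in> ball z0 R2 \<Longrightarrow> pos2 q z"
    "\<And>z f. z \<in> ball z0 R2 \<Longrightarrow> lift_len z f \<le> K * norm f"
    using lift_len_bound[OF assms] by blast
  show ?thesis
  proof (rule that[of "min R1 R2" "K * C"])
    fix z f assume z: "z \<in> ball z0 (min R1 R2)"
    obtain fs where fs: "sum_list fs = f" "(\<Sum>h\<leftarrow>fs. norm h) \<le> C * norm f"
      "\<forall>h\<in>set fs. turns_on (ball z0 R1) h" using C(3)[of f] by blast
    have "cone_norm (plane z) (dplane z f) \<le> (\<Sum>\<eta>\<leftarrow>map (dplane z) fs. len (plane z) \<eta>)"
    proof (rule cone_norm_le)
      show "plane z \<in> Per q" using plane_in_Per K(3) z by simp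
      show "set (map (dplane z) fs) \<subseteq> twistor_cone q (plane z)"
        using turns_on_in_cone[of "ball z0 R1" _ z] fs(3) z by auto
      show "sum_list (map (dplane z) fs) = dplane z f"
        using linear_sum_list[OF linear_dplane] fs(1) by metis
    qed
    also have "\<dots> = (\<Sum>h\<leftarrow>fs. lift_len z h)" by (simp add: lift_len_def o_def)
    also have "\<dots> \<le> (\<Sum>h\<leftarrow>fs. K * norm h)"
      using K(4) z by (intro sum_list_mono) auto
    also have "\<dots> = K * (\<Sum>h\<leftarrow>fs. norm h)" by (rule sum_list_const_mult)
    also have "\<dots> \<le> K * (C * norm f)" using fs(2) K(2) by simp
    finally show "cone_norm (plane z) (dplane z f) \<le> K * C * norm f" by (simp add: mult.assoc)
  qed (use C K in auto)
qed

text \<open>Null directions orthogonal to the plane are limits of positive ones: \<open>w\<^sub>0\<close> is a positive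
  orthogonal vector with the sign that makes \<open>B w w\<^sub>0 \<ge> 0\<close>.\<close>

lemma perturb_direction:
  assumes "pos2 q z" "B w (fst z) = 0" "B w (snd z) = 0" "q w \<ge> 0"
  obtains w0 where "\<And>\<delta>. \<delta> > 0 \<Longrightarrow> pos3 q z (w + \<delta> *\<^sub>R w0)"
proof -
  obtain w1 where w1: "B w1 (fst z) = 0" "B w1 (snd z) = 0" "q w1 > 0" using pos2_extend .
  define w0 where "w0 = (if B w w1 \<ge> 0 then w1 else - w1)"
  have w0: "B w0 (fst z) = 0" "B w0 (snd z) = 0" "q w0 > 0" "B w w0 \<ge> 0"
    using w1 by (auto simp: w0_def B.minus_left B.minus_right q_B)
  show ?thesis
  proof (rule that[of w0], rule pos3I[OF assms(1)])
    fix \<delta> :: real assume d: "\<delta> > 0"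
    show "B (w + \<delta> *\<^sub>R w0) (fst z) = 0" "B (w + \<delta> *\<^sub>R w0) (snd z) = 0"
      using w0 assms by (simp_all add: B.add_left B.scaleR_left)
    have "q (w + \<delta> *\<^sub>R w0) = q w + 2 * \<delta> * B w w0 + \<delta>\<^sup>2 * q w0"
      by (simp add: q_add B.scaleR_right)
    also have "\<dots> > 0" using d w0 assms(4) by (intro add_nonneg_pos add_nonneg_nonneg) auto
    finally show "q (w + \<delta> *\<^sub>R w0) > 0" .
  qed
qed

lemma orthogonal_notin_span:
  assumes "pos2 q z" "B w (fst z) = 0" "B w (snd z) = 0" "w \<noteq> 0"
  shows "w \<notin> span {fst z, snd z}"
proof
  assume "w \<in> span {fst z, snd z}"
  then obtain a b where w: "w = a *\<^sub>R fst z + b *\<^sub>R snd z" unfolding span_pair_iff by blast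
  have "q w = B w (a *\<^sub>R fst z + b *\<^sub>R snd z)" unfolding q_B by (simp flip: w)
  also have "\<dots> = 0" using assms by (simp add: B.add_right B.scaleR_right)
  finally have "q w = 0" .
  moreover have "(a, b) \<noteq> (0, 0)" using w assms(4) by auto
  then have "q w > 0" using assms(1) unfolding pos2_def w by blast
  ultimately show False by simp
qed

text \<open>Both errors are measured relative to the length of \<open>\<eta>\<close>, so that they can be summed over
  decompositions with arbitrarily many summands.\<close>

definition cone_close :: "real \<Rightarrow> (real ^ 'n) \<times> (real ^ 'n) \<Rightarrow> (real ^ 'n) \<times> (real ^ 'n) \<Rightarrow> real ^ 'n ^ 'n \<Rightarrow> bool" where
  "cone_close \<epsilon> z z' \<eta> \<longleftrightarrow> (\<exists>\<eta>'\<in>twistor_cone q (plane z').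
     norm (\<eta> - \<eta>') \<le> \<epsilon> * len (plane z) \<eta> \<and> len (plane z') \<eta>' \<le> (1 + \<epsilon>) * len (plane z) \<eta>)"

lemma tendsto_lift_len:
  assumes "pos2 q z" "(Z \<longlongrightarrow> z) F" "(f \<longlongrightarrow> h) F"
  shows "((\<lambda>n. lift_len (Z n) (f n)) \<longlongrightarrow> lift_len z h) F"
  using isCont_tendsto_compose[OF isCont_lift_len[OF assms(1), of h] tendsto_Pair[OF assms(2,3)]]
  by simp

lemma tendsto_dplane:
  assumes "pos2 q z" "(Z \<longlongrightarrow> z) F" "(f \<longlongrightarrow> h) F"
  shows "((\<lambda>n. dplane (Z n) (f n)) \<longlongrightarrow> dplane z h) F"
proof -
  let ?W = "{z. wedge (fst z) (snd z) \<noteq> 0} :: ((real ^ 'n) \<times> (real ^ 'n)) set"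
  have e: "{(z, f). wedge (fst z) (snd z) \<noteq> 0} = ?W \<times> (UNIV :: ((real ^ 'n) \<times> (real ^ 'n)) set)"
    by auto
  have c: "continuous_on (?W \<times> UNIV) (\<lambda>(z, f). dplane z f)"
    unfolding e[symmetric] by (rule continuous_on_dplane)
  have "(z, h) \<in> ?W \<times> UNIV" using pos2_wedge_neq_0[OF assms(1)] by simp
  then have "isCont (\<lambda>(z, f). dplane z f) (z, h)"
    using c unfolding continuous_on_eq_continuous_at[OF open_Times[OF open_wedge_neq_0 open_UNIV]] by (rule bspec[rotated])
  from isCont_tendsto_compose[OF this tendsto_Pair[OF assms(2,3)]] show ?thesis by simp
qed

text \<open>Otherwise there are counterexamples whose base frames converge to \<open>z\<^sub>0\<close>, and by compactness their
  coefficients and directions converge as well. The limit direction \<open>w\<close> is orthogonal to the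
  plane with \<open>q w \<ge> 0\<close>, so the limit vector is nonzero and is approximated by vectors of the cone
  at \<open>z\<^sub>0\<close>. The approximating direction is admissible at all nearby frames, a contradiction.
  Normalising both factors of \<open>(aw, bw)\<close> is what makes them range over a compact set.\<close>

lemma cone_close_unit:
  assumes z0: "pos2 q z0" and \<epsilon>: "\<epsilon> > 0"
  shows "\<exists>\<delta>>0. \<forall>z z' (a::real) (b::real) w. z \<in> ball z0 \<delta> \<and> z' \<in> ball z0 \<delta> \<and> norm (a, b) = 1 \<and> norm w = 1 \<and>
     B w (fst z) = 0 \<and> B w (snd z) = 0 \<and> q w > 0 \<longrightarrow> cone_close \<epsilon> z z' (dplane z (a *\<^sub>R w, b *\<^sub>R w))"
proof (rule ccontr)
  assume "\<not> ?thesis"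
  then have "\<forall>n. \<exists>z z' s w. z \<in> ball z0 (inverse (Suc n)) \<and> z' \<in> ball z0 (inverse (Suc n)) \<and>
     norm s = 1 \<and> norm w = 1 \<and> B w (fst z) = 0 \<and> B w (snd z) = 0 \<and> q w > 0 \<and>
     \<not> cone_close \<epsilon> z z' (dplane z (fst s *\<^sub>R w, snd s *\<^sub>R w))"
    by (metis fst_conv snd_conv inverse_positive_iff_positive of_nat_0_less_iff zero_less_Suc)
  then obtain Z Z' S W where *: "\<And>n. Z n \<in> ball z0 (inverse (Suc n))" "\<And>n. Z' n \<in> ball z0 (inverse (Suc n))"
    "\<And>n. norm (S n) = 1" "\<And>n. norm (W n) = 1" "\<And>n. B (W n) (fst (Z n)) = 0" "\<And>n. B (W n) (snd (Z n)) = 0"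
    "\<And>n. q (W n) > 0" "\<And>n. \<not> cone_close \<epsilon> (Z n) (Z' n) (dplane (Z n) (fst (S n) *\<^sub>R W n, snd (S n) *\<^sub>R W n))"
    by metis
  have lim: "X \<longlonglongrightarrow> z0" if "\<And>n. X n \<in> ball z0 (inverse (Suc n))" for X
  proof -
    have "(\<lambda>n. dist (X n) z0) \<longlonglongrightarrow> 0"
      by (rule tendsto_sandwich[OF _ _ tendsto_const LIMSEQ_inverse_real_of_nat])
        (use that in \<open>auto simp: dist_commute less_imp_le intro!: always_eventually\<close>)
    then show ?thesis using tendsto_dist_iff by blast
  qed
  have K: "compact (sphere (0 :: real \<times> real) 1 \<times> sphere (0 :: real ^ 'n) 1)" by (intro compact_Times) auto
  have mem: "\<forall>n. (S n, W n) \<in> sphere 0 1 \<times> sphere 0 1" using *(3,4) by simp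
  obtain l r where l: "l \<in> sphere 0 1 \<times> sphere 0 1" and r: "strict_mono r"
    and lr: "((\<lambda>n. (S n, W n)) \<circ> r) \<longlonglongrightarrow> l"
    using seq_compactE[OF compact_imp_seq_compact[OF K] mem] .
  obtain s w where sw: "l = (s, w)" by (cases l)
  have s: "(\<lambda>n. S (r n)) \<longlonglongrightarrow> s" and w: "(\<lambda>n. W (r n)) \<longlonglongrightarrow> w"
    using tendsto_fst[OF lr] tendsto_snd[OF lr] by (simp_all add: sw o_def)
  have n1: "norm s = 1" "norm w = 1" using l by (auto simp: sw)
  have Z: "(\<lambda>n. Z (r n)) \<longlonglongrightarrow> z0" "(\<lambda>n. Z' (r n)) \<longlonglongrightarrow> z0"
    using LIMSEQ_subseq_LIMSEQ[OF lim r] *(1,2) by (auto simp: o_def)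
  have "(\<lambda>n. B (W (r n)) (fst (Z (r n)))) \<longlonglongrightarrow> B w (fst z0)" "(\<lambda>n. B (W (r n)) (snd (Z (r n)))) \<longlonglongrightarrow> B w (snd z0)"
    by (intro B.tendsto tendsto_intros w Z)+
  then have B0: "B w (fst z0) = 0" "B w (snd z0) = 0"
    using *(5,6) LIMSEQ_unique[OF _ tendsto_const] by auto
  have "(\<lambda>n. q (W (r n))) \<longlonglongrightarrow> q w" unfolding q_B by (intro B.tendsto w)
  then have qw: "q w \<ge> 0" using *(7) by (meson LIMSEQ_le_const less_imp_le)
  define f where "f = (fst s *\<^sub>R w, snd s *\<^sub>R w)"
  define m where "m = lift_len z0 f"
  have "dplane z0 f \<noteq> 0"
  proof
    assume "dplane z0 f = 0"
    moreover have "w \<noteq> 0" using n1(2) by auto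
    ultimately have "fst s = 0 \<and> snd s = 0"
      using dplane_eq_0D[of "fst z0" "snd z0" w "fst s" "snd s"] pos2_wedge_neq_0[OF z0]
        orthogonal_notin_span[OF z0 B0] by (auto simp: f_def)
    then show False using n1(1) by (metis norm_zero prod.collapse zero_neq_one zero_prod_def)
  qed
  then have m: "m > 0"
    using len_pos[OF plane_in_Per[OF z0] dplane_in_tangent_space[OF z0]] by (simp add: m_def lift_len_def)
  obtain w0 where w0: "\<And>\<delta>. \<delta> > 0 \<Longrightarrow> pos3 q z0 (w + \<delta> *\<^sub>R w0)"
    using perturb_direction[OF z0 B0 qw] by blast
  define h where "h \<delta> = (fst s *\<^sub>R (w + \<delta> *\<^sub>R w0), snd s *\<^sub>R (w + \<delta> *\<^sub>R w0))" for \<delta> :: real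
  have "((\<lambda>\<delta>. w + \<delta> *\<^sub>R w0) \<longlongrightarrow> w + 0 *\<^sub>R w0) (at_right 0)" by (intro tendsto_intros)
  then have h: "(h \<longlongrightarrow> f) (at_right 0)"
    unfolding h_def f_def by (intro tendsto_intros) simp_all
  have "((\<lambda>\<delta>. (1 + \<epsilon>) * m - lift_len z0 (h \<delta>)) \<longlongrightarrow> (1 + \<epsilon>) * m - m) (at_right 0)"
    using tendsto_lift_len[OF z0 tendsto_const h] by (intro tendsto_intros) (simp add: m_def)
  then have e1: "\<forall>\<^sub>F \<delta> in at_right 0. (1 + \<epsilon>) * m - lift_len z0 (h \<delta>) > 0"
    by (rule order_tendstoD) (use \<epsilon> m in \<open>simp add: algebra_simps\<close>)
  have "((\<lambda>\<delta>. \<epsilon> * m - norm (dplane z0 f - dplane z0 (h \<delta>))) \<longlongrightarrow> \<epsilon> * m - norm (dplane z0 f - dplane z0 f)) (at_right 0)"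
    using tendsto_dplane[OF z0 tendsto_const h] by (intro tendsto_intros)
  then have e2: "\<forall>\<^sub>F \<delta> in at_right 0. \<epsilon> * m - norm (dplane z0 f - dplane z0 (h \<delta>)) > 0"
    by (rule order_tendstoD) (use \<epsilon> m in simp)
  have "\<forall>\<^sub>F \<delta> :: real in at_right 0. \<delta> > 0" by (simp add: eventually_at_right_less)
  then have "\<forall>\<^sub>F \<delta> in at_right 0. \<delta> > 0 \<and> (1 + \<epsilon>) * m - lift_len z0 (h \<delta>) > 0 \<and>
      \<epsilon> * m - norm (dplane z0 f - dplane z0 (h \<delta>)) > 0"
    using e1 e2 by eventually_elim simp
  then obtain \<delta> where \<delta>: "\<delta> > 0" "(1 + \<epsilon>) * m - lift_len z0 (h \<delta>) > 0"
      "\<epsilon> * m - norm (dplane z0 f - dplane z0 (h \<delta>)) > 0"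
    using eventually_happens'[OF trivial_limit_at_right_real] by blast
  let ?w = "w + \<delta> *\<^sub>R w0"
  obtain R where R: "R > 0" "\<And>z'. dist z' z0 < R \<Longrightarrow> pos3 q z' ?w"
    using pos3_ball[OF w0[OF \<delta>(1)]] by (metis dist_self)
  have p3: "\<forall>\<^sub>F n in sequentially. pos3 q (Z' (r n)) ?w"
    using tendstoD[OF Z(2) R(1)] by eventually_elim (rule R(2))
  let ?f = "\<lambda>n. (fst (S (r n)) *\<^sub>R W (r n), snd (S (r n)) *\<^sub>R W (r n))"
  have f: "?f \<longlonglongrightarrow> f" unfolding f_def by (intro tendsto_intros s w)
  have ml: "(\<lambda>n. lift_len (Z (r n)) (?f n)) \<longlonglongrightarrow> m" unfolding m_def by (rule tendsto_lift_len[OF z0 Z(1) f])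
  have ml': "(\<lambda>n. lift_len (Z' (r n)) (h \<delta>)) \<longlonglongrightarrow> lift_len z0 (h \<delta>)"
    by (rule tendsto_lift_len[OF z0 Z(2) tendsto_const])
  have d: "(\<lambda>n. norm (dplane (Z (r n)) (?f n) - dplane (Z' (r n)) (h \<delta>))) \<longlonglongrightarrow> norm (dplane z0 f - dplane z0 (h \<delta>))"
    by (intro tendsto_intros tendsto_dplane z0 Z f)
  have "(\<lambda>n. (1 + \<epsilon>) * lift_len (Z (r n)) (?f n) - lift_len (Z' (r n)) (h \<delta>)) \<longlonglongrightarrow> (1 + \<epsilon>) * m - lift_len z0 (h \<delta>)"
    by (intro tendsto_intros ml ml')
  then have E1: "\<forall>\<^sub>F n in sequentially. (1 + \<epsilon>) * lift_len (Z (r n)) (?f n) - lift_len (Z' (r n)) (h \<delta>) > 0"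
    using \<delta>(2) order_tendstoD(1) by blast
  have "(\<lambda>n. \<epsilon> * lift_len (Z (r n)) (?f n) - norm (dplane (Z (r n)) (?f n) - dplane (Z' (r n)) (h \<delta>)))
      \<longlonglongrightarrow> \<epsilon> * m - norm (dplane z0 f - dplane z0 (h \<delta>))"
    by (intro tendsto_intros ml d)
  then have E2: "\<forall>\<^sub>F n in sequentially.
      \<epsilon> * lift_len (Z (r n)) (?f n) - norm (dplane (Z (r n)) (?f n) - dplane (Z' (r n)) (h \<delta>)) > 0"
    using \<delta>(3) order_tendstoD(1) by blast
  have "\<forall>\<^sub>F n in sequentially. False"
    using p3 E1 E2
  proof eventually_elim
    case (elim n)
    have "dplane (Z' (r n)) (h \<delta>) \<in> twistor_cone q (plane (Z' (r n)))"
      unfolding h_def by (rule dplane_in_twistor_cone[OF elim(1)])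
    then have "cone_close \<epsilon> (Z (r n)) (Z' (r n)) (dplane (Z (r n)) (?f n))"
      unfolding cone_close_def using elim(2,3)
      by (intro bexI[of _ "dplane (Z' (r n)) (h \<delta>)"]) (simp_all add: lift_len_def)
    then show False using *(8) by blast
  qed
  then show False by simp
qed

lemma cone_close_near:
  assumes z0: "pos2 q z0" and \<epsilon>: "\<epsilon> > 0"
  obtains \<delta> where "\<delta> > 0" "\<And>z z' (a::real) (b::real) w. z \<in> ball z0 \<delta> \<Longrightarrow> z' \<in> ball z0 \<delta> \<Longrightarrow>
     B w (fst z) = 0 \<Longrightarrow> B w (snd z) = 0 \<Longrightarrow> q w > 0 \<Longrightarrow> cone_close \<epsilon> z z' (dplane z (a *\<^sub>R w, b *\<^sub>R w))"
proof -
  obtain \<delta>1 where d1: "\<delta>1 > 0" "\<And>z z' (a::real) (b::real) w. z \<in> ball z0 \<delta>1 \<Longrightarrow> z' \<in> ball z0 \<delta>1 \<Longrightarrow> norm (a, b) = 1 \<Longrightarrow>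
     norm w = 1 \<Longrightarrow> B w (fst z) = 0 \<Longrightarrow> B w (snd z) = 0 \<Longrightarrow> q w > 0 \<Longrightarrow> cone_close \<epsilon> z z' (dplane z (a *\<^sub>R w, b *\<^sub>R w))"
    using cone_close_unit[OF assms] by metis
  obtain R where R: "R > 0" "ball z0 R \<subseteq> {z. pos2 q z}"
    using openE[OF open_pos2, of z0] z0 by (metis mem_Collect_eq)
  show ?thesis
  proof (rule that[of "min \<delta>1 R"])
    fix z z' w and a b :: real assume z: "z \<in> ball z0 (min \<delta>1 R)" "z' \<in> ball z0 (min \<delta>1 R)"
      and w: "B w (fst z) = 0" "B w (snd z) = 0" "q w > 0"
    have p: "pos2 q z" "pos2 q z'" using z R(2) by auto
    note P = plane_in_Per[OF p(1)] plane_in_Per[OF p(2)]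
    let ?k = "norm (a, b) * norm w"
    show "cone_close \<epsilon> z z' (dplane z (a *\<^sub>R w, b *\<^sub>R w))"
    proof (cases "(a, b) = (0, 0)")
      case True
      then have "dplane z (a *\<^sub>R w, b *\<^sub>R w) = 0"
        using linear_0[OF linear_dplane, of z] by (simp add: zero_prod_def)
      moreover have "len (plane z) 0 = 0" "len (plane z') 0 = 0"
        using len_scale[OF P(1) subspace_0[OF subspace_tangent_space[OF P(1)]], of 0]
          len_scale[OF P(2) subspace_0[OF subspace_tangent_space[OF P(2)]], of 0] by auto
      ultimately show ?thesis unfolding cone_close_def
        using zero_in_twistor_cone[OF P(2)] by (intro bexI[of _ 0]) auto
    next
      case False
      have "w \<noteq> 0" using w(3) by auto
      then have k: "?k > 0" using False by (simp add: zero_prod_def)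
      define a' b' w' where "a' = a / norm (a, b)" and "b' = b / norm (a, b)" and "w' = w /\<^sub>R norm w"
      have ab': "(a', b') = sgn (a, b)" by (simp add: a'_def b'_def sgn_div_norm divide_inverse)
      have "norm (a', b') = 1" unfolding ab' norm_sgn using False by (simp add: zero_prod_def)
      moreover have "norm w' = 1" using \<open>w \<noteq> 0\<close> by (simp add: w'_def)
      moreover have "B w' (fst z) = 0" "B w' (snd z) = 0" "q w' > 0"
        using w \<open>w \<noteq> 0\<close> by (auto simp: w'_def B.scaleR_left)
      ultimately have "cone_close \<epsilon> z z' (dplane z (a' *\<^sub>R w', b' *\<^sub>R w'))" using d1(2) z by simp
      moreover define \<eta> where "\<eta> = dplane z (a' *\<^sub>R w', b' *\<^sub>R w')"
      ultimately obtain \<eta>' where \<eta>': "\<eta>' \<in> twistor_cone q (plane z')"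
        "norm (\<eta> - \<eta>') \<le> \<epsilon> * len (plane z) \<eta>" "len (plane z') \<eta>' \<le> (1 + \<epsilon>) * len (plane z) \<eta>"
        unfolding cone_close_def by blast
      have "(a *\<^sub>R w, b *\<^sub>R w) = ?k *\<^sub>R (a' *\<^sub>R w', b' *\<^sub>R w')"
        using False \<open>w \<noteq> 0\<close> by (simp add: a'_def b'_def w'_def zero_prod_def)
      then have e: "dplane z (a *\<^sub>R w, b *\<^sub>R w) = ?k *\<^sub>R \<eta>"
        unfolding \<eta>_def by (simp only: linear_cmul[OF linear_dplane])
      have l: "len (plane z) (?k *\<^sub>R \<eta>) = ?k * len (plane z) \<eta>"
        using len_scale[OF P(1), of \<eta> ?k] dplane_in_tangent_space[OF p(1)] k by (simp add: \<eta>_def)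
      have l': "len (plane z') (?k *\<^sub>R \<eta>') = ?k * len (plane z') \<eta>'"
        using len_scale[OF P(2), of \<eta>' ?k] twistor_cone_subset_tangent_space[OF P(2)] \<eta>'(1) k by auto
      have "norm (?k *\<^sub>R \<eta> - ?k *\<^sub>R \<eta>') = ?k * norm (\<eta> - \<eta>')"
        using k by (simp flip: scaleR_right_diff_distrib)
      also have "\<dots> \<le> ?k * (\<epsilon> * len (plane z) \<eta>)" using \<eta>'(2) k by (intro mult_left_mono) auto
      finally have n: "norm (?k *\<^sub>R \<eta> - ?k *\<^sub>R \<eta>') \<le> \<epsilon> * (?k * len (plane z) \<eta>)" by (simp add: mult_ac)
      have "?k * len (plane z') \<eta>' \<le> ?k * ((1 + \<epsilon>) * len (plane z) \<eta>)"
        using \<eta>'(3) k by (intro mult_left_mono) auto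
      then have "?k * len (plane z') \<eta>' \<le> (1 + \<epsilon>) * (?k * len (plane z) \<eta>)" by (simp add: mult_ac)
      then show ?thesis unfolding cone_close_def e l
        using scale_in_twistor_cone[OF P(2) \<eta>'(1), of ?k] n
        by (intro bexI[of _ "?k *\<^sub>R \<eta>'"]) (simp_all only: l' conj_absorb)
    qed
  qed (use d1 R in auto)
qed

end

section \<open>Continuity of the norm\<close>

lemma norm_sum_list_diff_le:
  "norm (sum_list L - sum_list (map h L)) \<le> (\<Sum>\<eta>\<leftarrow>L. norm (\<eta> - h \<eta>))"
proof (induction L)
  case (Cons \<eta> L)
  have "norm ((\<eta> + sum_list L) - (h \<eta> + sum_list (map h L))) =
      norm ((\<eta> - h \<eta>) + (sum_list L - sum_list (map h L)))" by (simp add: algebra_simps)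
  also have "\<dots> \<le> norm (\<eta> - h \<eta>) + norm (sum_list L - sum_list (map h L))" by (rule norm_triangle_ineq)
  finally show ?case using Cons by simp
qed simp

context period_metric
begin

text \<open>Each summand of an almost optimal decomposition of \<open>\<xi>\<close> is replaced by a nearby vector of the cone
  at \<open>p'\<close>. What then remains of \<open>\<xi>'\<close> is small, and \<open>cone_norm_lift_bound\<close> controls its norm.\<close>

lemma cone_norm_compare:
  assumes p0: "p0 \<in> Per q"
  obtains C where "C > 0" "\<And>\<epsilon>. \<epsilon> > 0 \<Longrightarrow> \<exists>\<delta>>0. \<forall>p p' \<xi> \<xi>'.
     p \<in> Per q \<and> p' \<in> Per q \<and> dist p p0 < \<delta> \<and> dist p' p0 < \<delta> \<and>
     \<xi> \<in> tangent_space (Per q) p \<and> \<xi>' \<in> tangent_space (Per q) p' \<longrightarrow>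
     cone_norm p' \<xi>' \<le> (1 + (1 + C) * \<epsilon>) * cone_norm p \<xi> + C * norm (\<xi>' - \<xi>)"
proof -
  obtain \<alpha> \<beta> where ab: "\<alpha> \<bullet> (p0 *v \<beta>) > 0" using exists_frame[OF p0] .
  let ?F = "frame \<alpha> \<beta>"
  let ?z0 = "?F p0"
  have z0: "pos2 q ?z0" using frame_section(2)[OF p0 ab] .
  obtain N where N: "N > 0" "\<And>x. norm (?F x) \<le> norm x * N"
    using bounded_linear.pos_bounded[OF bounded_linear_frame] by metis
  obtain R K where K: "R > 0" "K > 0"
    "\<And>z f. z \<in> ball ?z0 R \<Longrightarrow> cone_norm (plane z) (dplane z f) \<le> K * norm f"
    using cone_norm_lift_bound[OF z0] by metis
  obtain \<delta>2 where d2: "\<delta>2 > 0" "ball p0 \<delta>2 \<subseteq> {p. \<alpha> \<bullet> (p *v \<beta>) > 0}"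
    using openE[OF open_frame_domain, of p0] ab by (metis mem_Collect_eq)
  define C where "C = K * N"
  have C: "C > 0" using K N by (simp add: C_def)
  show ?thesis
  proof (rule that[OF C])
    fix \<epsilon> :: real assume \<epsilon>: "\<epsilon> > 0"
    obtain \<delta>1 where d1: "\<delta>1 > 0" "\<And>z z' (a::real) (b::real) w. z \<in> ball ?z0 \<delta>1 \<Longrightarrow> z' \<in> ball ?z0 \<delta>1 \<Longrightarrow>
     B w (fst z) = 0 \<Longrightarrow> B w (snd z) = 0 \<Longrightarrow> q w > 0 \<Longrightarrow> cone_close \<epsilon> z z' (dplane z (a *\<^sub>R w, b *\<^sub>R w))"
      using cone_close_near[OF z0 \<epsilon>] by metis
    define \<delta> where "\<delta> = min \<delta>2 (min \<delta>1 R / N)"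
    have \<delta>: "\<delta> > 0" using d1(1) d2(1) K(1) N(1) by (simp add: \<delta>_def)
    have near: "?F p \<in> ball ?z0 \<delta>1" "?F p \<in> ball ?z0 R" "\<alpha> \<bullet> (p *v \<beta>) > 0" if "dist p p0 < \<delta>" for p
    proof -
      have "dist ?z0 (?F p) = norm (?F (p0 - p))"
        by (simp add: dist_norm linear_diff[OF bounded_linear.linear[OF bounded_linear_frame]])
      also have "\<dots> \<le> dist p p0 * N" using N(2)[of "p0 - p"] by (simp add: dist_norm norm_minus_commute)
      also have "\<dots> < min \<delta>1 R" using that N(1) by (simp add: \<delta>_def field_simps)
      finally show "?F p \<in> ball ?z0 \<delta>1" "?F p \<in> ball ?z0 R" by auto
      show "\<alpha> \<bullet> (p *v \<beta>) > 0" using that d2(2) by (auto simp: \<delta>_def dist_commute)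
    qed
    have "cone_norm p' \<xi>' \<le> (1 + (1 + C) * \<epsilon>) * cone_norm p \<xi> + C * norm (\<xi>' - \<xi>)"
      if p: "p \<in> Per q" "p' \<in> Per q" "dist p p0 < \<delta>" "dist p' p0 < \<delta>"
        and \<xi>: "\<xi> \<in> tangent_space (Per q) p" "\<xi>' \<in> tangent_space (Per q) p'" for p p' \<xi> \<xi>'
    proof (rule field_le_epsilon)
      fix e :: real assume e: "e > 0"
      define k where "k = 1 + (1 + C) * \<epsilon>"
      have k: "k > 0" using C \<epsilon> by (simp add: k_def add_pos_pos)
      have "e / k > 0" using e k by simp
      from cone_norm_approx[OF p(1) \<xi>(1) this] obtain L where L: "set L \<subseteq> twistor_cone q p"
        "sum_list L = \<xi>" "(\<Sum>\<eta>\<leftarrow>L. len p \<eta>) < cone_norm p \<xi> + e / k" .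
      let ?s = "\<Sum>\<eta>\<leftarrow>L. len p \<eta>"
      have sec: "plane (?F p) = p" "plane (?F p') = p'"
        using frame_section(1) p near(3) by auto
      have "\<exists>\<eta>'\<in>twistor_cone q p'. norm (\<eta> - \<eta>') \<le> \<epsilon> * len p \<eta> \<and> len p' \<eta>' \<le> (1 + \<epsilon>) * len p \<eta>"
        if \<eta>: "\<eta> \<in> set L" for \<eta>
      proof -
        obtain a b w where w: "B w (p *v \<alpha>) = 0" "B w (p *v \<beta>) = 0" "q w > 0"
          "\<eta> = dplane (?F p) (a *\<^sub>R w, b *\<^sub>R w)"
          using twistor_coneE[OF _ p(1) near(3)[OF p(3)], of \<eta>] L(1) \<eta> by blast
        have "cone_close \<epsilon> (?F p) (?F p') (dplane (?F p) (a *\<^sub>R w, b *\<^sub>R w))"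
          using w by (intro d1(2) near(1) p) (simp_all add: frame_def)
        then show ?thesis unfolding cone_close_def sec w(4)[symmetric] by blast
      qed
      then obtain h where h: "\<And>\<eta>. \<eta> \<in> set L \<Longrightarrow> h \<eta> \<in> twistor_cone q p'"
        "\<And>\<eta>. \<eta> \<in> set L \<Longrightarrow> norm (\<eta> - h \<eta>) \<le> \<epsilon> * len p \<eta>"
        "\<And>\<eta>. \<eta> \<in> set L \<Longrightarrow> len p' (h \<eta>) \<le> (1 + \<epsilon>) * len p \<eta>" by metis
      let ?S = "sum_list (map h L)"
      have hL: "set (map h L) \<subseteq> twistor_cone q p'" using h(1) by auto
      have T': "subspace (tangent_space (Per q) p')" by (rule subspace_tangent_space[OF p(2)])
      have S: "?S \<in> tangent_space (Per q) p'"
        using sum_list_in_subspace[OF T'] hL twistor_cone_subset_tangent_space[OF p(2)] by blast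
      have "cone_norm p' ?S \<le> (\<Sum>\<eta>\<leftarrow>map h L. len p' \<eta>)" by (rule cone_norm_le[OF p(2) hL refl])
      also have "\<dots> = (\<Sum>\<eta>\<leftarrow>L. len p' (h \<eta>))" by (simp add: o_def)
      also have "\<dots> \<le> (\<Sum>\<eta>\<leftarrow>L. (1 + \<epsilon>) * len p \<eta>)" by (rule sum_list_mono) (rule h(3))
      also have "\<dots> = (1 + \<epsilon>) * ?s" by (rule sum_list_const_mult)
      finally have 1: "cone_norm p' ?S \<le> (1 + \<epsilon>) * ?s" .
      have "norm (\<xi> - ?S) \<le> (\<Sum>\<eta>\<leftarrow>L. norm (\<eta> - h \<eta>))"
        using norm_sum_list_diff_le[of L h] L(2) by simp
      also have "\<dots> \<le> (\<Sum>\<eta>\<leftarrow>L. \<epsilon> * len p \<eta>)" by (rule sum_list_mono) (rule h(2))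
      also have "\<dots> = \<epsilon> * ?s" by (rule sum_list_const_mult)
      finally have n: "norm (\<xi> - ?S) \<le> \<epsilon> * ?s" .
      let ?r = "\<xi>' - ?S"
      have r: "?r \<in> tangent_space (Per q) p'" using subspace_diff[OF T' \<xi>(2) S] .
      have "cone_norm p' ?r = cone_norm (plane (?F p')) (dplane (?F p') (?F ?r))"
        using tangent_space_frame[OF p(2) near(3)[OF p(4)], of ?r] r sec(2) by simp
      also have "\<dots> \<le> K * norm (?F ?r)" by (rule K(3)[OF near(2)[OF p(4)]])
      also have "\<dots> \<le> K * (norm ?r * N)" using K(2) N(2) by (intro mult_left_mono) auto
      also have "\<dots> = C * norm ?r" by (simp add: C_def)
      also have "\<dots> \<le> C * (norm (\<xi>' - \<xi>) + \<epsilon> * ?s)"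
        using C n norm_triangle_ineq[of "\<xi>' - \<xi>" "\<xi> - ?S"] by (intro mult_left_mono) auto
      finally have 2: "cone_norm p' ?r \<le> C * (norm (\<xi>' - \<xi>) + \<epsilon> * ?s)" .
      have "cone_norm p' \<xi>' \<le> cone_norm p' ?S + cone_norm p' ?r"
        using cone_norm_triangle[OF p(2) S r] by simp
      also have "\<dots> \<le> (1 + \<epsilon>) * ?s + C * (norm (\<xi>' - \<xi>) + \<epsilon> * ?s)" using 1 2 by simp
      also have "\<dots> = k * ?s + C * norm (\<xi>' - \<xi>)" by (simp add: k_def algebra_simps)
      also have "\<dots> \<le> k * (cone_norm p \<xi> + e / k) + C * norm (\<xi>' - \<xi>)"
        using L(3) k by (intro add_right_mono mult_left_mono) auto
      also have "\<dots> = k * cone_norm p \<xi> + C * norm (\<xi>' - \<xi>) + e"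
        using k by (simp add: distrib_left)
      finally show "cone_norm p' \<xi>' \<le> (1 + (1 + C) * \<epsilon>) * cone_norm p \<xi> + C * norm (\<xi>' - \<xi>) + e"
        by (simp add: k_def)
    qed
    then show "\<exists>\<delta>>0. \<forall>p p' \<xi> \<xi>'.
       p \<in> Per q \<and> p' \<in> Per q \<and> dist p p0 < \<delta> \<and> dist p' p0 < \<delta> \<and>
       \<xi> \<in> tangent_space (Per q) p \<and> \<xi>' \<in> tangent_space (Per q) p' \<longrightarrow>
       cone_norm p' \<xi>' \<le> (1 + (1 + C) * \<epsilon>) * cone_norm p \<xi> + C * norm (\<xi>' - \<xi>)"
      using \<delta> by blast
  qed
qed

text \<open>The comparison is used in both directions between the given point and a nearby one.\<close>

lemma continuous_on_cone_norm: "continuous_on (tangent_bundle (Per q)) (\<lambda>(p, v). cone_norm p v)"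
  unfolding continuous_on_iff
proof (clarify)
  fix p0 \<xi>0 and e :: real assume "(p0, \<xi>0) \<in> tangent_bundle (Per q)" and e: "e > 0"
  then have p0: "p0 \<in> Per q" "\<xi>0 \<in> tangent_space (Per q) p0" by (auto simp: tangent_bundle_def)
  obtain C where C: "C > 0" "\<And>\<epsilon>. \<epsilon> > 0 \<Longrightarrow> \<exists>\<delta>>0. \<forall>p p' \<xi> \<xi>'.
     p \<in> Per q \<and> p' \<in> Per q \<and> dist p p0 < \<delta> \<and> dist p' p0 < \<delta> \<and>
     \<xi> \<in> tangent_space (Per q) p \<and> \<xi>' \<in> tangent_space (Per q) p' \<longrightarrow>
     cone_norm p' \<xi>' \<le> (1 + (1 + C) * \<epsilon>) * cone_norm p \<xi> + C * norm (\<xi>' - \<xi>)"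
    using cone_norm_compare[OF p0(1)] by blast
  let ?F = "cone_norm p0 \<xi>0"
  have F: "?F \<ge> 0" by (rule cone_norm_nonneg[OF p0])
  define M where "M = 2 * ?F + C"
  have M: "M > 0" using F C by (simp add: M_def)
  define k where "k = min 1 (e / 2 / M)"
  have k: "k > 0" "k \<le> 1" "k * M \<le> e / 2"
    using e M by (auto simp: k_def min_def field_simps)
  have k': "k / (1 + C) > 0" "(1 + C) * (k / (1 + C)) = k" using k C by auto
  obtain \<delta> where \<delta>: "\<delta> > 0" "\<And>p p' \<xi> \<xi>'. p \<in> Per q \<Longrightarrow> p' \<in> Per q \<Longrightarrow> dist p p0 < \<delta> \<Longrightarrow> dist p' p0 < \<delta> \<Longrightarrow>
     \<xi> \<in> tangent_space (Per q) p \<Longrightarrow> \<xi>' \<in> tangent_space (Per q) p' \<Longrightarrow>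
     cone_norm p' \<xi>' \<le> (1 + k) * cone_norm p \<xi> + C * norm (\<xi>' - \<xi>)"
    using C(2)[OF k'(1)] unfolding k'(2) by blast
  define d where "d = min \<delta> (min 1 (e / 2 / C))"
  have "C * d \<le> C * (e / 2 / C)" using C(1) by (intro mult_left_mono) (auto simp: d_def)
  then have d: "d > 0" "d \<le> \<delta>" "d \<le> 1" "C * d \<le> e / 2"
    using \<delta>(1) e C(1) by (auto simp: d_def)
  have "dist (cone_norm p \<xi>) ?F < e"
    if "(p, \<xi>) \<in> tangent_bundle (Per q)" "dist (p, \<xi>) (p0, \<xi>0) < d" for p \<xi>
  proof -
    have p: "p \<in> Per q" "\<xi> \<in> tangent_space (Per q) p" using that(1) by (auto simp: tangent_bundle_def)
    have dp: "dist p p0 < d" and dx: "norm (\<xi> - \<xi>0) < d"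
      using that(2) dist_fst_le[of "(p, \<xi>)" "(p0, \<xi>0)"] dist_snd_le[of "(p, \<xi>)" "(p0, \<xi>0)"]
      by (auto simp: dist_norm)
    let ?G = "cone_norm p \<xi>"
    have G: "?G \<ge> 0" by (rule cone_norm_nonneg[OF p])
    have c: "C * norm (\<xi> - \<xi>0) < C * d" using dx C(1) by simp
    have 1: "?G \<le> (1 + k) * ?F + C * norm (\<xi> - \<xi>0)"
      using \<delta>(2)[OF p0(1) p(1) _ _ p0(2) p(2)] dp d(2) \<delta>(1) by simp
    have 2: "?F \<le> (1 + k) * ?G + C * norm (\<xi> - \<xi>0)"
      using \<delta>(2)[OF p(1) p0(1) _ _ p(2) p0(2)] dp d(2) \<delta>(1) by (simp add: norm_minus_commute)
    have "(1 + k) * ?F \<le> 2 * ?F" using k(2) F by (intro mult_right_mono) auto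
    moreover have "C * d \<le> C" using d(3) C(1) by simp
    ultimately have GM: "?G \<le> M" using 1 c by (simp add: M_def)
    have FM: "?F \<le> M" using F C(1) by (simp add: M_def)
    have "k * ?G \<le> k * M" "k * ?F \<le> k * M" using GM FM k(1) by (auto intro: mult_left_mono)
    then have "?G - ?F < e" "?F - ?G < e"
      using 1 2 c d(4) k(3) by (auto simp: algebra_simps)
    then show ?thesis by (simp add: dist_real_def abs_less_iff)
  qed
  then show "\<exists>d>0. \<forall>x'\<in>tangent_bundle (Per q). dist x' (p0, \<xi>0) < d \<longrightarrow>
      dist (case x' of (p, v) \<Rightarrow> cone_norm p v) (cone_norm p0 \<xi>0) < e"
    using d(1) by (intro exI[of _ d]) auto
qed

lemma finsler_norm_cone_norm: "finsler_norm (Per q) cone_norm"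
  unfolding finsler_norm_def
  by (simp add: continuous_on_cone_norm cone_norm_nonneg cone_norm_eq_0 cone_norm_scale cone_norm_triangle)

end

section \<open>Comparison of the two distances\<close>

context period_metric
begin

text \<open>To first order the sub-twistor distance along a curve grows at most at the rate
  \<open>cone_norm\<close> of its velocity. An almost optimal decomposition of the velocity at \<open>x\<close> is lifted to
  turns \<open>f\<^sub>i\<close> with sum \<open>V\<close>. For \<open>r \<le> x \<le> s\<close> one makes the moves \<open>(s - r)f\<^sub>i\<close> from a frame of
  \<open>c r\<close> and ends within \<open>o(s - r)\<close> of a frame of \<open>c s\<close>.\<close>

lemma twistor_chain_local:
  fixes c :: "real \<Rightarrow> real ^ 'n ^ 'n"
  assumes c: "c ` S \<subseteq> Per q" and x: "x \<in> S" and nt: "at x within S \<noteq> bot"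
    and der: "(c has_vector_derivative \<xi>) (at x within S)" and \<epsilon>: "\<epsilon> > 0"
  obtains d where "d > 0" "\<And>r s. r \<in> S \<Longrightarrow> s \<in> S \<Longrightarrow> r \<le> x \<Longrightarrow> x \<le> s \<Longrightarrow> s - r < d \<Longrightarrow>
      \<exists>l\<le>(s - r) * (cone_norm (c x) \<xi> + \<epsilon>). twistor_chain (c r) l (c s)"
proof -
  let ?p = "c x"
  have p: "?p \<in> Per q" using c x by blast
  have \<xi>: "\<xi> \<in> tangent_space (Per q) ?p" using velocity_in_tangent_space[OF der nt x c] .
  obtain \<alpha> \<beta> where ab: "\<alpha> \<bullet> (?p *v \<beta>) > 0" using exists_frame[OF p] .
  let ?F = "frame \<alpha> \<beta>"
  have lF: "bounded_linear ?F" by (rule bounded_linear_frame)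
  define u v where "u = ?p *v \<alpha>" and "v = ?p *v \<beta>"
  let ?z0 = "(u, v)"
  have Fp: "?F ?p = ?z0" by (simp add: frame_def u_def v_def)
  have z0: "pos2 q ?z0" using frame_section(2)[OF p ab] Fp by simp
  have pz0: "plane ?z0 = ?p" using frame_section(1)[OF p ab] Fp by simp
  have "\<epsilon> / 3 > 0" using \<epsilon> by simp
  from cone_norm_approx[OF p \<xi> this] obtain L where L: "set L \<subseteq> twistor_cone q ?p" "sum_list L = \<xi>"
    "(\<Sum>\<eta>\<leftarrow>L. len ?p \<eta>) < cone_norm ?p \<xi> + \<epsilon> / 3" .
  have "\<exists>f w. pos3 q ?z0 w \<and> (\<exists>a b. f = (a *\<^sub>R w, b *\<^sub>R w)) \<and> \<eta> = dplane ?z0 f \<and>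
      fst (?F \<eta>) - fst f \<in> span {u, v} \<and> snd (?F \<eta>) - snd f \<in> span {u, v}" if \<eta>: "\<eta> \<in> set L" for \<eta>
  proof -
    obtain a b w where w: "B w u = 0" "B w v = 0" "q w > 0"
      "\<eta> *v \<alpha> - a *\<^sub>R w \<in> span {u, v}" "\<eta> *v \<beta> - b *\<^sub>R w \<in> span {u, v}"
      "\<eta> = dplane ?z0 (a *\<^sub>R w, b *\<^sub>R w)"
      using twistor_coneE[OF _ p ab, of \<eta>] L(1) \<eta> unfolding Fp u_def[symmetric] v_def[symmetric] by blast
    then have "pos3 q ?z0 w" using pos3I[OF z0] by simp
    then show ?thesis using w(4-6) unfolding frame_def by fastforce
  qed
  then obtain f w where f: "\<And>\<eta>. \<eta> \<in> set L \<Longrightarrow> pos3 q ?z0 (w \<eta>) \<and> (\<exists>a b. f \<eta> = (a *\<^sub>R w \<eta>, b *\<^sub>R w \<eta>)) \<and>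
      \<eta> = dplane ?z0 (f \<eta>) \<and> fst (?F \<eta>) - fst (f \<eta>) \<in> span {u, v} \<and> snd (?F \<eta>) - snd (f \<eta>) \<in> span {u, v}"
    by metis
  let ?fs = "map f L"
  define V where "V = sum_list ?fs"
  \<comment> \<open>the velocity of the frame differs from the sum of the turns by a change of basis of the plane\<close>
  have "fst (?F (sum_list L') ) - fst (sum_list (map f L')) \<in> span {u, v} \<and>
      snd (?F (sum_list L') ) - snd (sum_list (map f L')) \<in> span {u, v}" if "set L' \<subseteq> set L" for L'
    using that
  proof (induction L')
    case Nil
    then show ?case using linear_0[OF bounded_linear.linear[OF lF]] by (simp add: span_zero)
  next
    case (Cons \<eta> L')
    have "fst (?F \<eta>) - fst (f \<eta>) + (fst (?F (sum_list L') ) - fst (sum_list (map f L'))) \<in> span {u, v}"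
      "snd (?F \<eta>) - snd (f \<eta>) + (snd (?F (sum_list L') ) - snd (sum_list (map f L'))) \<in> span {u, v}"
      using f[of \<eta>] Cons by (auto intro!: span_add)
    then show ?case by (simp add: linear_add[OF bounded_linear.linear[OF lF]] algebra_simps)
  qed
  from this[of L] have "fst (?F \<xi>) - fst V \<in> span {u, v}" "snd (?F \<xi>) - snd V \<in> span {u, v}"
    by (simp_all add: L(2) V_def)
  then obtain m1 m2 m3 m4 where m: "fst (?F \<xi>) - fst V = m1 *\<^sub>R u + m2 *\<^sub>R v"
    "snd (?F \<xi>) - snd V = m3 *\<^sub>R u + m4 *\<^sub>R v" unfolding span_pair_iff by metis
  \<comment> \<open>undoing this change of basis at constant speed gives a frame \<open>Z s\<close> of \<open>c s\<close> with \<open>Z' x = V\<close>\<close>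
  define Z where "Z s = ((1 - (s - x) * m1) *\<^sub>R (c s *v \<alpha>) + (0 - (s - x) * m2) *\<^sub>R (c s *v \<beta>),
      (0 - (s - x) * m3) *\<^sub>R (c s *v \<alpha>) + (1 - (s - x) * m4) *\<^sub>R (c s *v \<beta>))" for s
  have Zx: "Z x = ?z0" by (simp add: Z_def u_def v_def)
  have Zder: "(Z has_vector_derivative V) (at x within S)"
  proof -
    have l: "bounded_linear (\<lambda>p :: real ^ 'n ^ 'n. p *v y)" for y :: "real ^ 'n"
      using bounded_linear_compose[OF bounded_linear_fst bounded_linear_frame[of y y]]
      by (simp add: frame_def)
    have dv: "((\<lambda>s. c s *v y) has_vector_derivative \<xi> *v y) (at x within S)" for y
      using bounded_linear.has_vector_derivative[OF l der] .
    have ds: "((\<lambda>s. k - (s - x) * m) has_real_derivative - m) (at x within S)" for k m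
      by (auto intro!: derivative_eq_intros)
    have comb: "((\<lambda>s. (k - (s - x) * m) *\<^sub>R (c s *v \<alpha>) + (k' - (s - x) * m') *\<^sub>R (c s *v \<beta>)) has_vector_derivative
        k *\<^sub>R (\<xi> *v \<alpha>) + (- m) *\<^sub>R u + (k' *\<^sub>R (\<xi> *v \<beta>) + (- m') *\<^sub>R v)) (at x within S)" for k m k' m'
      using has_vector_derivative_add[OF has_vector_derivative_scaleR[OF ds dv] has_vector_derivative_scaleR[OF ds dv], of k m \<alpha> k' m' \<beta>]
      by (simp add: u_def v_def)
    have V: "fst V = 1 *\<^sub>R (\<xi> *v \<alpha>) + (- m1) *\<^sub>R u + (0 *\<^sub>R (\<xi> *v \<beta>) + (- m2) *\<^sub>R v)"
      "snd V = 0 *\<^sub>R (\<xi> *v \<alpha>) + (- m3) *\<^sub>R u + (1 *\<^sub>R (\<xi> *v \<beta>) + (- m4) *\<^sub>R v)"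
      using m by (simp_all add: frame_def algebra_simps)
    have "(Z has_vector_derivative (fst V, snd V)) (at x within S)"
      unfolding Z_def[abs_def] V
      by (rule has_vector_derivative_Pair[OF comb[of 1 m1 0 m2] comb[of 0 m3 1 m4]])
    then show ?thesis by simp
  qed
  have "\<exists>R>0. \<forall>h\<in>set ?fs. turns_on (ball ?z0 R) h"
  proof -
    have "\<exists>R>0. \<forall>\<eta>\<in>set L'. turns_on (ball ?z0 R) (f \<eta>)" if "set L' \<subseteq> set L" for L'
      using that
    proof (induction L')
      case Nil
      then show ?case by (intro exI[of _ 1]) simp
    next
      case (Cons \<eta> L')
      then obtain R1 where R1: "R1 > 0" "\<forall>\<eta>\<in>set L'. turns_on (ball ?z0 R1) (f \<eta>)" by auto
      have w: "pos3 q ?z0 (w \<eta>)" "\<exists>a b. f \<eta> = (a *\<^sub>R w \<eta>, b *\<^sub>R w \<eta>)" using f Cons.prems by auto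
      obtain R2 where R2: "R2 > 0" "\<And>z'. dist z' ?z0 < R2 \<Longrightarrow> pos3 q z' (w \<eta>)"
        using pos3_ball[OF w(1)] by (metis dist_self)
      have "turns_on (ball ?z0 R2) (f \<eta>)"
        unfolding turns_on_def using w(2) R2(2) by (metis mem_ball dist_commute)
      then show ?case using R1 R2(1)
        by (intro exI[of _ "min R1 R2"]) (auto intro: turns_on_subset)
    qed
    then show ?thesis by auto
  qed
  then obtain R1 where R1: "R1 > 0" "\<And>h. h \<in> set ?fs \<Longrightarrow> turns_on (ball ?z0 R1) h" by blast
  define e1 where "e1 = \<epsilon> / 3 / (real (length L) + 1)"
  have e1: "e1 > 0" "e1 * real (length L) \<le> \<epsilon> / 3"
  proof -
    show "e1 > 0" using \<epsilon> by (simp add: e1_def)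
    have "e1 * real (length L) \<le> e1 * (real (length L) + 1)" using \<open>e1 > 0\<close> by simp
    also have "\<dots> = \<epsilon> / 3"
      unfolding e1_def by (rule nonzero_eq_divide_eq[THEN iffD1, OF _ refl]) simp
    finally show "e1 * real (length L) \<le> \<epsilon> / 3" .
  qed
  have "\<exists>R>0. \<forall>h\<in>set ?fs. \<forall>z\<in>ball ?z0 R. lift_len z h < lift_len ?z0 h + e1"
  proof -
    have "\<forall>h\<in>set ?fs. \<forall>\<^sub>F z in nhds ?z0. lift_len z h < lift_len ?z0 h + e1"
    proof
      fix h
      have "((\<lambda>z. lift_len z h) \<longlongrightarrow> lift_len ?z0 h) (nhds ?z0)"
        by (rule tendsto_lift_len[OF z0 _ tendsto_const]) (simp add: filterlim_ident)
      then show "\<forall>\<^sub>F z in nhds ?z0. lift_len z h < lift_len ?z0 h + e1"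
        by (rule order_tendstoD) (use e1 in simp)
    qed
    then have "\<forall>\<^sub>F z in nhds ?z0. \<forall>h\<in>set ?fs. lift_len z h < lift_len ?z0 h + e1"
      by (intro eventually_ball_finite) auto
    then obtain R where "R > 0" "\<And>z. dist z ?z0 < R \<Longrightarrow> \<forall>h\<in>set ?fs. lift_len z h < lift_len ?z0 h + e1"
      unfolding eventually_nhds_metric by blast
    then show ?thesis by (metis mem_ball dist_commute)
  qed
  then obtain R2 where R2: "R2 > 0" "\<And>h z. h \<in> set ?fs \<Longrightarrow> z \<in> ball ?z0 R2 \<Longrightarrow> lift_len z h < lift_len ?z0 h + e1"
    by blast
  obtain R3 Li where R3: "R3 > 0" "Li > 0" "\<And>z z'. z \<in> ball ?z0 R3 \<Longrightarrow> z' \<in> ball ?z0 R3 \<Longrightarrow>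
       \<exists>l\<le>Li * norm (z' - z). twistor_chain (plane z) l (plane z')"
    using twistor_chain_lipschitz[OF z0] by metis
  obtain R4 where R4: "R4 > 0" "ball ?z0 R4 \<subseteq> {z. pos2 q z}"
    using openE[OF open_pos2, of ?z0] z0 by (metis mem_Collect_eq)
  define R where "R = min (min R1 R2) (min R3 R4)"
  have R: "R > 0" "R \<le> R1" "R \<le> R2" "R \<le> R3" "R \<le> R4" using R1 R2 R3 R4 by (auto simp: R_def)
  have pos2_R: "pos2 q z" if "z \<in> ball ?z0 R" for z
    using subsetD[OF R4(2) subsetD[OF subset_ball[OF R(5)] that]] by simp
  define N where "N = (\<Sum>h\<leftarrow>?fs. norm h)"
  have N: "N \<ge> 0" unfolding N_def by (intro sum_list_nonneg) auto
  \<comment> \<open>the corrected frame spans the same plane near \<open>x\<close>\<close>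
  have plane_Z: "\<forall>\<^sub>F s in at x within S. plane (Z s) = c s"
  proof -
    have "((\<lambda>s. \<alpha> \<bullet> (c s *v \<beta>)) \<longlongrightarrow> \<alpha> \<bullet> (?p *v \<beta>)) (at x within S)"
    proof -
      have "(c \<longlongrightarrow> ?p) (at x within S)"
        using has_vector_derivative_continuous[OF der] by (simp add: continuous_within)
      then have "((\<lambda>s. snd (?F (c s))) \<longlongrightarrow> snd (?F ?p)) (at x within S)"
        by (intro tendsto_intros bounded_linear.tendsto[OF lF])
      then show ?thesis unfolding frame_def by (intro tendsto_intros) simp
    qed
    then have 1: "\<forall>\<^sub>F s in at x within S. \<alpha> \<bullet> (c s *v \<beta>) > 0" using ab by (rule order_tendstoD)
    have "((\<lambda>s. (1 - (s - x) * m1) * (1 - (s - x) * m4) - (0 - (s - x) * m2) * (0 - (s - x) * m3)) \<longlongrightarrow>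
        (1 - (x - x) * m1) * (1 - (x - x) * m4) - (0 - (x - x) * m2) * (0 - (x - x) * m3)) (at x within S)"
      by (intro tendsto_intros)
    then have 2: "\<forall>\<^sub>F s in at x within S.
        (1 - (s - x) * m1) * (1 - (s - x) * m4) - (0 - (s - x) * m2) * (0 - (s - x) * m3) > 0"
      by (rule order_tendstoD) simp
    have 3: "\<forall>\<^sub>F s in at x within S. s \<in> S" by (simp add: eventually_at_filter)
    show ?thesis using 1 2 3
    proof eventually_elim
      case (elim s)
      have "plane (Z s) = plane (c s *v \<alpha>, c s *v \<beta>)" unfolding Z_def by (rule plane_comb[OF elim(2)])
      also have "\<dots> = c s" using frame_section(1)[OF _ elim(1)] c elim(3) unfolding frame_def by blast
      finally show ?case .
    qed
  qed
  define e2 where "e2 = \<epsilon> / 3 / Li"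
  have e2: "e2 > 0" using \<epsilon> R3(2) by (simp add: e2_def)
  obtain d1 where d1: "d1 > 0" "\<And>s. s \<in> S \<Longrightarrow> s \<noteq> x \<Longrightarrow> dist s x < d1 \<Longrightarrow> plane (Z s) = c s"
    using plane_Z unfolding eventually_at by blast
  obtain d2 where d2: "d2 > 0" "\<And>s. s \<in> S \<Longrightarrow> norm (s - x) < d2 \<Longrightarrow>
      norm (Z s - Z x - (s - x) *\<^sub>R V) \<le> e2 * norm (s - x)"
    using Zder e2 unfolding has_vector_derivative_def has_derivative_within_alt by blast
  define K where "K = norm V + e2 + N + 1"
  have K: "K > 0" using e2 N by (simp add: K_def add_nonneg_pos)
  define d where "d = min (min d1 d2) (R / K / 2)"
  show ?thesis
  proof (rule that[of d])
    show "d > 0" using d1 d2 R K by (simp add: d_def)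
    fix r s assume rs: "r \<in> S" "s \<in> S" "r \<le> x" "x \<le> s" "s - r < d"
    have dd: "d \<le> d1" "d \<le> d2" "d \<le> R / K / 2" by (auto simp: d_def)
    let ?t = "s - r"
    have t: "?t \<ge> 0" using rs by simp
    have "d * K \<le> R / K / 2 * K" using dd(3) K by (intro mult_right_mono) auto
    moreover have "?t * K < d * K" using rs(5) K by (intro mult_strict_right_mono) auto
    moreover have "R / K / 2 * K = R / 2" using K by simp
    ultimately have tK: "?t * K < R / 2" by linarith
    have Zc: "plane (Z y) = c y" if "y \<in> S" "\<bar>y - x\<bar> \<le> ?t" for y
      using d1(2)[OF that(1)] that(2) rs(5) dd(1) Zx pz0 by (cases "y = x") (auto simp: dist_real_def)
    have Zn: "norm (Z y - ?z0 - (y - x) *\<^sub>R V) \<le> e2 * \<bar>y - x\<bar>" if "y \<in> S" "\<bar>y - x\<bar> \<le> ?t" for y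
      using d2(2)[OF that(1)] that(2) rs(5) dd(2) Zx by simp
    have Zb: "dist (Z y) ?z0 \<le> ?t * (norm V + e2)" if y: "y \<in> S" "\<bar>y - x\<bar> \<le> ?t" for y
    proof -
      have "norm (Z y - ?z0) \<le> norm (Z y - ?z0 - (y - x) *\<^sub>R V) + norm ((y - x) *\<^sub>R V)"
        using norm_triangle_ineq[of "Z y - ?z0 - (y - x) *\<^sub>R V" "(y - x) *\<^sub>R V"] by simp
      also have "\<dots> \<le> e2 * \<bar>y - x\<bar> + \<bar>y - x\<bar> * norm V" using Zn[OF y] by simp
      also have "\<dots> = \<bar>y - x\<bar> * (norm V + e2)" by (simp add: algebra_simps)
      also have "\<dots> \<le> ?t * (norm V + e2)" using y(2) e2 by (intro mult_right_mono) auto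
      finally show ?thesis by (simp add: dist_norm)
    qed
    have r: "\<bar>r - x\<bar> \<le> ?t" and s: "\<bar>s - x\<bar> \<le> ?t" using rs by auto
    let ?hs = "map ((*\<^sub>R) ?t) ?fs"
    have hs: "sum_list ?hs = ?t *\<^sub>R V" unfolding V_def using linear_sum_list[OF linear_scaleR] by metis
    have nhs: "(\<Sum>h\<leftarrow>?hs. norm h) = ?t * N"
    proof -
      have "(\<Sum>h\<leftarrow>?hs. norm h) = (\<Sum>h\<leftarrow>?fs. ?t * norm h)" using t by (simp add: o_def)
      also have "\<dots> = ?t * N" unfolding N_def by (rule sum_list_const_mult)
      finally show ?thesis .
    qed
    have sum: "dist (Z r) ?z0 + ?t * N \<le> ?t * K"
      using Zb[OF rs(1) r] t by (simp add: K_def algebra_simps)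
    have chain1: "twistor_chain (plane (Z r)) (\<Sum>h\<leftarrow>?hs. lift_len ?z0 h + ?t * e1) (plane (Z r + sum_list ?hs))"
    proof (rule twistor_chain_moves[where ?z0.0 = ?z0 and R = R])
      show "pos2 q z" if "z \<in> ball ?z0 R" for z using pos2_R[OF that] .
      show "turns_on (ball ?z0 R) h" if h: "h \<in> set ?hs" for h
      proof -
        obtain h' where h': "h' \<in> set ?fs" "h = ?t *\<^sub>R h'"
          using h unfolding set_map[of "(*\<^sub>R) ?t"] by (rule imageE) (rule that)
        show ?thesis unfolding h'(2)
          by (rule turns_on_scale[OF turns_on_subset[OF R1(2)[OF h'(1)] subset_ball[OF R(2)]]])
      qed
      show "lift_len z h \<le> lift_len ?z0 h + ?t * e1" if h: "h \<in> set ?hs" and z: "z \<in> ball ?z0 R" for h z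
      proof -
        obtain h' where h': "h' \<in> set ?fs" "h = ?t *\<^sub>R h'"
          using h unfolding set_map[of "(*\<^sub>R) ?t"] by (rule imageE) (rule that)
        have pz: "pos2 q z" using pos2_R[OF z] .
        have "?t * lift_len z h' \<le> ?t * (lift_len ?z0 h' + e1)"
          using R2(2)[OF h'(1) subsetD[OF subset_ball[OF R(3)] z]] t by (intro mult_left_mono) auto
        then show ?thesis using lift_len_scale[OF pz] lift_len_scale[OF z0] t
          unfolding h'(2) by (simp add: distrib_left)
      qed
      show "dist (Z r) ?z0 + (\<Sum>h\<leftarrow>?hs. norm h) < R"
        unfolding nhs using sum tK R(1) by linarith
    qed
    let ?y = "Z r + ?t *\<^sub>R V"
    have M: "(\<Sum>h\<leftarrow>?hs. lift_len ?z0 h + ?t * e1) \<le> ?t * (cone_norm ?p \<xi> + \<epsilon> / 3 + \<epsilon> / 3)"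
    proof -
      have ll: "lift_len ?z0 (f \<eta>) = len ?p \<eta>" if "\<eta> \<in> set L" for \<eta>
        using f[OF that] pz0 by (simp add: lift_len_def)
      have "(\<Sum>h\<leftarrow>?hs. lift_len ?z0 h + ?t * e1) = (\<Sum>\<eta>\<leftarrow>L. lift_len ?z0 (?t *\<^sub>R f \<eta>) + ?t * e1)"
        by (simp add: o_def)
      also have "\<dots> = (\<Sum>\<eta>\<leftarrow>L. ?t * (len ?p \<eta> + e1))"
      proof -
        have "lift_len ?z0 (?t *\<^sub>R f \<eta>) + ?t * e1 = ?t * (len ?p \<eta> + e1)" if "\<eta> \<in> set L" for \<eta>
          using lift_len_scale[OF z0, of ?t "f \<eta>"] ll[OF that] t by (simp add: distrib_left)
        then show ?thesis by (intro arg_cong[of _ _ sum_list] map_cong) auto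
      qed
      also have "\<dots> = ?t * ((\<Sum>\<eta>\<leftarrow>L. len ?p \<eta>) + e1 * real (length L))"
        by (simp add: sum_list_const_mult sum_list_addf sum_list_triv mult.commute)
      also have "\<dots> \<le> ?t * (cone_norm ?p \<xi> + \<epsilon> / 3 + \<epsilon> / 3)"
        using L(3) e1(2) t by (intro mult_left_mono) auto
      finally show ?thesis .
    qed
    have "norm (Z s - ?y) \<le> e2 * ?t"
    proof -
      have "Z s - ?y = (Z s - ?z0 - (s - x) *\<^sub>R V) - (Z r - ?z0 - (r - x) *\<^sub>R V)"
        by (simp add: algebra_simps)
      then have "norm (Z s - ?y) \<le> norm (Z s - ?z0 - (s - x) *\<^sub>R V) + norm (Z r - ?z0 - (r - x) *\<^sub>R V)"
        using norm_triangle_ineq4 by metis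
      also have "\<dots> \<le> e2 * \<bar>s - x\<bar> + e2 * \<bar>r - x\<bar>" using Zn[OF rs(2) s] Zn[OF rs(1) r] by simp
      also have "\<dots> = e2 * ?t" using rs(3,4) by (simp add: algebra_simps)
      finally show ?thesis .
    qed
    then have "Li * norm (Z s - ?y) \<le> Li * (e2 * ?t)" using R3(2) by simp
    also have "Li * (e2 * ?t) = ?t * (\<epsilon> / 3)" using R3(2) by (simp add: e2_def)
    finally have n3: "Li * norm (Z s - ?y) \<le> ?t * (\<epsilon> / 3)" .
    have "dist (Z s) ?z0 \<le> ?t * K"
      using Zb[OF rs(2) s] mult_nonneg_nonneg[OF t N] t by (simp add: K_def algebra_simps)
    then have b1: "Z s \<in> ball ?z0 R3" using tK R(1,4) by (simp add: dist_commute)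
    have "norm V \<le> N"
    proof -
      have "norm (sum_list hs) \<le> (\<Sum>h\<leftarrow>hs. norm h)" for hs :: "((real ^ 'n) \<times> (real ^ 'n)) list"
        by (induction hs) (auto intro: norm_triangle_le)
      then show ?thesis unfolding V_def N_def .
    qed
    then have "norm (?t *\<^sub>R V) \<le> ?t * N" using t by (simp add: mult_left_mono)
    moreover have y: "?y - ?z0 = (Z r - ?z0) + ?t *\<^sub>R V" by simp
    ultimately have "dist ?y ?z0 \<le> dist (Z r) ?z0 + ?t * N"
      using norm_triangle_ineq[of "Z r - ?z0" "?t *\<^sub>R V"] unfolding dist_norm y by linarith
    then have b2: "?y \<in> ball ?z0 R3" using sum tK R(1,4) by (simp add: dist_commute)
    obtain l where l: "l \<le> Li * norm (Z s - ?y)" "twistor_chain (plane ?y) l (plane (Z s))"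
      using R3(3)[OF b2 b1] by blast
    have "twistor_chain (c r) ((\<Sum>h\<leftarrow>?hs. lift_len ?z0 h + ?t * e1) + l) (c s)"
      using twistor_chain_trans[OF chain1[unfolded hs] l(2)] Zc[OF rs(1) r] Zc[OF rs(2) s] by simp
    moreover have "(\<Sum>h\<leftarrow>?hs. lift_len ?z0 h + ?t * e1) + l \<le> ?t * (cone_norm ?p \<xi> + \<epsilon>)"
    proof -
      have "?t * (cone_norm ?p \<xi> + \<epsilon>) = ?t * (cone_norm ?p \<xi> + \<epsilon> / 3 + \<epsilon> / 3) + ?t * (\<epsilon> / 3)"
        by (simp add: field_simps)
      then show ?thesis using M l(1) n3 by linarith
    qed
    ultimately show "\<exists>l\<le>(s - r) * (cone_norm (c x) \<xi> + \<epsilon>). twistor_chain (c r) l (c s)" by blast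
  qed
qed

text \<open>The local estimates hold on intervals that contain the point, not only on one side of it, which
  is the form that the bisection lemma needs. By continuity, the norm of the velocity at \<open>x\<close> times
  the length of a short interval around \<open>x\<close> is at most the integral over the interval plus a small
  multiple of its length.\<close>

lemma twistor_chain_piece:
  fixes c :: "real \<Rightarrow> real ^ 'n ^ 'n"
  assumes ab: "a < b" and sm: "smooth_map {a..b} c" and c: "c ` {a..b} \<subseteq> Per q" and \<epsilon>: "\<epsilon> > 0"
  obtains l where "l \<le> integral {a..b} (\<lambda>s. cone_norm (c s) (vector_derivative c (at s within {a..b}))) + \<epsilon>"
    "twistor_chain (c a) l (c b)"
proof -
  let ?h = "\<lambda>s. cone_norm (c s) (vector_derivative c (at s within {a..b}))"
  have cont: "continuous_on {a..b} ?h" by (rule piece_continuous[OF ab sm c continuous_on_cone_norm])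
  define e where "e = \<epsilon> / (b - a)"
  have e: "e > 0" using \<epsilon> ab by (simp add: e_def)
  define P where "P r s \<longleftrightarrow> (a \<le> r \<and> s \<le> b \<longrightarrow>
      (\<exists>l\<le>integral {r..s} ?h + (s - r) * e. twistor_chain (c r) l (c s)))" for r s
  have int: "?h integrable_on {r..s}" if "a \<le> r" "s \<le> b" for r s
    by (rule integrable_continuous_real, rule continuous_on_subset[OF cont]) (use that in auto)
  have "P a b" using less_imp_le[OF ab]
  proof (induction rule: Bolzano)
    case (trans r s t)
    show ?case unfolding P_def
    proof
      assume rt: "a \<le> r \<and> t \<le> b"
      obtain l1 where l1: "l1 \<le> integral {r..s} ?h + (s - r) * e" "twistor_chain (c r) l1 (c s)"
        using trans(1,4) rt unfolding P_def by force
      obtain l2 where l2: "l2 \<le> integral {s..t} ?h + (t - s) * e" "twistor_chain (c s) l2 (c t)"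
        using trans(2,3) rt unfolding P_def by force
      have "integral {r..s} ?h + integral {s..t} ?h = integral {r..t} ?h"
        by (rule Henstock_Kurzweil_Integration.integral_combine) (use trans int rt in auto)
      then have "l1 + l2 \<le> integral {r..t} ?h + (t - r) * e"
        using l1(1) l2(1) by (simp add: algebra_simps)
      then show "\<exists>l\<le>integral {r..t} ?h + (t - r) * e. twistor_chain (c r) l (c t)"
        using twistor_chain_trans[OF l1(2) l2(2)] by blast
    qed
  next
    case (local x)
    then have x: "x \<in> {a..b}" by simp
    have "e / 2 > 0" using e by simp
    from twistor_chain_local[OF c x _ smooth_map_has_vector_derivative[OF ab sm x] this]
    obtain d1 where d1: "d1 > 0" "\<And>r s. r \<in> {a..b} \<Longrightarrow> s \<in> {a..b} \<Longrightarrow> r \<le> x \<Longrightarrow> x \<le> s \<Longrightarrow> s - r < d1 \<Longrightarrow>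
      \<exists>l\<le>(s - r) * (?h x + e / 2). twistor_chain (c r) l (c s)"
      using ab x by (auto simp: trivial_limit_within)
    obtain d2 where d2: "d2 > 0" "\<And>y. y \<in> {a..b} \<Longrightarrow> dist y x < d2 \<Longrightarrow> dist (?h y) (?h x) < e / 2"
      using cont x \<open>e / 2 > 0\<close> unfolding continuous_on_iff by metis
    have "P r s" if rs: "r \<le> x" "x \<le> s" "s - r < min d1 d2" for r s
      unfolding P_def
    proof
      assume ars: "a \<le> r \<and> s \<le> b"
      obtain l where l: "l \<le> (s - r) * (?h x + e / 2)" "twistor_chain (c r) l (c s)"
        using d1(2)[of r s] rs ars by auto
      have "(s - r) * (?h x - e / 2) \<le> integral {r..s} ?h"
      proof -
        have "integral {r..s} (\<lambda>_. ?h x - e / 2) \<le> integral {r..s} ?h"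
        proof (rule integral_le)
          fix y assume y: "y \<in> {r..s}"
          then have "dist (?h y) (?h x) < e / 2"
            using rs ars by (intro d2(2)) (auto simp: dist_real_def)
          then show "?h x - e / 2 \<le> ?h y" unfolding dist_real_def by linarith
        qed (use int ars in auto)
        then show ?thesis using rs by simp
      qed
      moreover have "(s - r) * (?h x + e / 2) = (s - r) * (?h x - e / 2) + (s - r) * e"
        by (simp add: field_simps)
      ultimately have "l \<le> integral {r..s} ?h + (s - r) * e" using l(1) by linarith
      then show "\<exists>l\<le>integral {r..s} ?h + (s - r) * e. twistor_chain (c r) l (c s)" using l(2) by blast
    qed
    then show ?case using d1(1) d2(1) by (intro exI[of _ "min d1 d2"]) auto
  qed
  then show ?thesis using that ab unfolding P_def by (auto simp: e_def)
qed

text \<open>The errors of the finitely many pieces are made to add up to less than \<open>\<epsilon>\<close>.\<close>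

lemma twistor_chain_of_path:
  assumes "(t, c) \<in> paths (Per q) x y" and \<epsilon>: "\<epsilon> > 0"
  obtains l where "l \<le> path_len cone_norm (t, c) + \<epsilon>" "twistor_chain x l y"
proof -
  obtain n \<tau> where \<tau>: "\<tau> 0 = 0" "\<tau> n = t" "\<And>i. i < n \<Longrightarrow> \<tau> i < \<tau> (Suc i)"
      "\<And>i. i < n \<Longrightarrow> smooth_map {\<tau> i..\<tau> (Suc i)} c"
    using assms unfolding paths_def piecewise_smooth_def by blast
  have c: "c ` {0..\<tau> n} \<subseteq> Per q" "c 0 = x" "c t = y" "x \<in> Per q"
    using assms \<tau> unfolding paths_def by auto
  let ?I = "\<lambda>i. integral {\<tau> i..\<tau> (Suc i)}
      (\<lambda>s. cone_norm (c s) (vector_derivative c (at s within {\<tau> i..\<tau> (Suc i)})))"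
  have len: "path_len cone_norm (t, c) = (\<Sum>i<n. ?I i)"
    using integral_unique[OF path_pieces[OF \<tau>(1,3,4) c(1) continuous_on_cone_norm]]
    unfolding path_len_def \<tau>(2) by simp
  define e where "e = \<epsilon> / (real n + 1)"
  have e: "e > 0" using \<epsilon> by (simp add: e_def)
  have "\<exists>l\<le>(\<Sum>i<k. ?I i) + real k * e. twistor_chain x l (c (\<tau> k))" if "k \<le> n" for k
    using that
  proof (induction k)
    case 0
    then show ?case using twistor_chain.nil[OF c(4)] c(2) \<tau>(1) by auto
  next
    case (Suc k)
    then have k: "k < n" by simp
    have "0 \<le> \<tau> k" "\<tau> (Suc k) \<le> \<tau> n"
      using partition_le[of n \<tau> 0 k] partition_le[of n \<tau> "Suc k" n] \<tau> k by auto
    then have "c ` {\<tau> k..\<tau> (Suc k)} \<subseteq> Per q" using c(1) by force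
    from twistor_chain_piece[OF \<tau>(3)[OF k] \<tau>(4)[OF k] this e] obtain l' where
      l': "l' \<le> ?I k + e" "twistor_chain (c (\<tau> k)) l' (c (\<tau> (Suc k)))" .
    obtain l where l: "l \<le> (\<Sum>i<k. ?I i) + real k * e" "twistor_chain x l (c (\<tau> k))"
      using Suc by auto
    show ?case using twistor_chain_trans[OF l(2) l'(2)] l(1) l'(1)
      by (intro exI[of _ "l + l'"]) (simp add: algebra_simps)
  qed
  from this[of n] obtain l where l: "l \<le> (\<Sum>i<n. ?I i) + real n * e" "twistor_chain x l y"
    using \<tau>(2) c(3) by auto
  have "real n * e \<le> (real n + 1) * e" using e by simp
  also have "\<dots> = \<epsilon>" by (simp add: e_def)
  finally have "l \<le> path_len cone_norm (t, c) + \<epsilon>" unfolding len using l(1) by linarith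
  then show ?thesis using that l(2) by blast
qed

lemma subtwistor_le_finsler:
  "subtwistor_dist q g x y \<le> finsler_dist (Per q) cone_norm x y"
  unfolding finsler_dist_def
proof (rule INF_greatest)
  fix tc assume "tc \<in> paths (Per q) x y"
  moreover obtain t c where tc: "tc = (t, c)" by (cases tc)
  ultimately have p: "(t, c) \<in> paths (Per q) x y" by simp
  show "subtwistor_dist q g x y \<le> ereal (path_len cone_norm tc)"
  proof (rule ereal_le_epsilon2)
    fix e :: real assume e: "e > 0"
    obtain l where l: "l \<le> path_len cone_norm (t, c) + e" "twistor_chain x l y"
      using twistor_chain_of_path[OF p e] .
    obtain d where d: "d \<in> twistor_paths q x y" "path_len len d \<le> l" using twistor_chain_path[OF l(2)] by blast
    have "subtwistor_dist q g x y \<le> ereal (path_len len d)"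
      unfolding subtwistor_dist_def len_def[abs_def] by (rule INF_lower[OF d(1)])
    also have "\<dots> \<le> ereal (path_len cone_norm tc + e)" using d(2) l(1) tc by simp
    finally show "subtwistor_dist q g x y \<le> ereal (path_len cone_norm tc) + ereal e" by simp
  qed
qed

text \<open>Velocities of twistor paths lie in the cone, where \<open>cone_norm\<close> is at most the length; the finitely
  many times without a velocity do not affect the integrals.\<close>

lemma finsler_le_subtwistor:
  "finsler_dist (Per q) cone_norm x y \<le> subtwistor_dist q g x y"
  unfolding subtwistor_dist_def
proof (rule INF_greatest)
  fix tc assume tw: "tc \<in> twistor_paths q x y"
  obtain t c where tc: "tc = (t, c)" by (cases tc)
  have p: "(t, c) \<in> paths (Per q) x y"
    and cone: "\<And>s v. s \<in> {0..t} \<Longrightarrow> (c has_vector_derivative v) (at s within {0..t}) \<Longrightarrow> v \<in> twistor_cone q (c s)"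
    using tw tc unfolding twistor_paths_def by auto
  have cP: "c ` {0..t} \<subseteq> Per q" using p unfolding paths_def by blast
  obtain F where F: "finite F" "\<And>s. s \<in> {0..t} - F \<Longrightarrow> 0 < s \<and> s < t \<and>
       (c has_vector_derivative vector_derivative c (at s within {0..t})) (at s within {0..t}) \<and>
       vector_derivative c (at s within {0..t}) \<in> tangent_space (Per q) (c s)"
    using path_facts[OF p] by blast
  let ?d = "\<lambda>s. vector_derivative c (at s within {0..t})"
  let ?n = "\<lambda>s. cone_norm (c s) (?d s)" and ?l = "\<lambda>s. len (c s) (?d s)"
  have "path_len cone_norm (t, c) \<le> path_len len (t, c)"
  proof -
    have i: "?n integrable_on {0..t}" "?l integrable_on {0..t}"
      using path_integrable[OF p continuous_on_cone_norm] path_integrable[OF p continuous_on_len] by auto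
    have "((\<lambda>s. if s \<in> F then ?l s else ?n s) has_integral integral {0..t} ?n) {0..t}"
      by (rule has_integral_spike_finite[OF F(1) _ integrable_integral[OF i(1)]]) auto
    moreover have "(if s \<in> F then ?l s else ?n s) \<le> ?l s" if s: "s \<in> {0..t}" for s
    proof (cases "s \<in> F")
      case False
      then have "?d s \<in> twistor_cone q (c s)" using F(2)[of s] cone[OF s] s by blast
      moreover have "c s \<in> Per q" using cP s by blast
      ultimately show ?thesis using cone_norm_le_len[of "c s"] False by simp
    qed simp
    ultimately have "integral {0..t} ?n \<le> integral {0..t} ?l"
      using has_integral_le[OF _ integrable_integral[OF i(2)]] by blast
    then show ?thesis by (simp add: path_len_def)
  qed
  then have "ereal (path_len cone_norm tc) \<le> ereal (path_len (\<lambda>p v. sqrt (g p v v)) tc)"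
    unfolding tc len_def[abs_def] by simp
  moreover have "finsler_dist (Per q) cone_norm x y \<le> ereal (path_len cone_norm tc)"
    unfolding finsler_dist_def tc by (rule INF_lower[OF p])
  ultimately show "finsler_dist (Per q) cone_norm x y \<le> ereal (path_len (\<lambda>p v. sqrt (g p v v)) tc)"
    by (rule order_trans[rotated])
qed

end

lemma signature_positive_space:
  fixes q :: "'v::euclidean_space \<Rightarrow> real"
  assumes "has_signature q r s"
  obtains T where "subspace T" "dim T = r" "pos_def_on q T"
proof -
  obtain e :: "nat \<Rightarrow> 'v" where e: "inj_on e {..<r + s}" "independent (e ` {..<r + s})"
    "\<And>a. q (\<Sum>i<r + s. a i *\<^sub>R e i) = (\<Sum>i<r. (a i)\<^sup>2) - (\<Sum>i=r..<r + s. (a i)\<^sup>2)"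
    using assms unfolding has_signature_def by blast
  have sub: "{..<r} \<subseteq> {..<r + s}" by auto
  have inj: "inj_on e {..<r}" using e(1) sub by (rule inj_on_subset)
  have ind: "independent (e ` {..<r})" using independent_mono[OF e(2) image_mono[OF sub]] .
  show ?thesis
  proof (rule that[of "span (e ` {..<r})"])
    show "dim (span (e ` {..<r})) = r"
      using dim_span_eq_card_independent[OF ind] card_image[OF inj] by simp
    show "pos_def_on q (span (e ` {..<r}))"
      unfolding pos_def_on_def
    proof (intro ballI impI)
      fix x assume x: "x \<in> span (e ` {..<r})" "x \<noteq> 0"
      obtain k where "x = (\<Sum>v\<in>e ` {..<r}. k v *\<^sub>R v)"
        using x(1) unfolding span_finite[OF finite_imageI[OF finite_lessThan]] by auto
      then have x1: "x = (\<Sum>i<r. k (e i) *\<^sub>R e i)" by (simp add: sum.reindex[OF inj])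
      define a where "a i = (if i < r then k (e i) else 0)" for i
      have "(\<Sum>i<r + s. a i *\<^sub>R e i) = (\<Sum>i<r. a i *\<^sub>R e i)"
        by (rule sum.mono_neutral_right) (auto simp: a_def)
      also have "\<dots> = x" unfolding x1 by (intro sum.cong) (auto simp: a_def)
      finally have "q x = (\<Sum>i<r. (a i)\<^sup>2) - (\<Sum>i=r..<r + s. (a i)\<^sup>2)" using e(3)[of a] by simp
      also have "(\<Sum>i=r..<r + s. (a i)\<^sup>2) = 0" by (intro sum.neutral) (auto simp: a_def)
      finally have qx: "q x = (\<Sum>i<r. (k (e i))\<^sup>2)" by (simp add: a_def)
      obtain i where "i < r" "k (e i) \<noteq> 0" using x(2) unfolding x1 by (metis (no_types, lifting) lessThan_iff scaleR_zero_left sum.neutral)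
      then show "q x > 0" unfolding qx by (intro sum_pos2[of _ i]) auto
    qed
  qed simp
qed

theorem theorem3p1:
  fixes q :: "real ^ 'n \<Rightarrow> real"
    and g :: "real ^ 'n ^ 'n \<Rightarrow> real ^ 'n ^ 'n \<Rightarrow> real ^ 'n ^ 'n \<Rightarrow> real"
  assumes "quadratic_form q"
    and "has_signature q 3 (CARD('n) - 3)"
    and "riemannian_metric (Per q) g"
  shows "\<exists>\<nu>. finsler_norm (Per q) \<nu> \<and>
    (\<forall>x\<in>Per q. \<forall>y\<in>Per q. subtwistor_dist q g x y = finsler_dist (Per q) \<nu> x y)"
proof -
  obtain B where B: "bilinear B" "\<And>x y. B x y = B y x" "\<And>x. q x = B x x"
    using assms(1) unfolding quadratic_form_def by blast
  interpret period_metric q B g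
  proof
    show "\<exists>T. subspace T \<and> dim T = 3 \<and> pos_def_on q T"
      using signature_positive_space[OF assms(2)] by blast
  qed (use B assms(3) in auto)
  show ?thesis
    using finsler_norm_cone_norm subtwistor_le_finsler finsler_le_subtwistor antisym by blast
qed

end
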